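(* Consider the charged-particle system $\ddot x=\dot x\times B(x)+E(x)$, $x(0)=x_0$, $\dot x(0)=v_0$, with $E(x)=-\nabla U(x)$ and energy $H(x,v)=\frac12|v|^2+U(x)$. Let $(x^n,v^n)_{n\ge 0}$ denote the numerical solution with step size $h>0$ produced by the implicit splitting method IMS-O2 or the explicit splitting method EXS-O2, as indicated. (i) The method IMS-O2 exactly preserves the energy: $$H(x^n,v^n)=H(x^0,v^0)\qquad\text{for } nh\le T.$$ (ii) Assume that $B(x)\equiv B$ (constant magnetic field) or $U(x)=\frac12 x^\intercal Qx+q^\intercal x$ (quadratic scalar potential, with $Q$ a symmetric matrix). Then, for the method EXS-O2, the energy along the numerical solution is conserved over long times as $$H(x^n,v^n)=H(x^0,v^0)+\mathcal{O}(h^2)\qquad\text{for } nh\le h^{2-N},$$ with an arbitrarily large positive integer $N$. (iii) If the scalar potential is quadratic, $U(x)=\frac12 x^\intercal Qx+q^\intercal x$ with symmetric $Q$, then the method EXS-O2 exactly preserves the modified energy $$H_h(x,v)=\frac12|v|^2+U(x)-\frac{h^2}{8}|\nabla U(x)|^2$$ at the discrete level, that is, $$H_h(x^{n+1},v^{n+1})=H_h(x^n,v^n)\qquad\text{for } nh\le T.$$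
   Context: Setting: $x(t)\in\mathbb{R}^3$ is the position, $v=\dot x\in\mathbb{R}^3$ the velocity, $B:\mathbb{R}^3\to\mathbb{R}^3$ a magnetic field with $B=\nabla\times A$ for a vector potential $A$, $U:\mathbb{R}^3\to\mathbb{R}$ a scalar potential, $E(x)=-\nabla U(x)$, $|\cdot|$ the Euclidean norm, and $T>0$ a final time. $\tilde B(x)\in\mathbb{R}^{3\times3}$ is the skew-symmetric matrix with $\tilde B(x)v=v\times B(x)$ for all $v$. In the quadratic potential, $Q\in\mathbb{R}^{3\times3}$ is symmetric and $q\in\mathbb{R}^3$. Both methods are Strang splittings: half a step of the exact flow $(x,v)\mapsto(x,e^{\frac h2\tilde B(x)}v)$, then a full step of an integrator for $\dot x=v$, $\dot v=E(x)$, then again half a step of the first flow. Both start from $x^0=x_0$, $v^0=v_0$. Method IMS-O2 (the integrator for the second subflow is the average vector field method): for $n\ge0$, $$x^{n+1}=x^n+he^{\frac h2\tilde B(x^n)}v^n+\frac{h^2}{2}\int_0^1E\left(\rho x^n+(1-\rho)x^{n+1}\right)d\rho,$$ $$v^{n+1}=e^{\frac h2\tilde B(x^{n+1})}e^{\frac h2\tilde B(x^n)}v^n+he^{\frac h2\tilde B(x^{n+1})}\int_0^1E\left(\rho x^n+(1-\rho)x^{n+1}\right)d\rho.$$ Method EXS-O2: for $n\ge0$, $$x^{n+1}=x^n+he^{\frac h2\tilde B(x^n)}v^n+\frac{h^2}{2}E(x^n),$$ $$v^{n+1}=e^{\frac h2\tilde B(x^{n+1})}e^{\frac h2\tilde B(x^n)}v^n+\frac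 h2e^{\frac h2\tilde B(x^{n+1})}\left[E(x^n)+E(x^{n+1})\right].$$ Standing assumptions: $U(x)$ and $B(x)$ are arbitrarily differentiable functions of $x$, and there is a compact set, independent of $h$, in which the numerical solution $(x^n,v^n)$ produced by the considered method stays. The constant symbolized by $\mathcal{O}$ is independent of $n$ and $h$ (it may depend on $N$). *)

theory Defs
  imports "HOL-Analysis.Analysis"
begin

unbundle cross3_syntax

(* On a finite-dimensional domain this is C^k: all iterated directional derivatives of
   order at most k exist, and those of order k are continuous. *)
primrec higher_differentiable ::
  "nat \<Rightarrow> ('a::real_normed_vector \<Rightarrow> 'b::real_normed_vector) \<Rightarrow> bool" where
  "higher_differentiable 0 f \<longleftrightarrow> continuous_on UNIV f"
| "higher_differentiable (Suc k) f \<longleftrightarrow>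
     (\<forall>x. f differentiable (at x)) \<and>
     (\<forall>v. higher_differentiable k (\<lambda>x. frechet_derivative f (at x) v))"

definition smooth :: "('a::real_normed_vector \<Rightarrow> 'b::real_normed_vector) \<Rightarrow> bool" where
  "smooth f \<longleftrightarrow> (\<forall>k. higher_differentiable k f)"

definition partial_deriv :: "'n \<Rightarrow> (real ^ 'n::finite \<Rightarrow> 'b::real_normed_vector) \<Rightarrow> real ^ 'n \<Rightarrow> 'b" where
  "partial_deriv i f x = frechet_derivative f (at x) (axis i 1)"

definition grad :: "(real ^ 'n::finite \<Rightarrow> real) \<Rightarrow> real ^ 'n \<Rightarrow> real ^ 'n" where
  "grad f x = (\<chi> i. partial_deriv i f x)"

lemma GDERIV_grad:
  assumes "f differentiable (at x)"
  shows "GDERIV f x :> grad f x"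
proof -
  let ?D = "frechet_derivative f (at x)"
  have D: "(f has_derivative ?D) (at x)"
    using assms frechet_derivative_works by blast
  then have lin: "linear ?D"
    by (rule has_derivative_linear)
  have "?D h = inner h (grad f x)" for h
  proof -
    have "?D h = ?D (\<Sum>i\<in>UNIV. (h $ i) *\<^sub>R axis i 1)"
      by (simp add: basis_expansion flip: scalar_mult_eq_scaleR)
    also have "\<dots> = (\<Sum>i\<in>UNIV. (h $ i) *\<^sub>R ?D (axis i 1))"
      by (simp add: linear_sum[OF lin] linear_cmul[OF lin])
    finally show ?thesis
      by (simp add: inner_vec_def grad_def partial_deriv_def)
  qed
  then show ?thesis
    using D unfolding gderiv_def by (metis (no_types, lifting) ext)
qed

definition curl :: "(real ^ 3 \<Rightarrow> real ^ 3) \<Rightarrow> real ^ 3 \<Rightarrow> real ^ 3" where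
  "curl A x = vector
     [partial_deriv 2 A x $ 3 - partial_deriv 3 A x $ 2,
      partial_deriv 3 A x $ 1 - partial_deriv 1 A x $ 3,
      partial_deriv 1 A x $ 2 - partial_deriv 2 A x $ 1]"

definition electric_field :: "(real ^ 3 \<Rightarrow> real) \<Rightarrow> real ^ 3 \<Rightarrow> real ^ 3" where
  "electric_field U x = - grad U x"

definition magnetic_matrix :: "(real ^ 3 \<Rightarrow> real ^ 3) \<Rightarrow> real ^ 3 \<Rightarrow> real ^ 3 ^ 3" where
  "magnetic_matrix B x = matrix (\<lambda>v. v \<times> B x)"

lemma magnetic_matrix_vector_mult: "magnetic_matrix B x *v v = v \<times> B x"
proof -
  have "linear (\<lambda>v. v \<times> B x)"
    by (rule linearI) (simp_all add: cross_add_left cross_mult_left)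
  then show ?thesis
    by (simp add: magnetic_matrix_def matrix_works)
qed

(* The exp of Complex_Main needs a Banach algebra instance, and for the type real ^ 'n ^ 'n
   the class multiplication is entrywise; hence the power series is written with **. *)
definition matrix_exp :: "real ^ 'n::finite ^ 'n \<Rightarrow> real ^ 'n ^ 'n" where
  "matrix_exp M = (\<Sum>k. (1 / fact k) *\<^sub>R (((**) M ^^ k) (mat 1)))"

(* The scheme is implicit and is not claimed to be (uniquely) solvable: the predicate says
   that the sequences x and v form a numerical solution with step size h. *)
definition IMS_O2 ::
  "(real ^ 3 \<Rightarrow> real) \<Rightarrow> (real ^ 3 \<Rightarrow> real ^ 3) \<Rightarrow> real ^ 3 \<Rightarrow> real ^ 3 \<Rightarrow> real
    \<Rightarrow> (nat \<Rightarrow> real ^ 3) \<Rightarrow> (nat \<Rightarrow> real ^ 3) \<Rightarrow> bool" where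
  "IMS_O2 U B x0 v0 h x v \<longleftrightarrow>
     (let E = electric_field U; R = (\<lambda>y. matrix_exp ((h / 2) *\<^sub>R magnetic_matrix B y)) in
       x 0 = x0 \<and> v 0 = v0 \<and>
       (\<forall>n. let I = integral {0..1} (\<lambda>\<rho>. E (\<rho> *\<^sub>R x n + (1 - \<rho>) *\<^sub>R x (Suc n))) in
         x (Suc n) = x n + h *\<^sub>R (R (x n) *v v n) + (h\<^sup>2 / 2) *\<^sub>R I \<and>
         v (Suc n) = R (x (Suc n)) *v (R (x n) *v v n) + h *\<^sub>R (R (x (Suc n)) *v I)))"

definition EXS_O2 ::
  "(real ^ 3 \<Rightarrow> real) \<Rightarrow> (real ^ 3 \<Rightarrow> real ^ 3) \<Rightarrow> real ^ 3 \<Rightarrow> real ^ 3 \<Rightarrow> real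
    \<Rightarrow> (nat \<Rightarrow> real ^ 3) \<Rightarrow> (nat \<Rightarrow> real ^ 3) \<Rightarrow> bool" where
  "EXS_O2 U B x0 v0 h x v \<longleftrightarrow>
     (let E = electric_field U; R = (\<lambda>y. matrix_exp ((h / 2) *\<^sub>R magnetic_matrix B y)) in
       x 0 = x0 \<and> v 0 = v0 \<and>
       (\<forall>n. x (Suc n) = x n + h *\<^sub>R (R (x n) *v v n) + (h\<^sup>2 / 2) *\<^sub>R E (x n) \<and>
            v (Suc n) = R (x (Suc n)) *v (R (x n) *v v n)
              + (h / 2) *\<^sub>R (R (x (Suc n)) *v (E (x n) + E (x (Suc n))))))"

definition energy :: "(real ^ 3 \<Rightarrow> real) \<Rightarrow> real ^ 3 \<Rightarrow> real ^ 3 \<Rightarrow> real" where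
  "energy U x v = (norm v)\<^sup>2 / 2 + U x"

definition modified_energy :: "(real ^ 3 \<Rightarrow> real) \<Rightarrow> real \<Rightarrow> real ^ 3 \<Rightarrow> real ^ 3 \<Rightarrow> real" where
  "modified_energy U h x v = (norm v)\<^sup>2 / 2 + U x - h\<^sup>2 / 8 * (norm (grad U x))\<^sup>2"

definition constant_field :: "(real ^ 3 \<Rightarrow> real ^ 3) \<Rightarrow> bool" where
  "constant_field B \<longleftrightarrow> (\<exists>b. \<forall>x. B x = b)"

definition quadratic_potential :: "(real ^ 3 \<Rightarrow> real) \<Rightarrow> bool" where
  "quadratic_potential U \<longleftrightarrow>
     (\<exists>Q q. transpose Q = Q \<and> (\<forall>x. U x = (x \<bullet> (Q *v x)) / 2 + q \<bullet> x))"

end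

theory Submission
  imports Defs
begin

text \<open>
  Exact conservation is a matter of algebra. The matrix exponential of the field is a rotation
  (\<open>matrix_exp_cross\<close>, Rodrigues' formula) and leaves the speed unchanged, so only the
  electric substep can change the energy. The averaged force does exactly the work required by the
  potential (\<open>IMS_O2_energy_step\<close>). In the explicit scheme the energy defect of a step with
  quadratic potential is itself a difference of end values and is absorbed by the modified energy
  (\<open>EXS_O2_modified_energy_step\<close>); as that energy differs from the true one by \<open>O(h\<^sup>2)\<close>
  on bounded sets, the long-time statement for quadratic potentials follows at once.

  The substance is the explicit scheme in a constant field with an arbitrary potential. There the
  positions satisfy the two-step recurrence
  \<open>d\<^sub>n - d\<^sub>n\<^sub>-\<^sub>1 = \<tau> (d\<^sub>n + d\<^sub>n\<^sub>-\<^sub>1) \<times> b - h\<^sup>2 \<nabla>U(x\<^sub>n)\<close> with increments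
  \<open>d\<^sub>n = x\<^sub>n\<^sub>+\<^sub>1 - x\<^sub>n\<close> (\<open>EXS_O2_constant_field\<close>). Backward error analysis would replace
  it by a modified differential equation, multiply by the velocity, and find total derivatives.
  The proof performs this multiplication on the discrete level: the recurrence is tested with a
  central difference \<open>D x\<^sub>n\<close> of high order instead of the velocity. As \<open>D\<close> is antisymmetric, the
  second difference symmetric and the magnetic term skew, the first two contributions telescope
  exactly (\<open>kinetic_ladder_diff\<close>, \<open>magnetic_ladder_diff\<close>), and the third one telescopes up to
  the error in the chain rule \<open>D U(x\<^sub>n) \<approx> \<nabla>U(x\<^sub>n) \<bullet> D x\<^sub>n\<close>. The result is a discrete energy whose
  change per step is of arbitrarily high order in \<open>h\<close> and which agrees with the energy up to
  \<open>O(h\<^sup>2)\<close> (\<open>discrete_energy_expansion\<close>).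

  The error in the chain rule is small only if the points \<open>x\<^sub>n\<close> lie on a curve with bounded
  derivatives. That is a discrete regularity statement (\<open>boris_orbit_fdiff_bounded\<close>): by the
  recurrence, every \<open>k\<close>-th difference of a bounded trajectory is \<open>O(h ^ k)\<close>, uniformly in time, and
  Newton interpolation turns these bounds into the required curve on each window
  (\<open>interpolating_curve\<close>). No solution of a differential equation enters.
\<close>

section \<open>Functions of one variable with bounded derivatives\<close>

text \<open>Differentiability is required everywhere but the bounds only for \<open>\<bar>t\<bar> \<le> r\<close>: the curves
below are defined on the whole line, yet controlled only on a window of fixed size. The recursion on the order makes
the product and chain rules plain inductions.\<close>

primrec bounded_derivs :: "nat \<Rightarrow> real \<Rightarrow> real \<Rightarrow> (real \<Rightarrow> real) \<Rightarrow> bool" where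
  "bounded_derivs 0 C r g \<longleftrightarrow> (\<forall>t. \<bar>t\<bar> \<le> r \<longrightarrow> \<bar>g t\<bar> \<le> C)"
| "bounded_derivs (Suc K) C r g \<longleftrightarrow>
     (\<forall>t. \<bar>t\<bar> \<le> r \<longrightarrow> \<bar>g t\<bar> \<le> C) \<and> (\<forall>t. g differentiable (at t)) \<and> bounded_derivs K C r (deriv g)"

lemma bounded_derivs_SucI:
  assumes "\<And>t. \<bar>t\<bar> \<le> r \<Longrightarrow> \<bar>g t\<bar> \<le> C"
    and "\<And>t. (g has_real_derivative g' t) (at t)" and "bounded_derivs K C r g'"
  shows "bounded_derivs (Suc K) C r g"
proof -
  have "deriv g = g'"
    using assms(2) by (auto intro: DERIV_imp_deriv)
  then show ?thesis
    using assms by (auto simp: real_differentiable_def)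
qed

lemma bounded_derivs_bound: "bounded_derivs K C r g \<Longrightarrow> \<bar>t\<bar> \<le> r \<Longrightarrow> \<bar>g t\<bar> \<le> C"
  by (cases K) auto

lemma bounded_derivs_mono: "bounded_derivs K C r g \<Longrightarrow> C \<le> C' \<Longrightarrow> bounded_derivs K C' r g"
  by (induction K arbitrary: g) (auto intro: order_trans)

lemma bounded_derivs_SucD: "bounded_derivs (Suc K) C r g \<Longrightarrow> bounded_derivs K C r g"
  by (induction K arbitrary: g) auto

lemma bounded_derivs_le: "bounded_derivs K C r g \<Longrightarrow> k \<le> K \<Longrightarrow> bounded_derivs k C r g"
  by (induction K) (use bounded_derivs_SucD le_Suc_eq in blast)+

lemma bounded_derivs_deriv:
  "bounded_derivs (Suc K) C r g \<Longrightarrow> (g has_real_derivative deriv g t) (at t)"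
  by (simp add: DERIV_deriv_iff_real_differentiable)

lemma bounded_derivs_DERIV:
  "bounded_derivs K C r g \<Longrightarrow> 0 < K \<Longrightarrow> (g has_real_derivative deriv g t) (at t)"
  by (cases K) (auto simp: DERIV_deriv_iff_real_differentiable)

lemma bounded_derivs_const: "\<bar>c\<bar> \<le> C \<Longrightarrow> bounded_derivs K C r (\<lambda>t. c)"
proof (induction K arbitrary: c)
  case (Suc K)
  then have "0 \<le> C" by linarith
  with Suc show ?case
    by (intro bounded_derivs_SucI[where g' = "\<lambda>_. 0"]) auto
qed auto

lemma bounded_derivs_shift: "\<bar>c\<bar> \<le> s \<Longrightarrow> bounded_derivs K (r + s + 1) r (\<lambda>t. t + c)" if "0 \<le> r"
proof (cases K)
  case (Suc k)
  assume "\<bar>c\<bar> \<le> s"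
  then show ?thesis
    unfolding Suc using that
    by (intro bounded_derivs_SucI[where g' = "\<lambda>_. 1"] bounded_derivs_const)
       (auto intro!: derivative_eq_intros)
qed auto

lemma bounded_derivs_add:
  "bounded_derivs K C r f \<Longrightarrow> bounded_derivs K D r g \<Longrightarrow> bounded_derivs K (C + D) r (\<lambda>t. f t + g t)"
proof (induction K arbitrary: f g)
  case 0
  then show ?case by (auto intro: order_trans[OF abs_triangle_ineq add_mono])
next
  case (Suc K)
  show ?case
  proof (rule bounded_derivs_SucI)
    show "((\<lambda>t. f t + g t) has_real_derivative deriv f t + deriv g t) (at t)" for t
      using Suc.prems[THEN bounded_derivs_deriv] by (rule DERIV_add)
    show "bounded_derivs K (C + D) r (\<lambda>t. deriv f t + deriv g t)"
      using Suc by simp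
  qed (use Suc.prems in \<open>auto intro: order_trans[OF abs_triangle_ineq add_mono]\<close>)
qed

lemma bounded_derivs_sum:
  assumes "finite S" and "\<And>i. i \<in> S \<Longrightarrow> bounded_derivs K (C i) r (f i)"
  shows "bounded_derivs K (\<Sum>i\<in>S. C i) r (\<lambda>t. \<Sum>i\<in>S. f i t)"
  using assms by (induction) (auto intro: bounded_derivs_add bounded_derivs_const)

text \<open>Each differentiation of a product doubles the number of terms, whence the factor
\<open>2 ^ K\<close>.\<close>

lemma bounded_derivs_mult:
  assumes "0 \<le> C" "0 \<le> D"
  shows "bounded_derivs K C r f \<Longrightarrow> bounded_derivs K D r g
    \<Longrightarrow> bounded_derivs K (2 ^ K * (C * D)) r (\<lambda>t. f t * g t)"
proof (induction K arbitrary: f g)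
  case 0
  then show ?case by (auto simp: abs_mult assms intro!: mult_mono)
next
  case (Suc K)
  have "\<bar>f t * g t\<bar> \<le> 2 ^ Suc K * (C * D)" if "\<bar>t\<bar> \<le> r" for t
  proof -
    have "\<bar>f t * g t\<bar> \<le> C * D"
      using Suc.prems that assms by (auto simp: abs_mult intro!: mult_mono)
    also have "1 * (C * D) \<le> 2 ^ Suc K * (C * D)"
      using assms by (intro mult_right_mono one_le_power) auto
    finally show ?thesis by simp
  qed
  moreover have "((\<lambda>t. f t * g t) has_real_derivative deriv f t * g t + deriv g t * f t) (at t)" for t
    using Suc.prems[THEN bounded_derivs_deriv] by (rule DERIV_mult)
  moreover have "bounded_derivs K (2 ^ K * (C * D) + 2 ^ K * (D * C)) r
      (\<lambda>t. deriv f t * g t + deriv g t * f t)"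
    using Suc.IH[of "deriv f" g] Suc.IH[of "f" "deriv g"] Suc.prems
      Suc.prems[THEN bounded_derivs_SucD]
    by (intro bounded_derivs_add) (auto simp: mult.commute)
  ultimately show ?case
    by (intro bounded_derivs_SucI) (auto simp: algebra_simps)
qed

lemma bounded_derivs_iterate:
  "bounded_derivs K C r g \<Longrightarrow> k \<le> K \<Longrightarrow> bounded_derivs (K - k) C r ((deriv ^^ k) g)"
proof (induction k)
  case (Suc k)
  then have "bounded_derivs (Suc (K - Suc k)) C r ((deriv ^^ k) g)"
    by (simp add: Suc_diff_Suc)
  then show ?case by simp
qed simp

lemma bounded_derivs_iterate_DERIV:
  assumes "bounded_derivs K C r g" "k < K"
  shows "((deriv ^^ k) g has_real_derivative (deriv ^^ Suc k) g t) (at t)"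
  using bounded_derivs_iterate[OF assms(1), of k] assms(2)
    bounded_derivs_deriv[of "K - Suc k" C r "(deriv ^^ k) g" t]
  by (simp add: Suc_diff_Suc)

lemma bounded_derivs_Taylor:
  assumes "bounded_derivs K C r g" "\<bar>t\<bar> \<le> r"
  shows "\<bar>g t - (\<Sum>k<K. (deriv ^^ k) g 0 / fact k * t ^ k)\<bar> \<le> C * \<bar>t\<bar> ^ K"
proof -
  obtain s where s: "\<bar>s\<bar> \<le> \<bar>t\<bar>"
    "g t = (\<Sum>k<K. (deriv ^^ k) g 0 / fact k * t ^ k) + (deriv ^^ K) g s / fact K * t ^ K"
    using Maclaurin_bi_le[of "\<lambda>k. (deriv ^^ k) g" g K t] bounded_derivs_iterate_DERIV[OF assms(1)]
    by auto
  have "\<bar>(deriv ^^ K) g s\<bar> \<le> C"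
    using bounded_derivs_iterate[OF assms(1), of K] s(1) assms(2) by simp
  then have "\<bar>(deriv ^^ K) g s\<bar> / fact K \<le> C / 1"
    by (intro frac_le) auto
  then have "\<bar>(deriv ^^ K) g s\<bar> / fact K * \<bar>t\<bar> ^ K \<le> C * \<bar>t\<bar> ^ K"
    by (intro mult_right_mono) auto
  then show ?thesis
    by (simp add: s(2) abs_mult power_abs)
qed

section \<open>Smooth functions along curves\<close>

lemma smooth_differentiable: "smooth f \<Longrightarrow> f differentiable (at x)"
  unfolding smooth_def by (metis higher_differentiable.simps(2))

lemma smooth_continuous: "smooth f \<Longrightarrow> continuous_on UNIV f"
  unfolding smooth_def by (metis higher_differentiable.simps(1))

lemma smooth_partial_deriv: "smooth f \<Longrightarrow> smooth (partial_deriv i f)"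
  unfolding smooth_def partial_deriv_def by (metis higher_differentiable.simps(2))

lemma smooth_continuous_grad:
  fixes U :: "real ^ 'n \<Rightarrow> real"
  assumes "smooth U"
  shows "continuous_on UNIV (grad U)"
  unfolding grad_def using assms
  by (intro continuous_on_vec_lambda smooth_continuous smooth_partial_deriv)

lemma smooth_grad_bounded:
  fixes U :: "real ^ 'n \<Rightarrow> real"
  assumes "smooth U"
  shows "\<exists>D\<ge>0. \<forall>x. norm x \<le> C \<longrightarrow> norm (grad U x) \<le> D"
proof -
  have "continuous_on UNIV (grad U)"
    using assms by (rule smooth_continuous_grad)
  then have "compact (grad U ` cball 0 C)"
    by (intro compact_continuous_image) (auto intro: continuous_on_subset)
  then obtain D where "\<forall>w\<in>grad U ` cball 0 C. norm w \<le> D"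
    using compact_imp_bounded bounded_iff by blast
  then show ?thesis by (intro exI[of _ "max 0 D"]) force
qed

lemma has_derivative_grad:
  "f differentiable (at x) \<Longrightarrow> (f has_derivative (\<lambda>w. w \<bullet> grad f x)) (at x)"
  using GDERIV_grad by (auto simp: gderiv_def)

lemma compact_cube: "compact {x :: real ^ 'n. \<forall>i. \<bar>x $ i\<bar> \<le> C}"
proof -
  have "{x :: real ^ 'n. \<forall>i. \<bar>x $ i\<bar> \<le> C} = cbox (\<chi> i. - C) (\<chi> i. C)"
    by (auto simp: mem_box_cart abs_le_iff minus_le_iff)
  then show ?thesis by simp
qed

text \<open>The chain rule in the form used for curves that are known only through their components.\<close>

lemma has_real_derivative_compose_grad:
  fixes f :: "real ^ 'n \<Rightarrow> real"
  assumes "f differentiable (at (y t))" and "\<And>i. ((\<lambda>t. y t $ i) has_real_derivative y' $ i) (at t)"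
  shows "((\<lambda>t. f (y t)) has_real_derivative grad f (y t) \<bullet> y') (at t)"
proof -
  have "((\<lambda>t. y t \<bullet> b) has_derivative (\<lambda>s. (s *\<^sub>R y') \<bullet> b)) (at t)" if "b \<in> Basis" for b
    using assms(2) that
    by (auto simp: Basis_vec_def inner_axis has_field_derivative_def mult.commute[of _ "y' $ _"])
  then have "(y has_derivative (\<lambda>s. s *\<^sub>R y')) (at t)"
    using has_derivative_componentwise_within[of y "\<lambda>s. s *\<^sub>R y'" t UNIV] by blast
  from has_derivative_compose[OF this has_derivative_grad[OF assms(1)]]
  have "((\<lambda>t. f (y t)) has_derivative (\<lambda>s. (s *\<^sub>R y') \<bullet> grad f (y t))) (at t)" .
  moreover have "(\<lambda>s. (s *\<^sub>R y') \<bullet> grad f (y t)) = (*) (grad f (y t) \<bullet> y')"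
    by (auto simp: inner_commute)
  ultimately show ?thesis
    by (simp add: has_field_derivative_def)
qed

text \<open>A substitute for the formula of Faa di Bruno. The derivative of \<open>f \<circ> y\<close> is the sum of the
products of \<open>partial_deriv i f \<circ> y\<close> with the derivatives of the components of \<open>y\<close>, and the
partial derivatives are again smooth, so induction on the order over all smooth \<open>f\<close> closes. What
matters is that the bound depends on the bound for the curve but not on the curve.\<close>

lemma bounded_derivs_compose:
  fixes f :: "real ^ 'n \<Rightarrow> real"
  assumes "smooth f" and "0 \<le> C"
  shows "\<exists>D\<ge>0. \<forall>y. (\<forall>i. bounded_derivs K C r (\<lambda>t. y t $ i)) \<longrightarrow> bounded_derivs K D r (\<lambda>t. f (y t))"
  using assms(1)
proof (induction K arbitrary: f)
  case (0 f)
  have "compact (f ` {x. \<forall>i. \<bar>x $ i\<bar> \<le> C})"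
    using compact_cube smooth_continuous[OF 0]
    by (intro compact_continuous_image) (auto intro: continuous_on_subset)
  then obtain D where D: "\<And>x. \<forall>i. \<bar>x $ i\<bar> \<le> C \<Longrightarrow> \<bar>f x\<bar> \<le> D"
    using compact_imp_bounded by (fastforce simp: bounded_iff)
  moreover have "0 \<le> D"
    using D[of 0] assms(2) by auto
  ultimately show ?case by auto
next
  case (Suc K f)
  obtain D0 where D0: "0 \<le> D0" "\<And>y. (\<forall>i. bounded_derivs K C r (\<lambda>t. y t $ i))
      \<Longrightarrow> bounded_derivs K D0 r (\<lambda>t. f (y t))"
    using Suc.IH[OF Suc.prems] by auto
  have "\<forall>i. \<exists>D\<ge>0. \<forall>y. (\<forall>i. bounded_derivs K C r (\<lambda>t. y t $ i))
      \<longrightarrow> bounded_derivs K D r (\<lambda>t. partial_deriv i f (y t))"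
    using Suc.IH smooth_partial_deriv[OF Suc.prems] by blast
  then obtain D where D: "\<And>i. 0 \<le> D i" "\<And>i y. (\<forall>i. bounded_derivs K C r (\<lambda>t. y t $ i))
      \<Longrightarrow> bounded_derivs K (D i) r (\<lambda>t. partial_deriv i f (y t))"
    by metis
  define D1 where "D1 = (\<Sum>i\<in>UNIV. 2 ^ K * (D i * C))"
  have D1: "0 \<le> D1" using D assms(2) by (auto simp: D1_def intro!: sum_nonneg)
  have "bounded_derivs (Suc K) (D0 + D1) r (\<lambda>t. f (y t))"
    if y: "\<forall>i. bounded_derivs (Suc K) C r (\<lambda>t. y t $ i)" for y
  proof (rule bounded_derivs_SucI)
    have y': "\<forall>i. bounded_derivs K C r (\<lambda>t. y t $ i)"
      using y bounded_derivs_SucD by blast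
    show "\<bar>f (y t)\<bar> \<le> D0 + D1" if "\<bar>t\<bar> \<le> r" for t
      using bounded_derivs_bound[OF D0(2)[OF y'] that] D1 by simp
    show "((\<lambda>t. f (y t)) has_real_derivative
        (\<Sum>i\<in>UNIV. partial_deriv i f (y t) * deriv (\<lambda>t. y t $ i) t)) (at t)" for t
    proof -
      have "((\<lambda>t. y t $ i) has_real_derivative (\<chi> i. deriv (\<lambda>t. y t $ i) t) $ i) (at t)" for i
        using bounded_derivs_deriv[OF y[rule_format, of i]] by simp
      from has_real_derivative_compose_grad[OF smooth_differentiable[OF Suc.prems] this]
      show ?thesis by (simp add: inner_vec_def grad_def)
    qed
    have "bounded_derivs K D1 r (\<lambda>t. \<Sum>i\<in>UNIV. partial_deriv i f (y t) * deriv (\<lambda>t. y t $ i) t)"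
      unfolding D1_def using D y y' assms(2)
      by (intro bounded_derivs_sum bounded_derivs_mult) auto
    then show "bounded_derivs K (D0 + D1) r
        (\<lambda>t. \<Sum>i\<in>UNIV. partial_deriv i f (y t) * deriv (\<lambda>t. y t $ i) t)"
      by (rule bounded_derivs_mono) (simp add: D0)
  qed
  then show ?case
    using D0(1) D1 by (intro exI[of _ "D0 + D1"]) auto
qed

text \<open>The constant serves all curves with the given bounds, with \<open>u\<close> and \<open>a\<close> the velocity and
acceleration at the centre.\<close>

lemma curve_Taylor:
  fixes U :: "real ^ 'n \<Rightarrow> real"
  assumes "smooth U" "0 \<le> C" "0 \<le> r"
  shows "\<exists>D\<ge>0. \<forall>y. (\<forall>i. bounded_derivs 3 C r (\<lambda>t. y t $ i)) \<longrightarrow>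
    (\<exists>u a. norm u \<le> D \<and> norm a \<le> D \<and> (\<forall>t. \<bar>t\<bar> \<le> r \<longrightarrow>
      norm (y t - y 0 - t *\<^sub>R u - (t\<^sup>2 / 2) *\<^sub>R a) \<le> D * \<bar>t\<bar> ^ 3 \<and>
      \<bar>U (y t) - U (y 0) - t * (grad U (y 0) \<bullet> u)\<bar> \<le> D * t\<^sup>2))"
proof -
  obtain D0 where D0: "0 \<le> D0" "\<And>y. (\<forall>i. bounded_derivs 2 C r (\<lambda>t. y t $ i)) \<Longrightarrow>
      bounded_derivs 2 D0 r (\<lambda>t. U (y t))"
    using bounded_derivs_compose[OF assms(1,2), of 2 r] by blast
  let ?n = "real CARD('n)"
  have l1: "norm w \<le> ?n * c" if "\<And>i. \<bar>w $ i\<bar> \<le> c" for w :: "real ^ 'n" and c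
    using order_trans[OF norm_le_l1_cart sum_bounded_above[of UNIV "\<lambda>i. \<bar>w $ i\<bar>" c]] that by simp
  let ?D = "?n * C + D0"
  have "\<exists>u a. norm u \<le> ?D \<and> norm a \<le> ?D \<and> (\<forall>t. \<bar>t\<bar> \<le> r \<longrightarrow>
      norm (y t - y 0 - t *\<^sub>R u - (t\<^sup>2 / 2) *\<^sub>R a) \<le> ?D * \<bar>t\<bar> ^ 3 \<and>
      \<bar>U (y t) - U (y 0) - t * (grad U (y 0) \<bullet> u)\<bar> \<le> ?D * t\<^sup>2)"
    if y: "\<forall>i. bounded_derivs 3 C r (\<lambda>t. y t $ i)" for y
  proof -
    define u a where "u = (\<chi> i. deriv (\<lambda>t. y t $ i) 0)" and "a = (\<chi> i. deriv (deriv (\<lambda>t. y t $ i)) 0)"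
    have "\<bar>u $ i\<bar> \<le> C" "\<bar>a $ i\<bar> \<le> C" for i
      using y[rule_format, of i] assms(3) by (simp_all add: u_def a_def eval_nat_numeral)
    then have "norm u \<le> ?n * C" "norm a \<le> ?n * C" by (auto intro: l1)
    moreover have "norm (y t - y 0 - t *\<^sub>R u - (t\<^sup>2 / 2) *\<^sub>R a) \<le> ?n * (C * \<bar>t\<bar> ^ 3)" if "\<bar>t\<bar> \<le> r" for t
    proof (rule l1)
      fix i
      show "\<bar>(y t - y 0 - t *\<^sub>R u - (t\<^sup>2 / 2) *\<^sub>R a) $ i\<bar> \<le> C * \<bar>t\<bar> ^ 3"
        using bounded_derivs_Taylor[OF y[rule_format, of i] that]
        by (simp add: u_def a_def eval_nat_numeral algebra_simps)
    qed
    moreover have "\<bar>U (y t) - U (y 0) - t * (grad U (y 0) \<bullet> u)\<bar> \<le> D0 * t\<^sup>2" if "\<bar>t\<bar> \<le> r" for t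
    proof -
      have "((\<lambda>t. y t $ i) has_real_derivative u $ i) (at 0)" for i
        using bounded_derivs_DERIV[OF y[rule_format, of i], of 0] by (simp add: u_def)
      from DERIV_imp_deriv[OF has_real_derivative_compose_grad[OF smooth_differentiable[OF assms(1)] this]]
      have "deriv (\<lambda>t. U (y t)) 0 = grad U (y 0) \<bullet> u" .
      moreover have "bounded_derivs 2 D0 r (\<lambda>t. U (y t))"
        using y by (intro D0(2)) (auto intro: bounded_derivs_le)
      from bounded_derivs_Taylor[OF this that]
      have "\<bar>U (y t) - (U (y 0) + deriv (\<lambda>t. U (y t)) 0 * t)\<bar> \<le> D0 * t\<^sup>2"
        by (simp add: numeral_2_eq_2 power2_eq_square)
      ultimately show ?thesis by (simp add: algebra_simps)
    qed
    moreover have "?n * (C * \<bar>t\<bar> ^ 3) \<le> ?D * \<bar>t\<bar> ^ 3" "D0 * t\<^sup>2 \<le> ?D * t\<^sup>2" "?n * C \<le> ?D" for t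
      using D0(1) assms(2) by (simp_all add: algebra_simps)
    ultimately show ?thesis
      by (intro exI[of _ u] exI[of _ a] conjI allI impI; meson order_trans)
  qed
  then show ?thesis using D0(1) assms(2) by (intro exI[of _ ?D]) auto
qed

lemma second_order_Taylor:
  fixes U :: "real ^ 'n \<Rightarrow> real"
  assumes "smooth U" "0 \<le> C"
  shows "\<exists>D\<ge>0. \<forall>x x'. norm x \<le> C \<and> norm x' \<le> C \<longrightarrow>
    \<bar>U x' - U x - grad U x \<bullet> (x' - x)\<bar> \<le> D * (norm (x' - x))\<^sup>2"
proof -
  let ?C = "3 * C + 1"
  obtain D where D: "0 \<le> D" "\<And>y. (\<forall>i. bounded_derivs 2 ?C (2 * C) (\<lambda>t. y t $ i)) \<Longrightarrow>
      bounded_derivs 2 D (2 * C) (\<lambda>t. U (y t))"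
    using bounded_derivs_compose[OF assms(1), of ?C 2 "2 * C"] assms(2) by auto
  have "\<bar>U x' - U x - grad U x \<bullet> (x' - x)\<bar> \<le> D * (norm (x' - x))\<^sup>2"
    if x: "norm x \<le> C" "norm x' \<le> C" for x x'
  proof (cases "x' = x")
    case False
    \<comment> \<open>Moving along the segment with unit speed keeps all derivatives of the curve bounded, so
      that the remainder is homogeneous of degree two in the distance.\<close>
    define s where "s = norm (x' - x)"
    define w where "w = (1 / s) *\<^sub>R (x' - x)"
    define y where "y t = x + t *\<^sub>R w" for t
    have s: "0 < s" "s \<le> 2 * C"
      using False norm_triangle_ineq4[of x' x] x by (auto simp: s_def)
    have w: "norm w = 1" "s *\<^sub>R w = x' - x" using s by (auto simp: w_def s_def)
    have wi: "\<bar>w $ i\<bar> \<le> 1" for i using component_le_norm_cart[of w i] w by simp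
    have "bounded_derivs (Suc (Suc 0)) ?C (2 * C) (\<lambda>t. y t $ i)" for i
    proof (rule bounded_derivs_SucI)
      show "((\<lambda>t. y t $ i) has_real_derivative w $ i) (at t)" for t
        by (auto simp: y_def intro!: derivative_eq_intros)
      show "bounded_derivs (Suc 0) ?C (2 * C) (\<lambda>t. w $ i)"
        using wi[of i] assms(2) by (intro bounded_derivs_const) simp
      fix t :: real assume t: "\<bar>t\<bar> \<le> 2 * C"
      have "\<bar>x $ i\<bar> \<le> C" using component_le_norm_cart[of x i] x by simp
      moreover have "\<bar>t * w $ i\<bar> \<le> 2 * C * 1"
        unfolding abs_mult using t wi[of i] by (intro mult_mono) auto
      ultimately show "\<bar>y t $ i\<bar> \<le> ?C" by (simp add: y_def)
    qed
    then have g: "bounded_derivs 2 D (2 * C) (\<lambda>t. U (y t))"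
      by (intro D(2)) (simp add: numeral_2_eq_2)
    have "\<And>i. ((\<lambda>t. y t $ i) has_real_derivative w $ i) (at 0)"
      by (auto simp: y_def intro!: derivative_eq_intros)
    from DERIV_imp_deriv[OF has_real_derivative_compose_grad[OF smooth_differentiable[OF assms(1)] this]]
    have d: "deriv (\<lambda>t. U (y t)) 0 = grad U x \<bullet> w" by (simp add: y_def)
    have "\<bar>U (y s) - (U (y 0) + deriv (\<lambda>t. U (y t)) 0 * s)\<bar> \<le> D * s\<^sup>2"
      using bounded_derivs_Taylor[OF g, of s] s by (simp add: numeral_2_eq_2 power2_eq_square)
    moreover have "y s = x'" "y 0 = x" "(grad U x \<bullet> w) * s = grad U x \<bullet> (x' - x)"
      by (simp_all add: y_def w(2) mult.commute flip: inner_scaleR_right)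
    ultimately show ?thesis by (simp add: d s_def algebra_simps)
  qed simp
  then show ?thesis using D(1) by blast
qed

section \<open>Forward differences and Newton interpolation\<close>

definition fdiff :: "(nat \<Rightarrow> 'a::ab_group_add) \<Rightarrow> nat \<Rightarrow> 'a" where
  "fdiff z n = z (Suc n) - z n"

lemma fdiff_iter_shift: "(fdiff ^^ k) (\<lambda>j. z (n + j)) i = (fdiff ^^ k) z (n + i)"
  by (induction k arbitrary: i) (simp_all add: fdiff_def)

lemma fdiff_iter_linear:
  assumes "\<And>a b. f (a - b) = f a - f b"
  shows "(fdiff ^^ k) (\<lambda>j. f (z j)) i = f ((fdiff ^^ k) z i)"
  by (induction k arbitrary: i) (simp_all add: fdiff_def assms)

lemma fdiff_iter_add: "(fdiff ^^ k) (\<lambda>j. z j + w j) i = (fdiff ^^ k) z i + (fdiff ^^ k) w i"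
  by (induction k arbitrary: i) (simp_all add: fdiff_def)

lemma fdiff_iter_cong:
  "(\<And>j. n \<le> j \<Longrightarrow> j \<le> n + k \<Longrightarrow> z j = w j) \<Longrightarrow> (fdiff ^^ k) z n = (fdiff ^^ k) w n"
  by (induction k arbitrary: n) (auto simp: fdiff_def)

text \<open>The mean value theorem for iterated differences: one application of the classical theorem per
difference, the intermediate points staying in the interval spanned by the nodes.\<close>

lemma fdiff_iter_mean_value:
  assumes "0 < h" and "\<And>k t. k < K \<Longrightarrow> (d k has_real_derivative d (Suc k) t) (at t)"
  shows "\<exists>\<xi>. real n * h \<le> \<xi> \<and> \<xi> \<le> real (n + K) * h \<and> (fdiff ^^ K) (\<lambda>j. d 0 (real j * h)) n = h ^ K * d K \<xi>"
  using assms(2)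
proof (induction K arbitrary: d)
  case 0
  then show ?case by auto
next
  case (Suc K)
  have "((\<lambda>t. d k (t + h) - d k t) has_real_derivative d (Suc k) (t + h) - d (Suc k) t) (at t)"
    if "k < K" for k t
    using Suc.prems[of k] that by (intro DERIV_diff) (auto simp flip: DERIV_shift)
  from Suc.IH[of "\<lambda>k t. d k (t + h) - d k t", OF this] obtain \<xi> where
    \<xi>: "real n * h \<le> \<xi>" "\<xi> \<le> real (n + K) * h"
       "(fdiff ^^ K) (\<lambda>j. d 0 (real j * h + h) - d 0 (real j * h)) n = h ^ K * (d K (\<xi> + h) - d K \<xi>)"
    by auto
  obtain \<eta> where \<eta>: "\<xi> < \<eta>" "\<eta> < \<xi> + h" "d K (\<xi> + h) - d K \<xi> = (\<xi> + h - \<xi>) * d (Suc K) \<eta>"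
    using MVT2[of \<xi> "\<xi> + h" "d K" "d (Suc K)"] Suc.prems[of K] assms(1) by auto
  have "fdiff (\<lambda>j. d 0 (real j * h)) = (\<lambda>j. d 0 (real j * h + h) - d 0 (real j * h))"
    by (auto simp: fdiff_def algebra_simps)
  then have "(fdiff ^^ Suc K) (\<lambda>j. d 0 (real j * h)) n = h ^ Suc K * d (Suc K) \<eta>"
    using \<xi>(3) \<eta>(3) by (simp add: funpow_Suc_right del: funpow.simps)
  moreover have "real n * h \<le> \<eta>" "\<eta> \<le> real (n + Suc K) * h"
    using \<xi> \<eta> by (auto simp: algebra_simps)
  ultimately show ?case by blast
qed

lemma newton_forward:
  fixes z :: "nat \<Rightarrow> real"
  shows "j \<le> K \<Longrightarrow> z j = (\<Sum>k\<le>K. real (j choose k) * (fdiff ^^ k) z 0)"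
proof (induction j arbitrary: z K)
  case 0
  have "(\<Sum>k\<le>K. real (0 choose k) * (fdiff ^^ k) z 0) = (\<Sum>k\<in>{0}. real (0 choose k) * (fdiff ^^ k) z 0)"
    by (rule sum.mono_neutral_right) auto
  then show ?case by simp
next
  case (Suc j)
  then obtain K' where K: "K = Suc K'" "j \<le> K'" by (cases K) auto
  have "z (Suc j) = z j + fdiff z j" by (simp add: fdiff_def)
  also have "z j = (\<Sum>k\<le>K. real (j choose k) * (fdiff ^^ k) z 0)"
    using Suc by simp
  also have "\<dots> = z 0 + (\<Sum>k\<le>K'. real (j choose Suc k) * (fdiff ^^ Suc k) z 0)"
    unfolding K sum.atMost_Suc_shift by simp
  also have "fdiff z j = (\<Sum>k\<le>K'. real (j choose k) * (fdiff ^^ Suc k) z 0)"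
    using Suc.IH[OF K(2), of "fdiff z"] by (simp add: funpow_swap1)
  finally show ?case
    unfolding K sum.atMost_Suc_shift by (simp add: sum.distrib distrib_right)
qed

text \<open>For \<open>h \<le> 1\<close> the shifts stay in a bounded range, so the products of linear factors are bounded
with all derivatives, uniformly in \<open>h\<close>.\<close>

lemma newton_basis_bounded:
  assumes "0 \<le> r" "0 \<le> s"
  shows "\<exists>D\<ge>0. \<forall>h c. 0 < h \<and> h \<le> 1 \<and> \<bar>c\<bar> \<le> s \<longrightarrow>
    bounded_derivs K D r (\<lambda>t. \<Prod>i<k. t + (c - real i * h))"
proof (induction k)
  case 0
  show ?case using bounded_derivs_const[of 1 1 K r] by (intro exI[of _ 1]) auto
next
  case (Suc k)
  then obtain D where D: "0 \<le> D" "\<And>h c. 0 < h \<Longrightarrow> h \<le> 1 \<Longrightarrow> \<bar>c\<bar> \<le> s \<Longrightarrow>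
    bounded_derivs K D r (\<lambda>t. \<Prod>i<k. t + (c - real i * h))" by blast
  let ?L = "r + (s + real k) + 1"
  have "bounded_derivs K (2 ^ K * (D * ?L)) r (\<lambda>t. \<Prod>i<Suc k. t + (c - real i * h))"
    if h: "0 < h" "h \<le> 1" "\<bar>c\<bar> \<le> s" for h c
  proof -
    have "real k * h \<le> real k * 1" using h by (intro mult_left_mono) auto
    then have "\<bar>c - real k * h\<bar> \<le> s + real k"
      using h by (simp add: abs_le_iff) (smt (verit) mult_nonneg_nonneg of_nat_0_le_iff)
    then have "bounded_derivs K ?L r (\<lambda>t. t + (c - real k * h))"
      by (rule bounded_derivs_shift[OF assms(1)])
    then show ?thesis
      using D h assms by (simp, intro bounded_derivs_mult) auto
  qed
  moreover have "0 \<le> 2 ^ K * (D * ?L)" using D assms by auto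
  ultimately show ?case by blast
qed

text \<open>A sequence whose \<open>k\<close>-th differences are of size \<open>h ^ k\<close> is, on any window of fixed length, the
trace of a curve whose derivatives are bounded uniformly in \<open>h\<close>. This takes the place of the
interpolating solution of a modified differential equation.\<close>

lemma interpolating_curve:
  assumes "0 \<le> C" "0 \<le> r"
  shows "\<exists>D\<ge>0. \<forall>h z. 0 < h \<and> h \<le> 1 \<and> (\<forall>k\<le>K. \<bar>(fdiff ^^ k) z 0\<bar> \<le> C * h ^ k) \<longrightarrow>
    (\<exists>y. bounded_derivs Q D r y \<and> (\<forall>j\<le>K. y ((real j - real m) * h) = z j))"
proof -
  have "\<exists>D\<ge>0. \<forall>h c. 0 < h \<and> h \<le> 1 \<and> \<bar>c\<bar> \<le> real m \<longrightarrow>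
      bounded_derivs Q D r (\<lambda>t. \<Prod>i<k. t + (c - real i * h))" for k
    using assms by (intro newton_basis_bounded) auto
  then obtain D where D: "\<And>k. 0 \<le> D k" "\<And>k h c. 0 < h \<Longrightarrow> h \<le> 1 \<Longrightarrow> \<bar>c\<bar> \<le> real m \<Longrightarrow>
      bounded_derivs Q (D k) r (\<lambda>t. \<Prod>i<k. t + (c - real i * h))"
    by metis
  let ?D = "\<Sum>k\<le>K. 2 ^ Q * (C * D k)"
  have "\<exists>y. bounded_derivs Q ?D r y \<and> (\<forall>j\<le>K. y ((real j - real m) * h) = z j)"
    if h: "0 < h" "h \<le> 1" and z: "\<And>k. k \<le> K \<Longrightarrow> \<bar>(fdiff ^^ k) z 0\<bar> \<le> C * h ^ k" for h z
  proof -
    \<comment> \<open>Newton's forward interpolation polynomial, with the node of index \<open>m\<close> placed at \<open>0\<close>.\<close>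
    define y where "y t = (\<Sum>k\<le>K. ((fdiff ^^ k) z 0 / h ^ k / fact k) * (\<Prod>i<k. t + (real m * h - real i * h)))" for t
    have "\<bar>(fdiff ^^ k) z 0 / h ^ k / fact k\<bar> \<le> C" if "k \<le> K" for k
    proof -
      have "\<bar>(fdiff ^^ k) z 0\<bar> / h ^ k \<le> C"
        using z[OF that] h by (simp add: pos_divide_le_eq)
      then have "\<bar>(fdiff ^^ k) z 0\<bar> / h ^ k / fact k \<le> C / 1"
        by (intro frac_le assms) auto
      then show ?thesis using h by (simp add: abs_divide)
    qed
    moreover have "\<bar>real m * h\<bar> \<le> real m"
      using h by (simp add: abs_mult mult_left_le)
    ultimately have "bounded_derivs Q ?D r y"
      unfolding y_def using D h assms
      by (intro bounded_derivs_sum bounded_derivs_mult bounded_derivs_const) auto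
    moreover have "y ((real j - real m) * h) = z j" if j: "j \<le> K" for j
    proof -
      have "(\<Prod>i<k. (real j - real m) * h + (real m * h - real i * h)) = h ^ k * (fact k * real (j choose k))" for k
      proof -
        have "(\<Prod>i<k. (real j - real m) * h + (real m * h - real i * h)) = (\<Prod>i<k. h * (real j - real i))"
          by (rule prod.cong) (auto simp: algebra_simps)
        also have "\<dots> = h ^ k * (fact k * (real j gchoose k))"
          by (simp add: prod.distrib gbinomial_prod_rev atLeast0LessThan)
        finally show ?thesis by (simp add: binomial_gbinomial)
      qed
      then have "y ((real j - real m) * h) = (\<Sum>k\<le>K. real (j choose k) * (fdiff ^^ k) z 0)"
        unfolding y_def using h by (intro sum.cong) auto
      then show ?thesis using newton_forward[OF j, of z] by simp
    qed
    ultimately show ?thesis by blast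
  qed
  moreover have "0 \<le> ?D" using D assms by (auto intro!: sum_nonneg)
  ultimately show ?thesis by blast
qed

lemma interpolating_curve_vec:
  assumes "0 \<le> C" "0 \<le> r"
  shows "\<exists>D\<ge>0. \<forall>h (z :: nat \<Rightarrow> real ^ 'n).
    0 < h \<and> h \<le> 1 \<and> (\<forall>k\<le>K. norm ((fdiff ^^ k) z 0) \<le> C * h ^ k) \<longrightarrow>
    (\<exists>y. (\<forall>i. bounded_derivs Q D r (\<lambda>t. y t $ i)) \<and> (\<forall>j\<le>K. y ((real j - real m) * h) = z j))"
proof -
  obtain D where D: "0 \<le> D" "\<And>h z. 0 < h \<Longrightarrow> h \<le> 1 \<Longrightarrow> (\<forall>k\<le>K. \<bar>(fdiff ^^ k) z 0\<bar> \<le> C * h ^ k) \<Longrightarrow>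
    (\<exists>y. bounded_derivs Q D r y \<and> (\<forall>j\<le>K. y ((real j - real m) * h) = z j))"
    using interpolating_curve[OF assms, of K Q m] by blast
  have "\<exists>y. (\<forall>i. bounded_derivs Q D r (\<lambda>t. y t $ i)) \<and> (\<forall>j\<le>K. y ((real j - real m) * h) = z j)"
    if h: "0 < h" "h \<le> 1" and z: "\<forall>k\<le>K. norm ((fdiff ^^ k) z 0) \<le> C * h ^ k"
    for h and z :: "nat \<Rightarrow> real ^ 'n"
  proof -
    have "(fdiff ^^ k) (\<lambda>j. z j $ i) 0 = (fdiff ^^ k) z 0 $ i" for k i
      by (rule fdiff_iter_linear) simp
    then have "\<forall>k\<le>K. \<bar>(fdiff ^^ k) (\<lambda>j. z j $ i) 0\<bar> \<le> C * h ^ k" for i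
      using z by (metis component_le_norm_cart order_trans)
    then have "\<forall>i. \<exists>y. bounded_derivs Q D r y \<and> (\<forall>j\<le>K. y ((real j - real m) * h) = z j $ i)"
      using D(2)[OF h] by simp
    then obtain y where y: "\<And>i. bounded_derivs Q D r (y i)"
        "\<And>i j. j \<le> K \<Longrightarrow> y i ((real j - real m) * h) = z j $ i"
      by metis
    then show ?thesis
      by (intro exI[of _ "\<lambda>t. \<chi> i. y i t"]) (auto simp: vec_eq_iff)
  qed
  then show ?thesis using D(1) by blast
qed

text \<open>Interpolate, compose with \<open>f\<close>, and apply the mean value theorem for differences.\<close>

lemma fdiff_compose_bounded:
  fixes f :: "real ^ 'n \<Rightarrow> real"
  assumes "smooth f" "0 \<le> C"
  shows "\<exists>D\<ge>0. \<forall>h z. 0 < h \<and> h \<le> 1 \<and> (\<forall>k\<le>K. norm ((fdiff ^^ k) z 0) \<le> C * h ^ k) \<longrightarrow>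
    \<bar>(fdiff ^^ K) (\<lambda>j. f (z j)) 0\<bar> \<le> D * h ^ K"
proof -
  obtain D where D: "0 \<le> D" "\<And>h z. 0 < h \<Longrightarrow> h \<le> 1 \<Longrightarrow> \<forall>k\<le>K. norm ((fdiff ^^ k) z 0) \<le> C * h ^ k \<Longrightarrow>
    (\<exists>y::real \<Rightarrow> real ^ 'n. (\<forall>i. bounded_derivs K D (real K) (\<lambda>t. y t $ i)) \<and> (\<forall>j\<le>K. y ((real j - real 0) * h) = z j))"
    using interpolating_curve_vec[OF assms(2), of "real K" K K 0, where 'n = 'n] by auto
  obtain D' where D': "0 \<le> D'" "\<And>y. \<forall>i. bounded_derivs K D (real K) (\<lambda>t. y t $ i) \<Longrightarrow>
      bounded_derivs K D' (real K) (\<lambda>t. f (y t))"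
    using bounded_derivs_compose[OF assms(1) D(1), of K "real K"] by blast
  have "\<bar>(fdiff ^^ K) (\<lambda>j. f (z j)) 0\<bar> \<le> D' * h ^ K"
    if h: "0 < h" "h \<le> 1" and z: "\<forall>k\<le>K. norm ((fdiff ^^ k) z 0) \<le> C * h ^ k" for h z
  proof -
    obtain y where y: "\<forall>i. bounded_derivs K D (real K) (\<lambda>t. y t $ i)" "\<And>j. j \<le> K \<Longrightarrow> y (real j * h) = z j"
      using D(2)[OF h z] by auto
    let ?g = "\<lambda>t. f (y t)"
    note g = D'(2)[OF y(1)]
    obtain \<xi> where \<xi>: "0 \<le> \<xi>" "\<xi> \<le> real K * h"
        "(fdiff ^^ K) (\<lambda>j. ?g (real j * h)) 0 = h ^ K * (deriv ^^ K) ?g \<xi>"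
      using fdiff_iter_mean_value[OF h(1), of K "\<lambda>k. (deriv ^^ k) ?g" 0] bounded_derivs_iterate_DERIV[OF g]
      by auto
    have "(fdiff ^^ K) (\<lambda>j. f (z j)) 0 = h ^ K * (deriv ^^ K) ?g \<xi>"
      using \<xi>(3) y(2) fdiff_iter_cong[of 0 K "\<lambda>j. f (z j)" "\<lambda>j. ?g (real j * h)"] by simp
    moreover have "\<bar>\<xi>\<bar> \<le> real K"
      using \<xi> h mult_left_le[of h "real K"] by simp
    then have "\<bar>(deriv ^^ K) ?g \<xi>\<bar> \<le> D'"
      using bounded_derivs_iterate[OF g, of K] by simp
    ultimately show ?thesis
      using h by (simp add: abs_mult mult.commute mult_left_mono)
  qed
  then show ?thesis using D' by blast
qed

lemma fdiff_compose_bounded_vec: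
  fixes F :: "real ^ 'n \<Rightarrow> real ^ 'm"
  assumes "\<And>i. smooth (\<lambda>x. F x $ i)" "0 \<le> C"
  shows "\<exists>D\<ge>0. \<forall>h z. 0 < h \<and> h \<le> 1 \<and> (\<forall>k\<le>K. norm ((fdiff ^^ k) z 0) \<le> C * h ^ k) \<longrightarrow>
    norm ((fdiff ^^ K) (\<lambda>j. F (z j)) 0) \<le> D * h ^ K"
proof -
  obtain D where D: "\<And>i. 0 \<le> D i" "\<And>i h z. 0 < h \<Longrightarrow> h \<le> 1 \<Longrightarrow>
      (\<forall>k\<le>K. norm ((fdiff ^^ k) z 0) \<le> C * h ^ k) \<Longrightarrow> \<bar>(fdiff ^^ K) (\<lambda>j. F (z j) $ i) 0\<bar> \<le> D i * h ^ K"
    using fdiff_compose_bounded[OF assms] by metis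
  have "norm ((fdiff ^^ K) (\<lambda>j. F (z j)) 0) \<le> (\<Sum>i\<in>UNIV. D i) * h ^ K"
    if "0 < h" "h \<le> 1" "\<forall>k\<le>K. norm ((fdiff ^^ k) z 0) \<le> C * h ^ k" for h z
  proof -
    have "(fdiff ^^ K) (\<lambda>j. F (z j) $ i) 0 = (fdiff ^^ K) (\<lambda>j. F (z j)) 0 $ i" for i
      by (rule fdiff_iter_linear) simp
    then have "norm ((fdiff ^^ K) (\<lambda>j. F (z j)) 0) \<le> (\<Sum>i\<in>UNIV. D i * h ^ K)"
      using D(2)[OF that] by (intro order_trans[OF norm_le_l1_cart sum_mono]) metis
    then show ?thesis by (simp add: sum_distrib_right)
  qed
  then show ?thesis
    using D(1) by (intro exI[of _ "\<Sum>i\<in>UNIV. D i"]) (auto intro: sum_nonneg)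
qed

section \<open>Gyration in a magnetic field\<close>

text \<open>The Cayley-Hamilton identity for the skew matrix of \<open>w \<mapsto> w \<times> b\<close>.\<close>

lemma cross_cross_cross: "((w \<times> b) \<times> b) \<times> b = - ((norm b)\<^sup>2 *\<^sub>R (w \<times> b))"
  unfolding power2_norm_eq_inner
  by (simp add: vec_eq_iff forall_3 cross3_def inner_vec_def sum_3 algebra_simps)

lemma cross_cross_inner:
  "w \<bullet> (w \<times> b) = 0" "(w \<times> b) \<bullet> ((w \<times> b) \<times> b) = 0"
  "w \<bullet> ((w \<times> b) \<times> b) = - ((w \<times> b) \<bullet> (w \<times> b))"
  "((w \<times> b) \<times> b) \<bullet> ((w \<times> b) \<times> b) = (norm b)\<^sup>2 * ((w \<times> b) \<bullet> (w \<times> b))"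
  unfolding power2_norm_eq_inner
  by (simp_all add: cross3_def inner_vec_def sum_3 algebra_simps)

lemma inner_cross_swap: "v \<bullet> (w \<times> b) = - (w \<bullet> (v \<times> b))" for v w b :: "real ^ 3"
  by (simp add: cross3_def inner_vec_def sum_3 algebra_simps)

lemma cross_diff_left: "(v - w) \<times> b = v \<times> b - w \<times> b" for v w b :: "real ^ 3"
  by (metis cross_add_left cross_minus_left diff_conv_add_uminus)

lemma norm_cross_le: "norm (a \<times> b) \<le> norm a * norm b" for a b :: "real ^ 3"
proof -
  have "(norm (a \<times> b))\<^sup>2 \<le> (norm a * norm b)\<^sup>2"
    using norm_cross_dot[of a b] zero_le_power2[of "a \<bullet> b"] by linarith
  then show ?thesis by (rule power2_le_imp_le) simp
qed

text \<open>Rodrigues' formula: \<open>w\<close> is turned about the axis \<open>b\<close> by the angle \<open>s * norm b\<close>. For \<open>b = 0\<close>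
the coefficients are \<open>0\<close> by the convention for division, and the map is the identity.\<close>

definition gyration :: "real \<Rightarrow> real ^ 3 \<Rightarrow> real ^ 3 \<Rightarrow> real ^ 3" where
  "gyration s b w = w + (sin (s * norm b) / norm b) *\<^sub>R (w \<times> b)
     + ((1 - cos (s * norm b)) / (norm b)\<^sup>2) *\<^sub>R ((w \<times> b) \<times> b)"

text \<open>The two coefficients satisfy the one relation that makes the formula orthogonal; it is
\<open>sin\<^sup>2 + cos\<^sup>2 = 1\<close> in disguise.\<close>

lemma gyration_coeffs:
  "(sin (s * norm b) / norm b)\<^sup>2 + ((1 - cos (s * norm b)) / (norm b)\<^sup>2)\<^sup>2 * (norm b)\<^sup>2
     = 2 * ((1 - cos (s * norm b)) / (norm b)\<^sup>2)"
proof (cases "b = 0")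
  case False
  have "(sin (s * norm b))\<^sup>2 + (1 - cos (s * norm b))\<^sup>2 = 2 * (1 - cos (s * norm b))"
    using sin_cos_squared_add[of "s * norm b"] by (simp add: power2_eq_square algebra_simps)
  then have "((sin (s * norm b))\<^sup>2 + (1 - cos (s * norm b))\<^sup>2) / (norm b)\<^sup>2
      = 2 * (1 - cos (s * norm b)) / (norm b)\<^sup>2" by simp
  then show ?thesis
    using False by (simp add: power_divide add_divide_distrib power2_eq_square)
qed simp

lemma norm_gyration [simp]: "norm (gyration s b w) = norm w"
proof -
  define \<alpha> \<beta> where ab: "\<alpha> = sin (s * norm b) / norm b" "\<beta> = (1 - cos (s * norm b)) / (norm b)\<^sup>2"
  have c: "\<alpha>\<^sup>2 + \<beta>\<^sup>2 * (norm b)\<^sup>2 = 2 * \<beta>"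
    unfolding ab by (rule gyration_coeffs)
  define u z where uz: "u = w \<times> b" "z = (w \<times> b) \<times> b"
  have p: "w \<bullet> u = 0" "u \<bullet> w = 0" "u \<bullet> z = 0" "z \<bullet> u = 0" "w \<bullet> z = - (u \<bullet> u)" "z \<bullet> w = - (u \<bullet> u)"
    "z \<bullet> z = (norm b)\<^sup>2 * (u \<bullet> u)"
    unfolding uz using cross_cross_inner[of w b] by (simp_all add: inner_commute)
  have "gyration s b w \<bullet> gyration s b w = (w + \<alpha> *\<^sub>R u + \<beta> *\<^sub>R z) \<bullet> (w + \<alpha> *\<^sub>R u + \<beta> *\<^sub>R z)"
    by (simp add: gyration_def ab uz)
  also have "\<dots> = w \<bullet> w + (\<alpha>\<^sup>2 + \<beta>\<^sup>2 * (norm b)\<^sup>2 - 2 * \<beta>) * (u \<bullet> u)"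
    by (simp add: inner_add p power2_eq_square algebra_simps)
  finally have "gyration s b w \<bullet> gyration s b w
      = w \<bullet> w + (\<alpha>\<^sup>2 + \<beta>\<^sup>2 * (norm b)\<^sup>2 - 2 * \<beta>) * (u \<bullet> u)" .
  then show ?thesis
    unfolding c by (simp add: norm_eq)
qed

lemma gyration_inverse: "gyration (- s) b (gyration s b w) = w"
proof -
  define \<alpha> \<beta> where ab: "\<alpha> = sin (s * norm b) / norm b" "\<beta> = (1 - cos (s * norm b)) / (norm b)\<^sup>2"
  have c: "\<alpha>\<^sup>2 + \<beta>\<^sup>2 * (norm b)\<^sup>2 = 2 * \<beta>"
    unfolding ab by (rule gyration_coeffs)
  have g: "gyration s b w = w + \<alpha> *\<^sub>R (w \<times> b) + \<beta> *\<^sub>R ((w \<times> b) \<times> b)" for w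
    by (simp add: gyration_def ab)
  have g': "gyration (- s) b w = w - \<alpha> *\<^sub>R (w \<times> b) + \<beta> *\<^sub>R ((w \<times> b) \<times> b)" for w
    by (simp add: gyration_def ab)
  have X: "gyration s b w \<times> b = w \<times> b + \<alpha> *\<^sub>R ((w \<times> b) \<times> b) + (- \<beta> * (norm b)\<^sup>2) *\<^sub>R (w \<times> b)"
    by (simp add: g cross_add_left cross_mult_left cross_cross_cross)
  have XX: "(gyration s b w \<times> b) \<times> b
      = (w \<times> b) \<times> b + (- \<alpha> * (norm b)\<^sup>2) *\<^sub>R (w \<times> b) + (- \<beta> * (norm b)\<^sup>2) *\<^sub>R ((w \<times> b) \<times> b)"
    unfolding X cross_add_left cross_mult_left cross_cross_cross by simp
  have "gyration (- s) b (gyration s b w)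
      = w - (\<alpha>\<^sup>2 + \<beta>\<^sup>2 * (norm b)\<^sup>2 - 2 * \<beta>) *\<^sub>R ((w \<times> b) \<times> b)"
    unfolding g'[of "gyration s b w"] XX unfolding X unfolding g
    by (simp add: vec_eq_iff power2_eq_square algebra_simps)
  then show ?thesis by (simp add: c)
qed

lemma gyration_add: "gyration s b (v + w) = gyration s b v + gyration s b w"
  by (simp add: gyration_def cross_add_left algebra_simps)

lemma gyration_scaleR: "gyration s b (c *\<^sub>R v) = c *\<^sub>R gyration s b v"
  by (simp add: gyration_def cross_mult_left algebra_simps)

lemma matrix_power_mult_vec:
  fixes M :: "real ^ 'n ^ 'n"
  shows "((**) M ^^ k) (mat 1) *v w = ((*v) M ^^ k) w"
  by (induction k) (simp_all flip: matrix_vector_mul_assoc)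

lemma cross_matrix_mult_vec: "matrix (\<lambda>v. v \<times> b) *v w = w \<times> b"
  using magnetic_matrix_vector_mult[of "\<lambda>_. b"] by (simp add: magnetic_matrix_def)

text \<open>Since the third power of the matrix is a multiple of the first, its powers cycle through two
vectors with the signs and factorials of the sine and cosine coefficients.\<close>

lemma cross_matrix_iterate:
  assumes "b \<noteq> 0"
  shows "((*v) (s *\<^sub>R matrix (\<lambda>v. v \<times> b)) ^^ Suc k) w =
     (fact k * cos_coeff k * (s * norm b) ^ k * s) *\<^sub>R (w \<times> b)
     + (fact k * sin_coeff k * (s * norm b) ^ k * (s / norm b)) *\<^sub>R ((w \<times> b) \<times> b)"
proof (induction k)
  case 0
  show ?case
    by (simp add: cross_matrix_mult_vec flip: scaleR_matrix_vector_assoc)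
next
  case (Suc k)
  let ?f = "(*v) (s *\<^sub>R matrix (\<lambda>v. v \<times> b))"
  have f: "?f w = s *\<^sub>R (w \<times> b)" for w
    by (simp add: cross_matrix_mult_vec flip: scaleR_matrix_vector_assoc)
  have "(?f ^^ Suc (Suc k)) w = s *\<^sub>R ((?f ^^ Suc k) w \<times> b)"
    by (simp add: f)
  also have "\<dots> = s *\<^sub>R (((fact k * cos_coeff k * (s * norm b) ^ k * s) *\<^sub>R (w \<times> b)
     + (fact k * sin_coeff k * (s * norm b) ^ k * (s / norm b)) *\<^sub>R ((w \<times> b) \<times> b)) \<times> b)"
    by (simp only: Suc.IH)
  also have "\<dots> = (s * (fact k * cos_coeff k * (s * norm b) ^ k * s)) *\<^sub>R ((w \<times> b) \<times> b)
     + (- (s * (fact k * sin_coeff k * (s * norm b) ^ k * (s / norm b)) * (norm b)\<^sup>2)) *\<^sub>R (w \<times> b)"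
    by (simp add: cross_add_left cross_mult_left cross_cross_cross scaleR_right_distrib
        scaleR_right_diff_distrib mult.assoc)
  also have "s * (fact k * cos_coeff k * (s * norm b) ^ k * s)
      = fact (Suc k) * sin_coeff (Suc k) * (s * norm b) ^ Suc k * (s / norm b)"
    using assms by (simp add: sin_coeff_Suc del: of_nat_Suc)
  also have "- (s * (fact k * sin_coeff k * (s * norm b) ^ k * (s / norm b)) * (norm b)\<^sup>2)
      = fact (Suc k) * cos_coeff (Suc k) * (s * norm b) ^ Suc k * s"
    using assms by (simp add: cos_coeff_Suc power2_eq_square del: of_nat_Suc)
  finally show ?case by (simp only: add.commute)
qed

lemma matrix_exp_cross: "matrix_exp (s *\<^sub>R matrix (\<lambda>v. v \<times> b)) *v w = gyration s b w"
proof -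
  let ?A = "matrix (\<lambda>v. v \<times> b)" and ?n = "norm b" and ?\<phi> = "s * norm b"
  let ?A2 = "?A ** ?A"
  \<comment> \<open>With \<open>A\<^sup>3 = - (norm b)\<^sup>2 A\<close> every term of the exponential series collapses to a combination
    of \<open>A\<close> and \<open>A\<^sup>2\<close> weighted by terms of the sine and cosine series; the identity
    matrix and the offset \<open>?I k\<close> correct the term \<open>k = 0\<close>.\<close>
  let ?T = "\<lambda>k. (1 / fact k) *\<^sub>R (((**) (s *\<^sub>R ?A) ^^ k) (mat 1))"
  let ?I = "\<lambda>k::nat. if k = 0 then 1 else (0::real)"
  let ?S = "\<lambda>k. (sin_coeff k * ?\<phi> ^ k / ?n) *\<^sub>R ?A + ((?I k - cos_coeff k * ?\<phi> ^ k) / ?n\<^sup>2) *\<^sub>R ?A2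
     + ?I k *\<^sub>R mat 1"
  have act: "(p *\<^sub>R ?A + q *\<^sub>R ?A2 + r *\<^sub>R mat 1) *v w
      = p *\<^sub>R (w \<times> b) + q *\<^sub>R ((w \<times> b) \<times> b) + r *\<^sub>R w" for p q r w
    by (simp add: matrix_vector_mult_add_rdistrib cross_matrix_mult_vec
        flip: scaleR_matrix_vector_assoc matrix_vector_mul_assoc)
  have T: "?T k = ?S k" for k
  proof (cases k)
    case 0
    then show ?thesis by (simp add: sin_coeff_def cos_coeff_def)
  next
    case (Suc j)
    have "?T k *v w = ?S k *v w" for w
    proof (cases "b = 0")
      case True
      have "?T k *v w = (1 / fact k) *\<^sub>R ((*v) (s *\<^sub>R ?A) ^^ Suc j) w"
        unfolding Suc by (simp only: matrix_power_mult_vec flip: scaleR_matrix_vector_assoc)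
      also have "\<dots> = 0"
        using True cross_matrix_mult_vec[of b] by (simp flip: scaleR_matrix_vector_assoc)
      finally show ?thesis
        using True Suc by (simp only: act) simp
    next
      case False
      have "?T k *v w = (1 / fact k) *\<^sub>R ((*v) (s *\<^sub>R ?A) ^^ Suc j) w"
        unfolding Suc by (simp only: matrix_power_mult_vec flip: scaleR_matrix_vector_assoc)
      also have "\<dots> = (1 / fact k * (fact j * cos_coeff j * ?\<phi> ^ j * s)) *\<^sub>R (w \<times> b)
         + (1 / fact k * (fact j * sin_coeff j * ?\<phi> ^ j * (s / ?n))) *\<^sub>R ((w \<times> b) \<times> b)"
        unfolding cross_matrix_iterate[OF False] by (simp add: scaleR_add_right)
      also have "1 / fact k * (fact j * cos_coeff j * ?\<phi> ^ j * s) = sin_coeff k * ?\<phi> ^ k / ?n"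
        unfolding Suc using False by (simp add: sin_coeff_Suc field_simps del: of_nat_Suc)
      also have "1 / fact k * (fact j * sin_coeff j * ?\<phi> ^ j * (s / ?n)) = (?I k - cos_coeff k * ?\<phi> ^ k) / ?n\<^sup>2"
        unfolding Suc using False
        by (simp add: cos_coeff_Suc power2_eq_square field_simps del: of_nat_Suc)
      finally show ?thesis
        using Suc by (simp only: act) simp
    qed
    then show ?thesis unfolding matrix_eq by blast
  qed
  have "(\<lambda>k. sin_coeff k * ?\<phi> ^ k) sums sin ?\<phi>" "(\<lambda>k. cos_coeff k * ?\<phi> ^ k) sums cos ?\<phi>"
    using sin_converges[of ?\<phi>] cos_converges[of ?\<phi>] by simp_all
  moreover have "?I sums 1"
    using sums_single[of 0 "\<lambda>_. 1::real"] by simp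
  ultimately have "?S sums ((sin ?\<phi> / ?n) *\<^sub>R ?A + ((1 - cos ?\<phi>) / ?n\<^sup>2) *\<^sub>R ?A2 + 1 *\<^sub>R mat 1)"
    by (intro sums_add sums_scaleR_left sums_divide sums_diff)
  then have "matrix_exp (s *\<^sub>R ?A) = (sin ?\<phi> / ?n) *\<^sub>R ?A + ((1 - cos ?\<phi>) / ?n\<^sup>2) *\<^sub>R ?A2 + 1 *\<^sub>R mat 1"
    unfolding matrix_exp_def T by (rule sums_unique[symmetric])
  then show ?thesis
    by (simp only: act gyration_def) simp
qed

lemma matrix_exp_magnetic: "matrix_exp (s *\<^sub>R magnetic_matrix B y) *v w = gyration s (B y) w"
  unfolding magnetic_matrix_def by (rule matrix_exp_cross)

lemma IMS_O2_step:
  assumes "IMS_O2 U B x0 v0 h x v"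
  defines "J \<equiv> \<lambda>n. integral {0..1} (\<lambda>\<rho>. electric_field U (\<rho> *\<^sub>R x n + (1 - \<rho>) *\<^sub>R x (Suc n)))"
  shows "x (Suc n) = x n + h *\<^sub>R gyration (h/2) (B (x n)) (v n) + (h\<^sup>2 / 2) *\<^sub>R J n"
    and "v (Suc n) = gyration (h/2) (B (x (Suc n))) (gyration (h/2) (B (x n)) (v n) + h *\<^sub>R J n)"
  using assms(1)
  by (simp_all add: IMS_O2_def Let_def matrix_exp_magnetic gyration_add gyration_scaleR J_def)

lemma EXS_O2_step:
  assumes "EXS_O2 U B x0 v0 h x v"
  defines "E \<equiv> electric_field U"
  shows "x (Suc n) = x n + h *\<^sub>R gyration (h/2) (B (x n)) (v n) + (h\<^sup>2 / 2) *\<^sub>R E (x n)"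
    and "v (Suc n) = gyration (h/2) (B (x (Suc n)))
      (gyration (h/2) (B (x n)) (v n) + (h/2) *\<^sub>R (E (x n) + E (x (Suc n))))"
  using assms(1)
  by (simp_all add: EXS_O2_def Let_def matrix_exp_magnetic gyration_add gyration_scaleR E_def)

section \<open>Exact conservation laws\<close>

text \<open>The defining property of the average vector field method: the averaged force does exactly the
work given by the difference in potential.\<close>

lemma averaged_gradient:
  fixes U :: "real ^ 'n \<Rightarrow> real"
  assumes "smooth U"
  shows "(x' - x) \<bullet> integral {0..1} (\<lambda>\<rho>. grad U (\<rho> *\<^sub>R x + (1 - \<rho>) *\<^sub>R x')) = U x' - U x"
proof -
  let ?y = "\<lambda>\<rho>. \<rho> *\<^sub>R x + (1 - \<rho>) *\<^sub>R x'"
  have "continuous_on UNIV (grad U)"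
    using assms by (rule smooth_continuous_grad)
  then have "continuous_on {0..1} (\<lambda>\<rho>. grad U (?y \<rho>))"
    by (rule continuous_on_compose2) (auto intro!: continuous_intros)
  then have "(\<lambda>\<rho>. grad U (?y \<rho>)) integrable_on {0..1}"
    by (rule integrable_continuous_real)
  then have "((\<lambda>\<rho>. (x' - x) \<bullet> grad U (?y \<rho>)) has_integral
      (x' - x) \<bullet> integral {0..1} (\<lambda>\<rho>. grad U (?y \<rho>))) {0..1}"
    using has_integral_linear[OF integrable_integral bounded_linear_inner_right[of "x' - x"]]
    by (simp add: o_def)
  \<comment> \<open>The segment is traversed from \<open>x'\<close> at \<open>\<rho> = 0\<close> to \<open>x\<close> at \<open>\<rho> = 1\<close>, whence the sign.\<close>
  moreover have "((\<lambda>\<rho>. (x' - x) \<bullet> grad U (?y \<rho>)) has_integral (- U (?y 1)) - (- U (?y 0))) {0..1}"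
  proof (rule fundamental_theorem_of_calculus)
    fix t :: real
    have "((\<lambda>t. U (?y t)) has_real_derivative grad U (?y t) \<bullet> (x - x')) (at t)"
      by (rule has_real_derivative_compose_grad[OF smooth_differentiable[OF assms]])
         (auto intro!: derivative_eq_intros simp: algebra_simps)
    then have "((\<lambda>t. - U (?y t)) has_real_derivative (x' - x) \<bullet> grad U (?y t)) (at t)"
      by (rule DERIV_minus[THEN DERIV_cong]) (simp add: inner_diff inner_commute algebra_simps)
    then show "((\<lambda>t. - U (?y t)) has_vector_derivative (x' - x) \<bullet> grad U (?y t)) (at t within {0..1})"
      by (simp add: has_real_derivative_iff_has_vector_derivative has_vector_derivative_at_within)
  qed auto
  ultimately show ?thesis
    by (auto dest: has_integral_unique)
qed

lemma norm_add_scaleR_squared: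
  "(norm (w + c *\<^sub>R J))\<^sup>2 = w \<bullet> w + 2 * c * (w \<bullet> J) + c\<^sup>2 * (J \<bullet> J)" for w J :: "'a::real_inner"
  by (simp only: power2_norm_eq_inner inner_add inner_scaleR_left inner_scaleR_right
      inner_commute[of J w]) (simp add: power2_eq_square algebra_simps)

text \<open>The rotations do not change the speed. Between them, the averaged force \<open>J\<close> changes the kinetic
energy by its inner product with the displacement, which is minus the change of the potential.\<close>

lemma IMS_O2_energy_step:
  assumes "smooth U" "IMS_O2 U B x0 v0 h x v"
  shows "energy U (x (Suc n)) (v (Suc n)) = energy U (x n) (v n)"
proof -
  define J where "J = integral {0..1} (\<lambda>\<rho>. electric_field U (\<rho> *\<^sub>R x n + (1 - \<rho>) *\<^sub>R x (Suc n)))"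
  define w where "w = gyration (h/2) (B (x n)) (v n)"
  have x: "x (Suc n) - x n = h *\<^sub>R w + (h\<^sup>2 / 2) *\<^sub>R J"
    unfolding w_def J_def by (subst IMS_O2_step(1)[OF assms(2), of n]) simp
  have "(x (Suc n) - x n) \<bullet> J = - (U (x (Suc n)) - U (x n))"
    using averaged_gradient[OF assms(1), of "x (Suc n)" "x n"]
    by (simp add: electric_field_def J_def)
  then have "U (x (Suc n)) - U (x n) = - (h * (w \<bullet> J) + h\<^sup>2 / 2 * (J \<bullet> J))"
    unfolding x inner_add_left inner_scaleR_left by simp
  moreover have "(norm (v (Suc n)))\<^sup>2 = (norm (w + h *\<^sub>R J))\<^sup>2" "(norm (v n))\<^sup>2 = w \<bullet> w"
    using IMS_O2_step(2)[OF assms(2), of n] power2_norm_eq_inner[of w] by (simp_all add: w_def J_def)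
  ultimately show ?thesis
    unfolding energy_def norm_add_scaleR_squared by (simp add: field_simps)
qed

lemma grad_quadratic:
  fixes Q :: "real ^ 'n ^ 'n"
  assumes "transpose Q = Q" and "\<And>x. U x = (x \<bullet> (Q *v x)) / 2 + q \<bullet> x"
  shows "grad U x = Q *v x + q"
proof -
  have sym: "y \<bullet> (Q *v z) = (Q *v y) \<bullet> z" for y z
    using dot_lmul_matrix[of y Q z] assms(1) by (metis transpose_matrix_vector)
  have "(U has_derivative (\<lambda>w. (w \<bullet> (Q *v x) + x \<bullet> (Q *v w)) / 2 + q \<bullet> w)) (at x)"
    unfolding assms(2)[abs_def]
    by (auto intro!: derivative_eq_intros bounded_linear.has_derivative[OF matrix_vector_mul_bounded_linear]
        simp: algebra_simps)
  also have "(\<lambda>w. (w \<bullet> (Q *v x) + x \<bullet> (Q *v w)) / 2 + q \<bullet> w) = (\<lambda>w. w \<bullet> (Q *v x + q))"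
    by (auto simp: sym[of x] inner_add inner_commute[of _ q] inner_commute[of "Q *v x"])
  finally have "frechet_derivative U (at x) = (\<lambda>w. w \<bullet> (Q *v x + q))"
    by (rule frechet_derivative_at[symmetric])
  then show ?thesis
    by (simp add: vec_eq_iff grad_def partial_deriv_def inner_axis')
qed

text \<open>For quadratic potentials the trapezoidal rule for the work integral is exact.\<close>

lemma quadratic_potential_diff:
  assumes "quadratic_potential U"
  shows "U x' - U x = (x' - x) \<bullet> (grad U x + grad U x') / 2"
proof -
  obtain Q q where Q: "transpose Q = Q" and U: "\<And>x. U x = (x \<bullet> (Q *v x)) / 2 + q \<bullet> x"
    using assms unfolding quadratic_potential_def by blast
  have "x \<bullet> (Q *v x') = x' \<bullet> (Q *v x)"
    using dot_lmul_matrix[of x Q x'] Q by (metis transpose_matrix_vector inner_commute)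
  then have "(x' - x) \<bullet> ((Q *v x + q) + (Q *v x' + q)) = x' \<bullet> (Q *v x') - x \<bullet> (Q *v x) + 2 * (q \<bullet> x' - q \<bullet> x)"
    unfolding inner_add inner_diff inner_commute[of x q] inner_commute[of x' q] by simp
  then show ?thesis
    unfolding grad_quadratic[OF Q U] U by simp
qed

text \<open>The velocity feels the mean of the two end forces, the position only the initial one. By the
exact trapezoidal rule the energy defect of one step is \<open>h\<^sup>2 / 8\<close> times the difference of the
squared forces, which is itself a difference of end values and can be absorbed into the energy.\<close>

lemma EXS_O2_modified_energy_step:
  assumes "quadratic_potential U" "EXS_O2 U B x0 v0 h x v"
  shows "modified_energy U h (x (Suc n)) (v (Suc n)) = modified_energy U h (x n) (v n)"
proof -
  define E E' where E: "E = grad U (x n)" "E' = grad U (x (Suc n))"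
  define w where "w = gyration (h/2) (B (x n)) (v n)"
  have x: "x (Suc n) - x n = h *\<^sub>R w - (h\<^sup>2 / 2) *\<^sub>R E"
    using EXS_O2_step(1)[OF assms(2), of n] by (simp add: w_def E electric_field_def)
  have "norm (v (Suc n)) = norm (w + (- (h/2)) *\<^sub>R (E + E'))"
    using EXS_O2_step(2)[OF assms(2), of n]
    by (simp add: w_def E electric_field_def algebra_simps)
  moreover have "(E + E') \<bullet> (E + E') = 2 * (E \<bullet> (E + E')) - E \<bullet> E + E' \<bullet> E'"
    by (simp add: inner_add inner_commute[of E' E])
  ultimately have "(norm (v (Suc n)))\<^sup>2 = w \<bullet> w - h * (w \<bullet> (E + E'))
      + h\<^sup>2 / 4 * (2 * (E \<bullet> (E + E')) - E \<bullet> E + E' \<bullet> E')"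
    by (simp only: norm_add_scaleR_squared) (simp add: power2_eq_square)
  moreover have "(norm (v n))\<^sup>2 = w \<bullet> w"
    by (simp add: w_def flip: power2_norm_eq_inner)
  moreover have "U (x (Suc n)) - U (x n) = h / 2 * (w \<bullet> (E + E')) - h\<^sup>2 / 4 * (E \<bullet> (E + E'))"
    using quadratic_potential_diff[OF assms(1), of "x (Suc n)" "x n"]
    unfolding x E[symmetric] by (simp add: inner_diff_left)
  ultimately show ?thesis
    unfolding modified_energy_def E[symmetric] power2_norm_eq_inner[of E] power2_norm_eq_inner[of E']
    by (simp add: field_simps)
qed

section \<open>The two-step recurrence and its regularity\<close>

text \<open>In a constant field the explicit method satisfies the two-step recurrence of the Boris scheme
with the rescaled factor \<open>\<tau>\<close> in place of \<open>h / 2\<close>. It contains positions only; the velocities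
enter through the bound on the first differences.\<close>

definition boris_orbit :: "(real ^ 3 \<Rightarrow> real ^ 3) \<Rightarrow> real ^ 3 \<Rightarrow> real \<Rightarrow> real \<Rightarrow> real \<Rightarrow> nat \<Rightarrow> (nat \<Rightarrow> real ^ 3) \<Rightarrow> bool"
  where "boris_orbit E b C h \<tau> L x \<longleftrightarrow> 0 < h \<and> h \<le> 1 \<and> \<bar>\<tau>\<bar> \<le> h \<and>
     (\<forall>n\<le>L. norm (x n) \<le> C) \<and> (\<forall>n<L. norm (fdiff x n) \<le> C * h) \<and>
     (\<forall>n. Suc n < L \<longrightarrow> fdiff x (Suc n) - fdiff x n
        = \<tau> *\<^sub>R ((fdiff x (Suc n) + fdiff x n) \<times> b) + h\<^sup>2 *\<^sub>R E (x (Suc n)))"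

text \<open>Discrete regularity of the trajectories: once positions and first differences are bounded, the
recurrence expresses the second difference by lower ones, and all higher differences follow with
the natural power of \<open>h\<close>, uniformly in the number of steps \<open>L\<close>.\<close>

lemma boris_orbit_fdiff_bounded:
  assumes "\<And>i. smooth (\<lambda>x. E x $ i)" "0 \<le> C"
  shows "\<exists>D\<ge>0. \<forall>h \<tau> L x. boris_orbit E b C h \<tau> L x \<longrightarrow>
    (\<forall>n k. k \<le> K \<longrightarrow> n + k \<le> L \<longrightarrow> norm ((fdiff ^^ k) x n) \<le> D * h ^ k)"
proof (induction K)
  case 0
  show ?case
    using assms(2) by (intro exI[of _ C]) (auto simp: boris_orbit_def)
next
  case (Suc K)
  then obtain D where D: "0 \<le> D" "\<And>h \<tau> L x n k. boris_orbit E b C h \<tau> L x \<Longrightarrow> k \<le> K \<Longrightarrow>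
      n + k \<le> L \<Longrightarrow> norm ((fdiff ^^ k) x n) \<le> D * h ^ k" by blast
  show ?case
  proof (cases K)
    case 0
    then show ?thesis
      using assms(2) by (intro exI[of _ C]) (auto simp: boris_orbit_def le_Suc_eq)
  next
    case K: (Suc j)
    obtain D' where D': "0 \<le> D'" "\<And>h z. 0 < h \<Longrightarrow> h \<le> 1 \<Longrightarrow> (\<forall>k\<le>j. norm ((fdiff ^^ k) z 0) \<le> D * h ^ k) \<Longrightarrow>
        norm ((fdiff ^^ j) (\<lambda>j. E (z j)) 0) \<le> D' * h ^ j"
      using fdiff_compose_bounded_vec[OF assms(1) D(1), of j] by blast
    define D2 where "D2 = D + (2 * D * norm b + D')"
    have D2: "0 \<le> D2" "D \<le> D2" using D(1) D'(1) by (auto simp: D2_def)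
    have "norm ((fdiff ^^ k) x n) \<le> D2 * h ^ k"
      if orb: "boris_orbit E b C h \<tau> L x" and k: "k \<le> Suc K" "n + k \<le> L" for h \<tau> L x n k
    proof (cases "k \<le> K")
      case True
      have "0 < h" using orb by (simp add: boris_orbit_def)
      then show ?thesis
        using D(2)[OF orb True k(2)] D2 by (smt (verit) mult_right_mono zero_le_power)
    next
      case False
      then have k': "k = Suc (Suc j)" using k K by simp
      have h: "0 < h" "h \<le> 1" "\<bar>\<tau>\<bar> \<le> h" using orb by (auto simp: boris_orbit_def)
      \<comment> \<open>Difference the recurrence \<open>j\<close> times: the magnetic term costs one difference of order
        \<open>j + 1\<close> but carries \<open>\<tau>\<close>, the electric term costs one of order \<open>j\<close> but carries \<open>h\<^sup>2\<close>.\<close>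
      have "(fdiff ^^ k) x n = (fdiff ^^ j) (fdiff (fdiff x)) n"
        unfolding k' by (simp add: funpow_swap1)
      also have "\<dots> = (fdiff ^^ j)
          (\<lambda>i. \<tau> *\<^sub>R ((fdiff x (1 + i) + fdiff x i) \<times> b) + h\<^sup>2 *\<^sub>R E (x (1 + i))) n"
        using orb k(2) k'
        by (intro fdiff_iter_cong) (simp add: fdiff_def[of "fdiff x"] boris_orbit_def)
      also have "\<dots> = \<tau> *\<^sub>R (((fdiff ^^ j) (\<lambda>i. fdiff x (1 + i)) n + (fdiff ^^ j) (fdiff x) n) \<times> b)
          + h\<^sup>2 *\<^sub>R (fdiff ^^ j) (\<lambda>i. E (x (1 + i))) n"
        unfolding fdiff_iter_add
        by (subst (1 2) fdiff_iter_linear)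
           (simp_all add: cross_diff_left fdiff_iter_add algebra_simps)
      also have "(fdiff ^^ j) (\<lambda>i. fdiff x (1 + i)) n = (fdiff ^^ Suc j) x (Suc n)"
        unfolding fdiff_iter_shift by (simp add: funpow_swap1)
      also have "(fdiff ^^ j) (fdiff x) n = (fdiff ^^ Suc j) x n"
        by (simp add: funpow_swap1)
      also have "(fdiff ^^ j) (\<lambda>i. E (x (1 + i))) n = (fdiff ^^ j) (\<lambda>i. E (x (Suc n + i))) 0"
        using fdiff_iter_shift[of j "\<lambda>i. E (x (1 + i))" n 0] by (simp add: add.assoc)
      finally have eq: "(fdiff ^^ k) x n = \<tau> *\<^sub>R (((fdiff ^^ Suc j) x (Suc n) + (fdiff ^^ Suc j) x n) \<times> b)
          + h\<^sup>2 *\<^sub>R (fdiff ^^ j) (\<lambda>i. E (x (Suc n + i))) 0" .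
      have "norm ((fdiff ^^ Suc j) x (Suc n)) \<le> D * h ^ Suc j" "norm ((fdiff ^^ Suc j) x n) \<le> D * h ^ Suc j"
        using D(2)[OF orb, of "Suc j"] k k' K by auto
      then have "norm ((fdiff ^^ Suc j) x (Suc n) + (fdiff ^^ Suc j) x n) \<le> 2 * (D * h ^ Suc j)"
        by (intro norm_triangle_le) linarith
      then have "norm (((fdiff ^^ Suc j) x (Suc n) + (fdiff ^^ Suc j) x n) \<times> b) \<le> 2 * (D * h ^ Suc j) * norm b"
        by (meson norm_cross_le order_trans mult_right_mono norm_ge_zero)
      then have 1: "norm (\<tau> *\<^sub>R (((fdiff ^^ Suc j) x (Suc n) + (fdiff ^^ Suc j) x n) \<times> b))
          \<le> h * (2 * (D * h ^ Suc j) * norm b)"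
        using h unfolding norm_scaleR by (intro mult_mono) auto
      have "\<forall>k\<le>j. norm ((fdiff ^^ k) (\<lambda>i. x (Suc n + i)) 0) \<le> D * h ^ k"
        unfolding fdiff_iter_shift using D(2)[OF orb] k k' K by simp
      from D'(2)[OF h(1,2) this]
      have 2: "norm (h\<^sup>2 *\<^sub>R (fdiff ^^ j) (\<lambda>i. E (x (Suc n + i))) 0) \<le> h\<^sup>2 * (D' * h ^ j)"
        unfolding norm_scaleR by (simp add: mult_left_mono)
      have "norm ((fdiff ^^ k) x n) \<le> h * (2 * (D * h ^ Suc j) * norm b) + h\<^sup>2 * (D' * h ^ j)"
        unfolding eq using 1 2 by (rule norm_triangle_mono)
      also have "\<dots> = (2 * D * norm b + D') * h ^ k"
        unfolding k' by (simp add: power2_eq_square algebra_simps)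
      also have "\<dots> \<le> D2 * h ^ k"
        using D(1) h by (intro mult_right_mono) (auto simp: D2_def)
      finally show ?thesis .
    qed
    then show ?thesis using D2(1) by blast
  qed
qed

lemma boris_orbit_window:
  assumes "\<And>i. smooth (\<lambda>x. E x $ i)" "0 \<le> C"
  shows "\<exists>D\<ge>0. \<forall>h \<tau> L x n. boris_orbit E b C h \<tau> L x \<and> m \<le> n \<and> n + m \<le> L \<longrightarrow>
    (\<exists>y. (\<forall>i. bounded_derivs Q D (real m) (\<lambda>t. y t $ i))
       \<and> (\<forall>l. \<bar>l\<bar> \<le> int m \<longrightarrow> y (real_of_int l * h) = x (nat (int n + l))))"
proof -
  obtain D0 where D0: "0 \<le> D0" "\<And>h \<tau> L x n k. boris_orbit E b C h \<tau> L x \<Longrightarrow> k \<le> 2 * m \<Longrightarrow>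
      n + k \<le> L \<Longrightarrow> norm ((fdiff ^^ k) x n) \<le> D0 * h ^ k"
    using boris_orbit_fdiff_bounded[OF assms, where b = b and K = "2 * m"] by blast
  obtain D where D: "0 \<le> D" "\<And>h (z :: nat \<Rightarrow> real ^ 3). 0 < h \<Longrightarrow> h \<le> 1 \<Longrightarrow>
      (\<forall>k\<le>2 * m. norm ((fdiff ^^ k) z 0) \<le> D0 * h ^ k) \<Longrightarrow>
      (\<exists>y. (\<forall>i. bounded_derivs Q D (real m) (\<lambda>t. y t $ i)) \<and> (\<forall>j\<le>2 * m. y ((real j - real m) * h) = z j))"
    using interpolating_curve_vec[OF D0(1), of "real m" "2 * m" Q m, where 'n = 3] by auto
  have "\<exists>y. (\<forall>i. bounded_derivs Q D (real m) (\<lambda>t. y t $ i))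
       \<and> (\<forall>l. \<bar>l\<bar> \<le> int m \<longrightarrow> y (real_of_int l * h) = x (nat (int n + l)))"
    if orb: "boris_orbit E b C h \<tau> L x" and n: "m \<le> n" "n + m \<le> L" for h \<tau> L x n
  proof -
    have h: "0 < h" "h \<le> 1" using orb by (auto simp: boris_orbit_def)
    have "\<forall>k\<le>2 * m. norm ((fdiff ^^ k) (\<lambda>j. x (n - m + j)) 0) \<le> D0 * h ^ k"
      unfolding fdiff_iter_shift using D0(2)[OF orb] n by auto
    from D(2)[OF h this] obtain y where y: "\<forall>i. bounded_derivs Q D (real m) (\<lambda>t. y t $ i)"
      "\<And>j. j \<le> 2 * m \<Longrightarrow> y ((real j - real m) * h) = x (n - m + j)" by blast
    have "y (real_of_int l * h) = x (nat (int n + l))" if l: "\<bar>l\<bar> \<le> int m" for l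
    proof -
      have "nat (int m + l) \<le> 2 * m" "real (nat (int m + l)) - real m = real_of_int l"
        "n - m + nat (int m + l) = nat (int n + l)"
        using l n by auto
      then show ?thesis using y(2)[of "nat (int m + l)"] by simp
    qed
    then show ?thesis using y(1) by blast
  qed
  then show ?thesis using D(1) by blast
qed

lemma one_minus_cos_le: "1 - cos x \<le> x\<^sup>2 / 2" for x :: real
proof -
  have "1 - cos x = 2 * (sin (x / 2))\<^sup>2"
    using cos_double_sin[of "x / 2"] by simp
  moreover have "\<bar>sin (x / 2)\<bar>\<^sup>2 \<le> \<bar>x / 2\<bar>\<^sup>2"
    by (intro power_mono abs_sin_x_le_abs_x) simp
  ultimately show ?thesis by (simp add: power_divide)
qed

text \<open>In a constant field the two half rotations that meet at a time step are the same map. Undoing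
one of them gives the step before in terms of the velocity after it, with the inverse rotation;
sum and difference of consecutive increments then isolate the even and odd parts of the rotation.
Dividing the odd by the even part produces the tangent \<open>\<tau>\<close>.\<close>

lemma EXS_O2_constant_field:
  fixes b :: "real ^ 3"
  assumes exs: "EXS_O2 U B x0 v0 h x v" and B: "\<And>y. B y = b" and h: "0 < h" "h * norm b \<le> 1"
  defines "\<beta> \<equiv> (1 - cos (h / 2 * norm b)) / (norm b)\<^sup>2"
    and "\<tau> \<equiv> sin (h / 2 * norm b) / norm b / cos (h / 2 * norm b)"
  shows "fdiff x (Suc n) + fdiff x n = (2 * h) *\<^sub>R (v (Suc n) + \<beta> *\<^sub>R ((v (Suc n) \<times> b) \<times> b))"
    and "fdiff x (Suc n) - fdiff x n = \<tau> *\<^sub>R ((fdiff x (Suc n) + fdiff x n) \<times> b)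
           + h\<^sup>2 *\<^sub>R electric_field U (x (Suc n))"
    and "\<bar>\<tau>\<bar> \<le> h" and "\<bar>\<beta>\<bar> \<le> h\<^sup>2"
proof -
  define \<phi> \<alpha> where "\<phi> = h / 2 * norm b" and "\<alpha> = sin \<phi> / norm b"
  define E where "E = electric_field U"
  let ?V = "v (Suc n)"
  have \<tau>: "\<tau> = \<alpha> / cos \<phi>" and \<beta>: "\<beta> = (1 - cos \<phi>) / (norm b)\<^sup>2"
    by (simp_all add: \<tau>_def \<alpha>_def \<beta>_def \<phi>_def)
  have \<phi>: "0 \<le> \<phi>" "\<phi> \<le> 1 / 2" using h by (auto simp: \<phi>_def)
  then have "\<phi>\<^sup>2 \<le> (1/2)\<^sup>2" by (intro power_mono) auto
  then have c: "1 / 2 \<le> cos \<phi>"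
    using one_minus_cos_le[of \<phi>] by (simp add: power_divide)
  have "\<bar>sin \<phi>\<bar> \<le> h / 2 * norm b"
    using abs_sin_x_le_abs_x[of \<phi>] \<phi>(1) by (simp add: \<phi>_def)
  then have \<alpha>: "\<bar>\<alpha>\<bar> \<le> h / 2"
    using h by (cases "b = 0") (auto simp: \<alpha>_def pos_divide_le_eq)
  have "\<bar>\<tau>\<bar> \<le> (h / 2) / (1 / 2)"
    unfolding \<tau> abs_divide using \<alpha> c by (intro frac_le) auto
  then show "\<bar>\<tau>\<bar> \<le> h" by simp
  have "1 - cos \<phi> \<le> h\<^sup>2 / 8 * (norm b)\<^sup>2"
    using one_minus_cos_le[of \<phi>] by (simp add: \<phi>_def power_mult_distrib power_divide)
  then have "\<beta> \<le> h\<^sup>2 / 8"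
    unfolding \<beta> using h by (cases "b = 0") (auto simp: pos_divide_le_eq)
  moreover have "0 \<le> \<beta>" unfolding \<beta> by simp
  ultimately show "\<bar>\<beta>\<bar> \<le> h\<^sup>2" using zero_le_power2[of h] by linarith
  have g: "gyration (h/2) b w = w + \<alpha> *\<^sub>R (w \<times> b) + \<beta> *\<^sub>R ((w \<times> b) \<times> b)" for w
    by (simp add: gyration_def \<alpha>_def \<beta>_def \<phi>_def)
  have g': "gyration (- (h/2)) b w = w - \<alpha> *\<^sub>R (w \<times> b) + \<beta> *\<^sub>R ((w \<times> b) \<times> b)" for w
    by (simp add: gyration_def \<alpha>_def \<beta>_def \<phi>_def)
  have d: "fdiff x k = h *\<^sub>R gyration (h/2) b (v k) + (h\<^sup>2 / 2) *\<^sub>R E (x k)" for k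
    using EXS_O2_step(1)[OF exs, of k] by (simp add: fdiff_def B E_def)
  have "gyration (- (h/2)) b ?V = gyration (h/2) b (v n) + (h/2) *\<^sub>R (E (x n) + E (x (Suc n)))"
    unfolding EXS_O2_step(2)[OF exs, of n] B E_def by (rule gyration_inverse)
  then have "gyration (h/2) b (v n) = gyration (- (h/2)) b ?V - (h/2) *\<^sub>R (E (x n) + E (x (Suc n)))"
    by (simp add: algebra_simps)
  then have "fdiff x n = h *\<^sub>R (gyration (- (h/2)) b ?V - (h/2) *\<^sub>R (E (x n) + E (x (Suc n)))) + (h\<^sup>2 / 2) *\<^sub>R E (x n)"
    unfolding d[of n] by simp
  then have dn: "fdiff x n = h *\<^sub>R gyration (- (h/2)) b ?V - (h\<^sup>2 / 2) *\<^sub>R E (x (Suc n))"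
    by (simp add: vec_eq_iff power2_eq_square field_simps)
  show sum: "fdiff x (Suc n) + fdiff x n = (2 * h) *\<^sub>R (?V + \<beta> *\<^sub>R ((?V \<times> b) \<times> b))"
    unfolding dn d[of "Suc n"] g g' by (simp add: vec_eq_iff algebra_simps)
  have diff: "fdiff x (Suc n) - fdiff x n = (2 * h * \<alpha>) *\<^sub>R (?V \<times> b) + h\<^sup>2 *\<^sub>R E (x (Suc n))"
    unfolding dn d[of "Suc n"] g g' by (simp add: vec_eq_iff algebra_simps)
  have X: "(fdiff x (Suc n) + fdiff x n) \<times> b = (2 * h * (1 - \<beta> * (norm b)\<^sup>2)) *\<^sub>R (?V \<times> b)"
    unfolding sum cross_mult_left cross_add_left cross_cross_cross by (simp add: vec_eq_iff algebra_simps)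
  \<comment> \<open>For \<open>b \<noteq> 0\<close> the factor \<open>1 - \<beta> * (norm b)\<^sup>2\<close> is the cosine in the denominator of \<open>\<tau>\<close>; for
    \<open>b = 0\<close> division by zero makes both sides vanish, as they should.\<close>
  have "\<tau> * (1 - \<beta> * (norm b)\<^sup>2) = \<alpha>"
    using c by (cases "b = 0") (auto simp: \<tau> \<beta> \<alpha>_def)
  then have "\<tau> * (2 * h * (1 - \<beta> * (norm b)\<^sup>2)) = 2 * h * \<alpha>"
    by (metis mult.left_commute)
  then have "\<tau> *\<^sub>R ((fdiff x (Suc n) + fdiff x n) \<times> b) = (2 * h * \<alpha>) *\<^sub>R (?V \<times> b)"
    unfolding X scaleR_scaleR by (simp only:)
  then show "fdiff x (Suc n) - fdiff x n = \<tau> *\<^sub>R ((fdiff x (Suc n) + fdiff x n) \<times> b)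
           + h\<^sup>2 *\<^sub>R electric_field U (x (Suc n))"
    unfolding diff E_def by simp
qed

lemma smooth_electric_field: "smooth U \<Longrightarrow> smooth (\<lambda>x. electric_field U x $ i)"
proof -
  assume "smooth U"
  have "higher_differentiable k f \<Longrightarrow> higher_differentiable k (\<lambda>x. - f x)" for k and f :: "real ^ 3 \<Rightarrow> real"
  proof (induction k arbitrary: f)
    case (Suc k)
    have "frechet_derivative (\<lambda>x. - f x) (at x) = (\<lambda>w. - frechet_derivative f (at x) w)" for x
      using Suc.prems by (intro frechet_derivative_at[symmetric] has_derivative_minus)
        (simp flip: frechet_derivative_works)
    then show ?case using Suc by simp
  qed (auto intro: continuous_intros)
  then show ?thesis
    using smooth_partial_deriv[OF \<open>smooth U\<close>, of i]
    by (simp add: smooth_def electric_field_def grad_def)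
qed

lemma EXS_O2_boris_orbit:
  fixes b :: "real ^ 3"
  assumes exs: "EXS_O2 U B x0 v0 h x v" and B: "\<And>y. B y = b" and h: "0 < h" "h \<le> 1" "h * norm b \<le> 1"
    and bd: "\<And>n. n \<le> L \<Longrightarrow> norm (x n) \<le> C \<and> norm (v n) \<le> C"
    and G: "\<And>y. norm y \<le> C \<Longrightarrow> norm (grad U y) \<le> G"
  shows "boris_orbit (electric_field U) b (C + G) h (sin (h / 2 * norm b) / norm b / cos (h / 2 * norm b)) L x"
proof -
  have C: "0 \<le> C" using bd[of 0] norm_ge_zero[of "x 0"] by linarith
  have G0: "0 \<le> G" using G[of 0] C norm_ge_zero[of "grad U 0"] by (simp del: norm_ge_zero)
  have "norm (fdiff x n) \<le> (C + G) * h" if "n < L" for n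
  proof -
    have "fdiff x n = h *\<^sub>R gyration (h/2) (B (x n)) (v n) + (h\<^sup>2 / 2) *\<^sub>R electric_field U (x n)"
      using EXS_O2_step(1)[OF exs, of n] by (simp add: fdiff_def)
    also have "norm \<dots> \<le> h * C + h * G"
    proof (intro norm_triangle_mono)
      show "norm (h *\<^sub>R gyration (h/2) (B (x n)) (v n)) \<le> h * C"
        using bd[of n] that h by simp
      have "h\<^sup>2 / 2 \<le> h" using h by (simp add: power2_eq_square)
      then show "norm ((h\<^sup>2 / 2) *\<^sub>R electric_field U (x n)) \<le> h * G"
        unfolding norm_scaleR using G[of "x n"] bd[of n] that h G0
        by (intro mult_mono) (auto simp: electric_field_def)
    qed
    finally show ?thesis by (simp add: algebra_simps)
  qed
  moreover have "norm (x n) \<le> C + G" if "n \<le> L" for n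
    using bd[OF that] G0 by simp
  ultimately show ?thesis
    unfolding boris_orbit_def using EXS_O2_constant_field(2,3)[OF exs B h(1,3)] h by auto
qed

section \<open>Central difference stencils of high order\<close>

lemma sum_pairs_telescope:
  fixes e g :: "nat \<Rightarrow> real"
  shows "(\<Sum>i<2 * m. e (i div 2) * (g (Suc i) - g i)) = (\<Sum>i<m. e i * (g (2 * Suc i) - g (2 * i)))"
  by (induction m) (simp_all add: algebra_simps)

text \<open>Richardson extrapolation yields central difference rules of any order. The weights multiply
symmetric pairs of increments rather than points, because the telescoping identities below are
stated for such pairs.\<close>

lemma central_stencil_exists:
  "\<exists>m (e :: nat \<Rightarrow> real). \<forall>l\<le>M. (\<Sum>i<m. e i * (real (Suc i) ^ (2 * l + 1) - real i ^ (2 * l + 1)))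
     = (if l = 0 then 1 / 2 else 0)"
proof (induction M)
  case 0
  show ?case by (intro exI[of _ 1] exI[of _ "\<lambda>_. 1 / 2"]) simp
next
  case (Suc M)
  then obtain m and e :: "nat \<Rightarrow> real" where
    e: "\<And>l. l \<le> M \<Longrightarrow> (\<Sum>i<m. e i * (real (Suc i) ^ (2 * l + 1) - real i ^ (2 * l + 1)))
       = (if l = 0 then 1 / 2 else 0)" by blast
  let ?p = "2 * Suc M + 1"
  define S where "S l = (\<Sum>i<m. e i * (real (Suc i) ^ (2 * l + 1) - real i ^ (2 * l + 1)))" for l
  have "(2::real) ^ 1 < 2 ^ ?p" by (intro power_strict_increasing) auto
  then have nz: "(2::real) - 2 ^ ?p \<noteq> 0" by simp
  \<comment> \<open>Richardson extrapolation: the old stencil and the same stencil with doubled step are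
    combined so that the total weight is kept (\<open>\<alpha> + 2 * \<beta> = 1\<close>) and the
    first moment that was still wrong cancels.\<close>
  define \<beta> where "\<beta> = 1 / (2 - 2 ^ ?p :: real)"
  define \<alpha> where "\<alpha> = 1 - 2 * \<beta>"
  have ab: "\<alpha> + \<beta> * 2 ^ ?p = 0"
    using nz unfolding \<alpha>_def \<beta>_def by (simp add: field_simps)
  define f where "f i = \<alpha> * (if i < m then e i else 0) + \<beta> * e (i div 2)" for i
  have f: "(\<Sum>i<2 * m. f i * (real (Suc i) ^ (2 * l + 1) - real i ^ (2 * l + 1))) = (\<alpha> + \<beta> * 2 ^ (2 * l + 1)) * S l" for l
  proof -
    let ?g = "\<lambda>i. real i ^ (2 * l + 1)"
    have "(\<Sum>i<2 * m. (if i < m then e i else 0) * (?g (Suc i) - ?g i))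
        = (\<Sum>i<m. (if i < m then e i else 0) * (?g (Suc i) - ?g i))"
      by (rule sum.mono_neutral_right) auto
    then have 1: "(\<Sum>i<2 * m. (if i < m then e i else 0) * (?g (Suc i) - ?g i)) = S l"
      by (simp add: S_def)
    have "?g (2 * i) = 2 ^ (2 * l + 1) * ?g i" for i
      by (simp add: power_mult_distrib)
    then have "(\<Sum>i<m. e i * (?g (2 * Suc i) - ?g (2 * i))) = 2 ^ (2 * l + 1) * S l"
      unfolding S_def sum_distrib_left by (intro sum.cong) (simp_all only: algebra_simps)
    then have 2: "(\<Sum>i<2 * m. e (i div 2) * (?g (Suc i) - ?g i)) = 2 ^ (2 * l + 1) * S l"
      by (rule trans[OF sum_pairs_telescope])
    have "(\<Sum>i<2 * m. f i * (?g (Suc i) - ?g i))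
       = \<alpha> * (\<Sum>i<2 * m. (if i < m then e i else 0) * (?g (Suc i) - ?g i))
         + \<beta> * (\<Sum>i<2 * m. e (i div 2) * (?g (Suc i) - ?g i))"
      unfolding sum_distrib_left sum.distrib[symmetric] f_def
      by (intro sum.cong) (simp_all only: algebra_simps)
    then show ?thesis unfolding 1 2 by (simp only: algebra_simps)
  qed
  have "(\<Sum>i<2 * m. f i * (real (Suc i) ^ (2 * l + 1) - real i ^ (2 * l + 1))) = (if l = 0 then 1 / 2 else 0)"
    if "l \<le> Suc M" for l
  proof (cases "l = Suc M")
    case True
    then show ?thesis unfolding f using ab by simp
  next
    case False
    then have "S l = (if l = 0 then 1 / 2 else 0)" using e[of l] that by (simp add: S_def)
    then show ?thesis unfolding f by (simp add: \<alpha>_def)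
  qed
  then show ?case by blast
qed

text \<open>An antisymmetric difference quotient written through increments; for a smooth function sampled
with step \<open>h\<close> it approximates \<open>h\<close> times the derivative at the centre.\<close>

definition stencil :: "nat \<Rightarrow> (nat \<Rightarrow> real) \<Rightarrow> (int \<Rightarrow> 'a::real_vector) \<Rightarrow> 'a" where
  "stencil m e z = (\<Sum>i<m. e i *\<^sub>R (z (int i + 1) - z (int i) + z (- int i) - z (- int i - 1)))"

definition stencil_order :: "nat \<Rightarrow> (nat \<Rightarrow> real) \<Rightarrow> nat \<Rightarrow> bool" where
  "stencil_order m e M \<longleftrightarrow> (\<forall>l\<le>M. (\<Sum>i<m. e i * (real (Suc i) ^ (2 * l + 1) - real i ^ (2 * l + 1)))
     = (if l = 0 then 1 / 2 else 0))"

lemma stencil_order_weight: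
  assumes "stencil_order m e M"
  shows "(\<Sum>i<m. e i) = 1 / 2" "0 < m"
proof -
  show "(\<Sum>i<m. e i) = 1 / 2"
    using assms unfolding stencil_order_def by (auto dest: spec[of _ 0])
  then show "0 < m" by (cases m) auto
qed

text \<open>Even powers cancel by antisymmetry, so the odd moments decide everything and the exactness
extends to one degree more.\<close>

lemma stencil_monomial:
  assumes "stencil_order m e M" "k < 2 * M + 3"
  shows "stencil m e (\<lambda>j. (real_of_int j * h) ^ k) = (if k = 1 then h else 0)"
proof (cases "even k")
  case True
  have "(- real i - 1) ^ k = (real i + 1) ^ k" for i
    using power_minus_even[OF True, of "real i + 1"] by simp
  then show ?thesis
    using True by (auto simp: stencil_def power_mult_distrib add.commute intro!: sum.neutral)
next
  case False
  then obtain l where l: "k = 2 * l + 1" by (auto elim: oddE)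
  have "stencil m e (\<lambda>j. (real_of_int j * h) ^ k)
      = (\<Sum>i<m. 2 * h ^ k * (e i * (real (Suc i) ^ k - real i ^ k)))"
    unfolding stencil_def
  proof (rule sum.cong)
    fix i
    have "- real i - 1 = - real (Suc i)" by simp
    then have m: "(- real i) ^ k = - (real i ^ k)" "(- real i - 1) ^ k = - (real (Suc i) ^ k)"
      by (simp_all only: power_minus_odd[OF False])
    have "real_of_int (int i + 1) = real (Suc i)" "real_of_int (- int i - 1) = - real i - 1" by auto
    then show "e i *\<^sub>R ((real_of_int (int i + 1) * h) ^ k - (real_of_int (int i) * h) ^ k
        + (real_of_int (- int i) * h) ^ k - (real_of_int (- int i - 1) * h) ^ k)
        = 2 * h ^ k * (e i * (real (Suc i) ^ k - real i ^ k))"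
      by (simp only: power_mult_distrib of_int_minus of_int_of_nat_eq m) (simp add: algebra_simps)
  qed simp
  also have "\<dots> = 2 * h ^ k * (\<Sum>i<m. e i * (real (Suc i) ^ k - real i ^ k))"
    by (simp add: sum_distrib_left)
  also have "\<dots> = (if k = 1 then h else 0)"
    using assms unfolding stencil_order_def l by auto
  finally show ?thesis .
qed

lemma stencil_cong:
  "(\<And>l. \<bar>l\<bar> \<le> int m \<Longrightarrow> z l = w l) \<Longrightarrow> stencil m e z = stencil m e w"
  by (auto simp: stencil_def intro!: sum.cong)

lemma stencil_nth: "stencil m e z $ i = stencil m e (\<lambda>j. z j $ i)"
  by (simp add: stencil_def)

lemma stencil_diff: "stencil m e (\<lambda>j. z j - w j) = stencil m e z - stencil m e w"
  by (simp add: stencil_def algebra_simps flip: sum_subtractf)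

lemma stencil_scale_sum:
  "finite S \<Longrightarrow> stencil m e (\<lambda>j. \<Sum>k\<in>S. c k * z k j) = (\<Sum>k\<in>S. c k * stencil m e (z k))" for c :: "_ \<Rightarrow> real"
proof (induction rule: finite_induct)
  case (insert k S)
  have "stencil m e (\<lambda>j. c k * z k j + (\<Sum>k\<in>S. c k * z k j))
      = c k * stencil m e (z k) + stencil m e (\<lambda>j. \<Sum>k\<in>S. c k * z k j)"
    unfolding stencil_def sum_distrib_left sum.distrib[symmetric]
    by (rule sum.cong) (simp_all add: algebra_simps)
  then show ?case using insert by simp
qed (simp add: stencil_def)

lemma stencil_bound:
  assumes "\<And>j. \<bar>j\<bar> \<le> int m \<Longrightarrow> norm (z j) \<le> c"
  shows "norm (stencil m e z) \<le> (\<Sum>i<m. 4 * \<bar>e i\<bar>) * c"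
proof -
  have "norm (e i *\<^sub>R (z (int i + 1) - z (int i) + z (- int i) - z (- int i - 1))) \<le> 4 * \<bar>e i\<bar> * c"
    if "i < m" for i
  proof -
    have "norm (z (int i + 1) - z (int i) + z (- int i) - z (- int i - 1)) \<le> ((c + c) + c) + c"
      using that by (intro norm_triangle_mono norm_triangle_le_diff add_mono assms) auto
    from mult_left_mono[OF this abs_ge_zero[of "e i"]] show ?thesis
      unfolding norm_scaleR by (simp add: mult_ac)
  qed
  then show ?thesis
    unfolding stencil_def sum_distrib_right by (intro sum_norm_le) auto
qed

lemma stencil_error:
  assumes "stencil_order m e M" "0 \<le> C"
  shows "\<exists>D\<ge>0. \<forall>h g. 0 < h \<and> h \<le> 1 \<and> bounded_derivs (2 * M + 3) C (real m) g \<longrightarrow>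
    \<bar>stencil m e (\<lambda>j. g (real_of_int j * h)) - h * deriv g 0\<bar> \<le> D * h ^ (2 * M + 3)"
proof -
  let ?Q = "2 * M + 3"
  let ?D = "(\<Sum>i<m. 4 * \<bar>e i\<bar>) * (C * real m ^ ?Q)"
  have "\<bar>stencil m e (\<lambda>j. g (real_of_int j * h)) - h * deriv g 0\<bar> \<le> ?D * h ^ ?Q"
    if h: "0 < h" "h \<le> 1" and g: "bounded_derivs ?Q C (real m) g" for h g
  proof -
    define p where "p t = (\<Sum>k<?Q. (deriv ^^ k) g 0 / fact k * t ^ k)" for t
    have "stencil m e (\<lambda>j. p (real_of_int j * h))
        = (\<Sum>k<?Q. (deriv ^^ k) g 0 / fact k * stencil m e (\<lambda>j. (real_of_int j * h) ^ k))"
      unfolding p_def by (rule stencil_scale_sum) simp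
    also have "\<dots> = (\<Sum>k<?Q. if k = 1 then h * deriv g 0 else 0)"
      using stencil_monomial[OF assms(1)] by (intro sum.cong) auto
    also have "\<dots> = h * deriv g 0"
      by (simp add: sum.delta)
    finally have "stencil m e (\<lambda>j. g (real_of_int j * h)) - h * deriv g 0
        = stencil m e (\<lambda>j. g (real_of_int j * h) - p (real_of_int j * h))"
      by (simp add: stencil_diff)
    moreover have "\<bar>g (real_of_int j * h) - p (real_of_int j * h)\<bar> \<le> C * real m ^ ?Q * h ^ ?Q"
      if j: "\<bar>j\<bar> \<le> int m" for j
    proof -
      have "\<bar>real_of_int j\<bar> \<le> real m" using j by linarith
      then have "\<bar>real_of_int j * h\<bar> \<le> real m * h" "real m * h \<le> real m"
        using h by (auto simp: abs_mult mult_right_mono mult_left_le)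
      then have "\<bar>g (real_of_int j * h) - p (real_of_int j * h)\<bar> \<le> C * \<bar>real_of_int j * h\<bar> ^ ?Q"
        unfolding p_def using bounded_derivs_Taylor[OF g] by auto
      also have "\<dots> \<le> C * (real m * h) ^ ?Q"
        using \<open>\<bar>real_of_int j * h\<bar> \<le> real m * h\<close> assms(2) by (intro mult_left_mono power_mono) auto
      finally show ?thesis by (simp add: power_mult_distrib mult.assoc)
    qed
    ultimately show ?thesis
      using stencil_bound[of m "\<lambda>j. g (real_of_int j * h) - p (real_of_int j * h)" "C * real m ^ ?Q * h ^ ?Q" e]
      by (simp add: mult.assoc)
  qed
  moreover have "0 \<le> ?D" using assms(2) by (auto intro!: mult_nonneg_nonneg sum_nonneg)
  ultimately show ?thesis by blast
qed

text \<open>Both stencils approximate derivatives at the centre to high order, and the derivatives obey the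
chain rule.\<close>

lemma stencil_chain_rule:
  fixes U :: "real ^ 'n \<Rightarrow> real"
  assumes "smooth U" "0 \<le> C" "stencil_order m e M"
  shows "\<exists>D\<ge>0. \<forall>h y. 0 < h \<and> h \<le> 1 \<and> (\<forall>i. bounded_derivs (2 * M + 3) C (real m) (\<lambda>t. y t $ i)) \<longrightarrow>
    \<bar>stencil m e (\<lambda>j. U (y (real_of_int j * h))) - grad U (y 0) \<bullet> stencil m e (\<lambda>j. y (real_of_int j * h))\<bar>
      \<le> D * h ^ (2 * M + 3)"
proof -
  let ?Q = "2 * M + 3"
  obtain D0 where D0: "0 \<le> D0" "\<And>y. (\<forall>i. bounded_derivs ?Q C (real m) (\<lambda>t. y t $ i)) \<Longrightarrow>
      bounded_derivs ?Q D0 (real m) (\<lambda>t. U (y t))"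
    using bounded_derivs_compose[OF assms(1,2), of ?Q "real m"] by blast
  have "\<forall>i. \<exists>D\<ge>0. \<forall>y. (\<forall>j. bounded_derivs 0 C (real m) (\<lambda>t. y t $ j)) \<longrightarrow>
      bounded_derivs 0 D (real m) (\<lambda>t. partial_deriv i U (y t))"
    using bounded_derivs_compose[OF smooth_partial_deriv[OF assms(1)] assms(2)] by blast
  then obtain G where G: "\<And>i. 0 \<le> G i" "\<And>i y. (\<forall>j. bounded_derivs 0 C (real m) (\<lambda>t. y t $ j)) \<Longrightarrow>
      bounded_derivs 0 (G i) (real m) (\<lambda>t. partial_deriv i U (y t))" by metis
  obtain S0 where S0: "0 \<le> S0" "\<And>h g. 0 < h \<Longrightarrow> h \<le> 1 \<Longrightarrow> bounded_derivs ?Q D0 (real m) g \<Longrightarrow>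
      \<bar>stencil m e (\<lambda>j. g (real_of_int j * h)) - h * deriv g 0\<bar> \<le> S0 * h ^ ?Q"
    using stencil_error[OF assms(3) D0(1)] by blast
  obtain S1 where S1: "0 \<le> S1" "\<And>h g. 0 < h \<Longrightarrow> h \<le> 1 \<Longrightarrow> bounded_derivs ?Q C (real m) g \<Longrightarrow>
      \<bar>stencil m e (\<lambda>j. g (real_of_int j * h)) - h * deriv g 0\<bar> \<le> S1 * h ^ ?Q"
    using stencil_error[OF assms(3,2)] by blast
  let ?D = "S0 + (\<Sum>i\<in>UNIV. G i * S1)"
  have "\<bar>stencil m e (\<lambda>j. U (y (real_of_int j * h))) - grad U (y 0) \<bullet> stencil m e (\<lambda>j. y (real_of_int j * h))\<bar>
      \<le> ?D * h ^ ?Q"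
    if h: "0 < h" "h \<le> 1" and y: "\<forall>i. bounded_derivs ?Q C (real m) (\<lambda>t. y t $ i)" for h y
  proof -
    define u where "u = (\<chi> i. deriv (\<lambda>t. y t $ i) 0)"
    have "((\<lambda>t. y t $ i) has_real_derivative u $ i) (at 0)" for i
      using bounded_derivs_DERIV[OF y[rule_format, of i], of 0] by (simp add: u_def)
    from DERIV_imp_deriv[OF has_real_derivative_compose_grad[OF smooth_differentiable[OF assms(1)] this]]
    have "deriv (\<lambda>t. U (y t)) 0 = grad U (y 0) \<bullet> u" .
    then have 1: "\<bar>stencil m e (\<lambda>j. U (y (real_of_int j * h))) - h * (grad U (y 0) \<bullet> u)\<bar> \<le> S0 * h ^ ?Q"
      using S0(2)[OF h D0(2)[OF y]] by simp
    have y0: "\<forall>j. bounded_derivs 0 C (real m) (\<lambda>t. y t $ j)"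
      using y bounded_derivs_le by blast
    have "grad U (y 0) \<bullet> stencil m e (\<lambda>j. y (real_of_int j * h)) - h * (grad U (y 0) \<bullet> u)
        = (\<Sum>i\<in>UNIV. partial_deriv i U (y 0) * (stencil m e (\<lambda>j. y (real_of_int j * h) $ i) - h * u $ i))"
      by (simp add: inner_vec_def grad_def stencil_nth right_diff_distrib sum_subtractf sum_distrib_left mult.left_commute)
    also have "\<bar>\<dots>\<bar> \<le> (\<Sum>i\<in>UNIV. G i * (S1 * h ^ ?Q))"
    proof (intro order_trans[OF sum_abs sum_mono])
      fix i
      have "\<bar>partial_deriv i U (y 0)\<bar> \<le> G i"
        using bounded_derivs_bound[OF G(2)[OF y0, of i], of 0] by simp
      moreover have "\<bar>stencil m e (\<lambda>j. y (real_of_int j * h) $ i) - h * u $ i\<bar> \<le> S1 * h ^ ?Q"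
        using S1(2)[OF h y[rule_format, of i]] by (simp add: u_def)
      ultimately show "\<bar>partial_deriv i U (y 0) * (stencil m e (\<lambda>j. y (real_of_int j * h) $ i) - h * u $ i)\<bar>
          \<le> G i * (S1 * h ^ ?Q)"
        unfolding abs_mult using G(1) by (intro mult_mono) auto
    qed
    also have "\<dots> = (\<Sum>i\<in>UNIV. G i * S1) * h ^ ?Q"
      by (simp add: sum_distrib_right mult.assoc)
    finally show ?thesis using 1 by (simp add: distrib_right)
  qed
  moreover have "0 \<le> ?D" using S0 S1 G by (auto intro!: add_nonneg_nonneg sum_nonneg)
  ultimately show ?thesis by blast
qed

section \<open>A telescoping discrete energy\<close>

definition backward_sum :: "nat \<Rightarrow> (int \<Rightarrow> real) \<Rightarrow> int \<Rightarrow> real" where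
  "backward_sum k q n = (\<Sum>l<k. q (n - int l))"

lemma backward_sum_diff: "backward_sum k q n - backward_sum k q (n - 1) = q n - q (n - int k)"
  unfolding backward_sum_def by (induction k) (simp_all add: algebra_simps)

text \<open>A quadratic form in the increments whose backward difference is the product of a symmetric pair
of increments with the second difference. It is a sum of \<open>i + 1\<close> products minus a sum of \<open>i\<close>
products, so that a single squared velocity remains in the limit.\<close>

definition kinetic_ladder :: "nat \<Rightarrow> (int \<Rightarrow> 'a::real_inner) \<Rightarrow> int \<Rightarrow> real" where
  "kinetic_ladder i d n = backward_sum (Suc i) (\<lambda>p. d p \<bullet> d (p + int i)) n
     - backward_sum i (\<lambda>p. d p \<bullet> d (p + int i + 1)) (n - 1)"

text \<open>The analogous form for the skew product \<open>v \<bullet> (w \<times> b)\<close>. In the limit it vanishes, as the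
magnetic force does no work.\<close>

definition magnetic_ladder :: "real ^ 3 \<Rightarrow> nat \<Rightarrow> (int \<Rightarrow> real ^ 3) \<Rightarrow> int \<Rightarrow> real" where
  "magnetic_ladder b i d n = - backward_sum (Suc i) (\<lambda>p. d p \<bullet> (d (p + int i) \<times> b)) n
     - backward_sum i (\<lambda>p. d p \<bullet> (d (p + int i + 1) \<times> b)) (n - 1)"

text \<open>The algebraic core: an antisymmetric difference operator paired with a symmetric one telescopes
exactly. It is the discrete form of the fact that \<open>y' \<bullet> y''\<close> is a total derivative.\<close>

lemma kinetic_ladder_diff:
  "kinetic_ladder i d n - kinetic_ladder i d (n - 1) = (d (n + int i) + d (n - 1 - int i)) \<bullet> (d n - d (n - 1))"
proof -
  have "kinetic_ladder i d n - kinetic_ladder i d (n - 1)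
     = (d n \<bullet> d (n + int i) - d (n - 1 - int i) \<bullet> d (n - 1))
       - (d (n - 1) \<bullet> d (n + int i) - d (n - 1 - int i) \<bullet> d n)"
    using backward_sum_diff[of "Suc i" "\<lambda>p. d p \<bullet> d (p + int i)" n]
      backward_sum_diff[of i "\<lambda>p. d p \<bullet> d (p + int i + 1)" "n - 1"]
    by (simp add: kinetic_ladder_def algebra_simps)
  then show ?thesis
    by (simp add: inner_add inner_diff inner_commute)
qed

text \<open>For a skew form it is the pairing of two antisymmetric operators that telescopes.\<close>

lemma magnetic_ladder_diff:
  "magnetic_ladder b i d n - magnetic_ladder b i d (n - 1)
    = (d (n + int i) + d (n - 1 - int i)) \<bullet> ((d n + d (n - 1)) \<times> b)"
proof -
  have "magnetic_ladder b i d n - magnetic_ladder b i d (n - 1)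
     = - (d n \<bullet> (d (n + int i) \<times> b) - d (n - 1 - int i) \<bullet> (d (n - 1) \<times> b))
       - (d (n - 1) \<bullet> (d (n + int i) \<times> b) - d (n - 1 - int i) \<bullet> (d n \<times> b))"
    using backward_sum_diff[of "Suc i" "\<lambda>p. d p \<bullet> (d (p + int i) \<times> b)" n]
      backward_sum_diff[of i "\<lambda>p. d p \<bullet> (d (p + int i + 1) \<times> b)" "n - 1"]
    by (simp add: magnetic_ladder_def algebra_simps)
  then show ?thesis
    using inner_cross_swap[of "d n" "d (n + int i)" b] inner_cross_swap[of "d (n - 1)" "d (n + int i)" b]
    by (simp add: inner_add cross_add_left)
qed

definition increment :: "(int \<Rightarrow> 'a::ab_group_add) \<Rightarrow> int \<Rightarrow> 'a" where
  "increment X p = X (p + 1) - X p"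

text \<open>The quantity obtained by testing the recurrence with a high-order difference of the positions.
Its kinetic and magnetic parts telescope exactly; the potential part is the telescoped stencil of
\<open>U\<close> along the trajectory.\<close>

definition discrete_energy ::
  "nat \<Rightarrow> (nat \<Rightarrow> real) \<Rightarrow> (real ^ 3 \<Rightarrow> real) \<Rightarrow> real ^ 3 \<Rightarrow> real \<Rightarrow> real \<Rightarrow> (int \<Rightarrow> real ^ 3) \<Rightarrow> int \<Rightarrow> real" where
  "discrete_energy m e U b h \<tau> X n = (\<Sum>i<m. e i *
     (kinetic_ladder i (increment X) n / h\<^sup>2 - \<tau> * (magnetic_ladder b i (increment X) n / h\<^sup>2)
      + U (X (n + int i + 1)) + U (X (n - int i))))"

text \<open>Along the recurrence only the force remains: the change of the discrete energy is the failure of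
the stencil to satisfy the chain rule for \<open>U\<close>, since \<open>F\<close> will be minus the gradient.\<close>

lemma discrete_energy_diff:
  assumes "h \<noteq> 0"
    and "increment X n - increment X (n - 1)
      = \<tau> *\<^sub>R ((increment X n + increment X (n - 1)) \<times> b) + h\<^sup>2 *\<^sub>R F"
  shows "discrete_energy m e U b h \<tau> X n - discrete_energy m e U b h \<tau> X (n - 1)
    = stencil m e (\<lambda>j. X (n + j)) \<bullet> F + stencil m e (\<lambda>j. U (X (n + j)))"
proof -
  let ?d = "increment X"
  have "e i * (kinetic_ladder i ?d n / h\<^sup>2 - \<tau> * (magnetic_ladder b i ?d n / h\<^sup>2)
        + U (X (n + int i + 1)) + U (X (n - int i)))
      - e i * (kinetic_ladder i ?d (n - 1) / h\<^sup>2 - \<tau> * (magnetic_ladder b i ?d (n - 1) / h\<^sup>2)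
        + U (X (n - 1 + int i + 1)) + U (X (n - 1 - int i)))
      = (e i *\<^sub>R (X (n + (int i + 1)) - X (n + int i) + X (n + - int i) - X (n + (- int i - 1)))) \<bullet> F
        + e i *\<^sub>R (U (X (n + (int i + 1))) - U (X (n + int i)) + U (X (n + - int i)) - U (X (n + (- int i - 1))))"
    (is "?l = ?r") for i
  proof -
    let ?s = "?d (n + int i) + ?d (n - 1 - int i)"
    have s: "?s = X (n + (int i + 1)) - X (n + int i) + X (n + - int i) - X (n + (- int i - 1))"
      by (simp add: increment_def algebra_simps)
    have "kinetic_ladder i ?d n / h\<^sup>2 - \<tau> * (magnetic_ladder b i ?d n / h\<^sup>2)
        - (kinetic_ladder i ?d (n - 1) / h\<^sup>2 - \<tau> * (magnetic_ladder b i ?d (n - 1) / h\<^sup>2))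
      = (?s \<bullet> (?d n - ?d (n - 1)) - \<tau> * (?s \<bullet> ((?d n + ?d (n - 1)) \<times> b))) / h\<^sup>2"
      unfolding kinetic_ladder_diff[symmetric] magnetic_ladder_diff[symmetric]
      by (simp add: diff_divide_distrib right_diff_distrib)
    also have "\<dots> = ?s \<bullet> F"
      unfolding assms(2) using assms(1) by (simp add: inner_add_right)
    finally have eq: "?s \<bullet> F = kinetic_ladder i ?d n / h\<^sup>2 - \<tau> * (magnetic_ladder b i ?d n / h\<^sup>2)
        - (kinetic_ladder i ?d (n - 1) / h\<^sup>2 - \<tau> * (magnetic_ladder b i ?d (n - 1) / h\<^sup>2))" ..
    show ?thesis
      unfolding s[symmetric] inner_scaleR_left eq by (simp add: algebra_simps)
  qed
  then show ?thesis
    unfolding discrete_energy_def stencil_def inner_sum_left sum.distrib[symmetric] sum_subtractf[symmetric]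
    by (intro sum.cong) auto
qed

section \<open>Comparison of the discrete energy with the energy\<close>

text \<open>Here \<open>P\<close> and \<open>Q\<close> are velocities of a curve at the times \<open>s * h\<close> and \<open>t * h\<close>, known up to second
order.\<close>

lemma inner_expansion:
  fixes u a P Q :: "'a::real_inner"
  assumes "0 \<le> h" "h \<le> 1" "norm u \<le> D" "norm a \<le> D" "\<bar>s\<bar> \<le> S" "\<bar>t\<bar> \<le> S"
    and "norm (P - u - (s * h) *\<^sub>R a) \<le> D * h\<^sup>2" "norm (Q - u - (t * h) *\<^sub>R a) \<le> D * h\<^sup>2"
  shows "\<bar>P \<bullet> Q - u \<bullet> u - (s + t) * h * (u \<bullet> a)\<bar> \<le> (2 + S)\<^sup>2 * D\<^sup>2 * h\<^sup>2"
proof -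
  define A B \<rho> \<sigma> where "A = u + (s * h) *\<^sub>R a" and "B = u + (t * h) *\<^sub>R a"
    and "\<rho> = P - A" and "\<sigma> = Q - B"
  have nn: "0 \<le> D" "0 \<le> S" using assms(3,5) norm_ge_zero[of u] by linarith+
  have sh: "\<bar>s * h\<bar> \<le> S" "\<bar>t * h\<bar> \<le> S"
    using assms(1,2,5,6) nn mult_mono[of "\<bar>s\<bar>" S h 1] mult_mono[of "\<bar>t\<bar>" S h 1] by (auto simp: abs_mult)
  have A: "norm A \<le> D + S * D" "norm B \<le> D + S * D"
    unfolding A_def B_def using assms(3,4) sh nn
    by (auto intro!: norm_triangle_mono mult_mono)
  have r: "norm \<rho> \<le> D * h\<^sup>2" "norm \<sigma> \<le> D * h\<^sup>2"
    using assms(7,8) by (simp_all add: \<rho>_def \<sigma>_def A_def B_def algebra_simps)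
  have h2: "h\<^sup>2 \<le> 1" using assms(1,2) by (simp add: power_le_one)
  have "P \<bullet> Q - u \<bullet> u - (s + t) * h * (u \<bullet> a) = ((s * t) * h\<^sup>2) * (a \<bullet> a) + \<rho> \<bullet> B + A \<bullet> \<sigma> + \<rho> \<bullet> \<sigma>"
  proof -
    have PQ: "P = A + \<rho>" "Q = B + \<sigma>" by (simp_all add: \<rho>_def \<sigma>_def)
    have "A \<bullet> B = u \<bullet> u + (s + t) * h * (u \<bullet> a) + ((s * t) * h\<^sup>2) * (a \<bullet> a)"
      by (simp add: A_def B_def inner_add inner_commute[of a u] power2_eq_square algebra_simps)
    then show ?thesis
      unfolding PQ by (simp add: inner_add)
  qed
  moreover have "\<bar>((s * t) * h\<^sup>2) * (a \<bullet> a)\<bar> \<le> (S * S) * h\<^sup>2 * (D * D)"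
  proof -
    have "a \<bullet> a \<le> D * D"
      using power_mono[OF assms(4) norm_ge_zero, of 2]
      by (simp only: power2_norm_eq_inner power2_eq_square[of D])
    then show ?thesis
      unfolding abs_mult using assms(5,6) nn by (intro mult_mono) auto
  qed
  moreover have "\<bar>\<rho> \<bullet> B\<bar> \<le> (D * h\<^sup>2) * (D + S * D)"
    using r A nn by (intro order_trans[OF Cauchy_Schwarz_ineq2 mult_mono]) auto
  moreover have "\<bar>A \<bullet> \<sigma>\<bar> \<le> (D + S * D) * (D * h\<^sup>2)"
    using r A nn by (intro order_trans[OF Cauchy_Schwarz_ineq2 mult_mono]) auto
  moreover have "\<bar>\<rho> \<bullet> \<sigma>\<bar> \<le> (D * h\<^sup>2) * D"
    using r nn h2 order_trans[OF r(2), of D]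
    by (intro order_trans[OF Cauchy_Schwarz_ineq2 mult_mono]) (auto simp: mult_left_le)
  ultimately have "\<bar>P \<bullet> Q - u \<bullet> u - (s + t) * h * (u \<bullet> a)\<bar>
      \<le> (S * S) * h\<^sup>2 * (D * D) + (D * h\<^sup>2) * (D + S * D) + (D + S * D) * (D * h\<^sup>2) + (D * h\<^sup>2) * D"
    by linarith
  also have "\<dots> \<le> (2 + S)\<^sup>2 * D\<^sup>2 * h\<^sup>2"
  proof -
    have "0 \<le> S * (D\<^sup>2 * h\<^sup>2)" "0 \<le> D\<^sup>2 * h\<^sup>2" using nn by auto
    then show ?thesis by (simp add: power2_eq_square algebra_simps)
  qed
  finally show ?thesis .
qed

text \<open>The leading term \<open>u \<bullet> (u \<times> b)\<close> vanishes.\<close>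

lemma triple_expansion:
  fixes u a P Q b :: "real ^ 3"
  assumes "0 \<le> h" "h \<le> 1" "norm u \<le> D" "norm a \<le> D" "\<bar>s\<bar> \<le> S" "\<bar>t\<bar> \<le> S"
    and "norm (P - u - (s * h) *\<^sub>R a) \<le> D * h\<^sup>2" "norm (Q - u - (t * h) *\<^sub>R a) \<le> D * h\<^sup>2"
  shows "\<bar>P \<bullet> (Q \<times> b)\<bar> \<le> (3 + S)\<^sup>2 * D\<^sup>2 * norm b * h"
proof -
  have nn: "0 \<le> D" "0 \<le> S" using assms(3,5) norm_ge_zero[of u] by linarith+
  have near: "norm (R - u) \<le> (S + 1) * D * h"
    if "\<bar>r\<bar> \<le> S" "norm (R - u - (r * h) *\<^sub>R a) \<le> D * h\<^sup>2" for r and R :: "real ^ 3"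
  proof -
    have "norm ((r * h) *\<^sub>R a) \<le> S * h * D"
      using that(1) assms(1,4) nn unfolding norm_scaleR abs_mult by (intro mult_mono) auto
    moreover have "D * h\<^sup>2 \<le> D * h"
      using assms(1,2) nn by (intro mult_left_mono) (auto simp: power2_eq_square mult_left_le)
    moreover have "norm (R - u) \<le> norm (R - u - (r * h) *\<^sub>R a) + norm ((r * h) *\<^sub>R a)"
      using norm_triangle_ineq[of "R - u - (r * h) *\<^sub>R a" "(r * h) *\<^sub>R a"] by simp
    ultimately show ?thesis using that(2) by (simp add: algebra_simps)
  qed
  note p = near[OF assms(5,7)] and q = near[OF assms(6,8)]
  have "(S + 1) * D * h \<le> (S + 1) * D"
    using nn assms(1,2) by (intro mult_left_le) auto
  then have Q: "norm Q \<le> (S + 2) * D"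
    using q assms(3) norm_triangle_ineq[of "Q - u" u] by (simp add: algebra_simps)
  have "\<bar>(P - u) \<bullet> (Q \<times> b)\<bar> \<le> ((S + 1) * D * h) * ((S + 2) * D * norm b)"
    using p Q nn assms(1)
    by (intro order_trans[OF Cauchy_Schwarz_ineq2 mult_mono]
        order_trans[OF norm_cross_le mult_right_mono]) auto
  moreover have "\<bar>u \<bullet> ((Q - u) \<times> b)\<bar> \<le> D * ((S + 1) * D * h * norm b)"
    using q nn assms(1,3)
    by (intro order_trans[OF Cauchy_Schwarz_ineq2 mult_mono]
        order_trans[OF norm_cross_le mult_right_mono]) auto
  moreover have "P \<bullet> (Q \<times> b) = (P - u) \<bullet> (Q \<times> b) + u \<bullet> ((Q - u) \<times> b)"
    using cross_cross_inner(1)[of u b] by (simp add: inner_diff cross_diff_left)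
  ultimately have "\<bar>P \<bullet> (Q \<times> b)\<bar> \<le> ((S + 1) * D * h) * ((S + 2) * D * norm b) + D * ((S + 1) * D * h * norm b)"
    by linarith
  also have "\<dots> = (S + 1) * (S + 3) * (D\<^sup>2 * norm b * h)"
    by (simp add: power2_eq_square algebra_simps)
  also have "\<dots> \<le> (3 + S)\<^sup>2 * (D\<^sup>2 * norm b * h)"
    unfolding power2_eq_square[of "3 + S"] using nn assms(1) by (intro mult_right_mono mult_mono) auto
  finally show ?thesis by (simp add: mult.assoc)
qed

text \<open>The midpoints of the increments in the two sums of a kinetic ladder balance to a single time
\<open>h / 2\<close>.\<close>

lemma ladder_weights:
  fixes x y h :: real
  shows "(\<Sum>l<Suc i. x + (real i - 2 * real l + 1) * h * y) - (\<Sum>l<i. x + (real i - 2 * real l) * h * y) = x + h * y"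
proof -
  have "(\<Sum>l<k. x + (c - 2 * real l) * h * y) = real k * x + (real k * c - real k * (real k - 1)) * h * y" for k c
    by (induction k) (simp_all add: algebra_simps)
  from this[where k = "Suc i" and c = "real i + 1"] this[where k = i and c = "real i"] show ?thesis
    by (simp add: algebra_simps)
qed

lemma kinetic_ladder_expansion:
  fixes P :: "int \<Rightarrow> 'a::real_inner"
  assumes h: "0 \<le> h" "h \<le> 1" and u: "norm u \<le> D" "norm a \<le> D"
    and P: "\<And>l. - int m \<le> l \<Longrightarrow> l < int m \<Longrightarrow> norm (P l - u - ((real_of_int l + 1/2) * h) *\<^sub>R a) \<le> D * h\<^sup>2"
    and i: "i < m"
  shows "\<bar>kinetic_ladder i P 0 - (u \<bullet> u + h * (u \<bullet> a))\<bar> \<le> (2 * real m) * ((3 + real m)\<^sup>2 * D\<^sup>2 * h\<^sup>2)"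
proof -
  \<comment> \<open>All offsets \<open>l + 1 / 2\<close> that occur are at most \<open>m + 1\<close> in absolute value.\<close>
  let ?c = "(2 + (real m + 1))\<^sup>2 * D\<^sup>2 * h\<^sup>2"
  have PP: "\<bar>P k \<bullet> P l - u \<bullet> u - (real_of_int k + 1/2 + (real_of_int l + 1/2)) * h * (u \<bullet> a)\<bar> \<le> ?c"
    if "- int m \<le> k" "k < int m" "- int m \<le> l" "l < int m" for k l
    using that by (intro inner_expansion[OF h u] P) linarith+
  have "kinetic_ladder i P 0 = (\<Sum>l<Suc i. P (- int l) \<bullet> P (- int l + int i))
      - (\<Sum>l<i. P (- 1 - int l) \<bullet> P (- 1 - int l + int i + 1))"
    by (simp add: kinetic_ladder_def backward_sum_def)
  then have "kinetic_ladder i P 0 - (u \<bullet> u + h * (u \<bullet> a)) =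
      (\<Sum>l<Suc i. P (- int l) \<bullet> P (- int l + int i) - (u \<bullet> u + (real i - 2 * real l + 1) * h * (u \<bullet> a)))
      - (\<Sum>l<i. P (- 1 - int l) \<bullet> P (- 1 - int l + int i + 1) - (u \<bullet> u + (real i - 2 * real l) * h * (u \<bullet> a)))"
    unfolding sum_subtractf using ladder_weights[of "u \<bullet> u" i h "u \<bullet> a"] by linarith
  moreover have "\<bar>\<Sum>l<Suc i. P (- int l) \<bullet> P (- int l + int i) - (u \<bullet> u + (real i - 2 * real l + 1) * h * (u \<bullet> a))\<bar>
      \<le> real (card {..<Suc i}) * ?c"
  proof (intro order_trans[OF sum_abs sum_bounded_above])
    fix l assume "l \<in> {..<Suc i}"
    then show "\<bar>P (- int l) \<bullet> P (- int l + int i) - (u \<bullet> u + (real i - 2 * real l + 1) * h * (u \<bullet> a))\<bar> \<le> ?c"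
      using PP[of "- int l" "- int l + int i"] i by (simp add: algebra_simps)
  qed
  moreover have "\<bar>\<Sum>l<i. P (- 1 - int l) \<bullet> P (- 1 - int l + int i + 1) - (u \<bullet> u + (real i - 2 * real l) * h * (u \<bullet> a))\<bar>
      \<le> real (card {..<i}) * ?c"
  proof (intro order_trans[OF sum_abs sum_bounded_above])
    fix l assume "l \<in> {..<i}"
    then show "\<bar>P (- 1 - int l) \<bullet> P (- 1 - int l + int i + 1) - (u \<bullet> u + (real i - 2 * real l) * h * (u \<bullet> a))\<bar> \<le> ?c"
      using PP[of "- 1 - int l" "- 1 - int l + int i + 1"] i by (simp add: algebra_simps)
  qed
  ultimately have "\<bar>kinetic_ladder i P 0 - (u \<bullet> u + h * (u \<bullet> a))\<bar> \<le> real (Suc i) * ?c + real i * ?c"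
    by simp
  also have "\<dots> = real (Suc i + i) * ?c" by (simp add: algebra_simps)
  also have "\<dots> \<le> (2 * real m) * ?c"
    using i by (intro mult_right_mono) auto
  finally show ?thesis by (simp add: add.commute)
qed

lemma magnetic_ladder_bound:
  assumes h: "0 \<le> h" "h \<le> 1" and u: "norm u \<le> D" "norm a \<le> D"
    and P: "\<And>l. - int m \<le> l \<Longrightarrow> l < int m \<Longrightarrow> norm (P l - u - ((real_of_int l + 1/2) * h) *\<^sub>R a) \<le> D * h\<^sup>2"
    and i: "i < m"
  shows "\<bar>magnetic_ladder b i P 0\<bar> \<le> (2 * real m) * ((4 + real m)\<^sup>2 * D\<^sup>2 * norm b * h)"
proof -
  let ?c = "(3 + (real m + 1))\<^sup>2 * D\<^sup>2 * norm b * h"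
  have PP: "\<bar>P k \<bullet> (P l \<times> b)\<bar> \<le> ?c"
    if "- int m \<le> k" "k < int m" "- int m \<le> l" "l < int m" for k l
    using that by (intro triple_expansion[OF h u _ _ P P]) linarith+
  have "magnetic_ladder b i P 0 = - (\<Sum>l<Suc i. P (- int l) \<bullet> (P (- int l + int i) \<times> b))
      - (\<Sum>l<i. P (- 1 - int l) \<bullet> (P (- 1 - int l + int i + 1) \<times> b))"
    by (simp add: magnetic_ladder_def backward_sum_def)
  moreover have "\<bar>\<Sum>l<Suc i. P (- int l) \<bullet> (P (- int l + int i) \<times> b)\<bar> \<le> real (card {..<Suc i}) * ?c"
    using i by (intro order_trans[OF sum_abs sum_bounded_above] PP) auto
  moreover have "\<bar>\<Sum>l<i. P (- 1 - int l) \<bullet> (P (- 1 - int l + int i + 1) \<times> b)\<bar> \<le> real (card {..<i}) * ?c"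
    using i by (intro order_trans[OF sum_abs sum_bounded_above] PP) auto
  ultimately have "\<bar>magnetic_ladder b i P 0\<bar> \<le> real (Suc i) * ?c + real i * ?c"
    by simp
  also have "\<dots> = real (Suc i + i) * ?c" by (simp add: algebra_simps)
  also have "\<dots> \<le> (2 * real m) * ?c"
    using i h by (intro mult_right_mono) auto
  finally show ?thesis by (simp add: add.commute)
qed

lemma kinetic_ladder_rescale:
  "kinetic_ladder i d n / h\<^sup>2 = kinetic_ladder i (\<lambda>l. (1 / h) *\<^sub>R d (n + l)) 0"
proof -
  have "d p \<bullet> d q / h\<^sup>2 = ((1 / h) *\<^sub>R d p) \<bullet> ((1 / h) *\<^sub>R d q)" for p q
    by (simp add: power2_eq_square)
  then show ?thesis
    unfolding kinetic_ladder_def backward_sum_def diff_divide_distrib sum_divide_distrib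
    by (intro arg_cong2[where f = "(-)"] sum.cong) (simp_all only: diff_0 add.assoc diff_conv_add_uminus add_0 minus_add_distrib)
qed

lemma magnetic_ladder_rescale:
  "magnetic_ladder b i d n / h\<^sup>2 = magnetic_ladder b i (\<lambda>l. (1 / h) *\<^sub>R d (n + l)) 0"
proof -
  have "d p \<bullet> (d q \<times> b) / h\<^sup>2 = ((1 / h) *\<^sub>R d p) \<bullet> (((1 / h) *\<^sub>R d q) \<times> b)" for p q
    by (simp add: power2_eq_square cross_mult_left)
  then show ?thesis
    unfolding magnetic_ladder_def backward_sum_def diff_divide_distrib sum_divide_distrib minus_divide_left[symmetric]
    by (intro arg_cong2[where f = "(-)"] arg_cong[where f = uminus] sum.cong)
       (simp_all only: diff_0 add.assoc diff_conv_add_uminus add_0 minus_add_distrib)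
qed

lemma norm_square_diff_le:
  fixes u v :: "'a::real_inner"
  assumes "norm u \<le> D" "norm v \<le> D" "norm (u - v) \<le> c"
  shows "\<bar>u \<bullet> u - v \<bullet> v\<bar> \<le> 2 * D * c"
proof -
  have "u \<bullet> u - v \<bullet> v = (u - v) \<bullet> (u + v)"
    by (simp add: inner_diff inner_add inner_commute)
  also have "\<bar>\<dots>\<bar> \<le> c * (D + D)"
    using assms norm_triangle_mono[OF assms(1,2)]
    by (intro order_trans[OF Cauchy_Schwarz_ineq2 mult_mono]) (auto intro: order_trans[OF norm_ge_zero])
  finally show ?thesis by (simp add: algebra_simps)
qed

text \<open>The discrete energy is centred half a step after \<open>n\<close>, so its expansion about \<open>n\<close> has a term of
order \<open>h\<close>. That term is the rate of change of the energy along the motion and is therefore small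
by the recurrence, leaving agreement to second order.\<close>

lemma discrete_energy_expansion:
  fixes U :: "real ^ 3 \<Rightarrow> real" and b :: "real ^ 3"
  assumes "stencil_order m e M" "0 \<le> D"
  shows "\<exists>D'\<ge>0. \<forall>h \<tau> \<beta> X n u a g v.
    0 < h \<and> h \<le> 1 \<and> \<bar>\<tau>\<bar> \<le> h \<and> \<bar>\<beta>\<bar> \<le> h\<^sup>2 \<and> norm u \<le> D \<and> norm a \<le> D \<and> norm v \<le> D \<and>
    (\<forall>l. \<bar>l\<bar> \<le> int m \<longrightarrow>
      norm (X (n + l) - X n - (real_of_int l * h) *\<^sub>R u - ((real_of_int l * h)\<^sup>2 / 2) *\<^sub>R a) \<le> D * h ^ 3 \<and>
      \<bar>U (X (n + l)) - U (X n) - (real_of_int l * h) * (g \<bullet> u)\<bar> \<le> D * h\<^sup>2) \<and>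
    increment X n - increment X (n - 1) = \<tau> *\<^sub>R ((increment X n + increment X (n - 1)) \<times> b) - h\<^sup>2 *\<^sub>R g \<and>
    increment X n + increment X (n - 1) = (2 * h) *\<^sub>R (v + \<beta> *\<^sub>R ((v \<times> b) \<times> b))
    \<longrightarrow> \<bar>discrete_energy m e U b h \<tau> X n - energy U (X n) v\<bar> \<le> D' * h\<^sup>2"
proof -
  have m: "0 < m" and e: "(\<Sum>i<m. e i) = 1 / 2"
    using stencil_order_weight[OF assms(1)] by auto
  define D1 where "D1 = 2 * D"
  define ck cm where "ck = (2 * real m) * ((3 + real m)\<^sup>2 * D1\<^sup>2)" 
    and "cm = (2 * real m) * ((4 + real m)\<^sup>2 * D1\<^sup>2 * norm b)"
  define c1 where "c1 = ck + cm + 2 * D"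
  define cv where "cv = D1 + D * (norm b)\<^sup>2"
  define c2 where "c2 = D1 * (2 * D1) + D1 * (4 * D1 * norm b)"
  define D' where "D' = (\<Sum>i<m. \<bar>e i\<bar>) * c1 + D1 * cv + c2"
  have nn: "0 \<le> D1" "0 \<le> ck" "0 \<le> cm" "0 \<le> c1" "0 \<le> cv" "0 \<le> c2"
    using assms(2) by (simp_all add: D1_def ck_def cm_def c1_def cv_def c2_def)
  have "\<bar>discrete_energy m e U b h \<tau> X n - energy U (X n) v\<bar> \<le> D' * h\<^sup>2"
    if h: "0 < h" "h \<le> 1" and \<tau>: "\<bar>\<tau>\<bar> \<le> h" and \<beta>: "\<bar>\<beta>\<bar> \<le> h\<^sup>2"
      and u: "norm u \<le> D" "norm a \<le> D" and v: "norm v \<le> D"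
      and X: "\<And>l. \<bar>l\<bar> \<le> int m \<Longrightarrow>
        norm (X (n + l) - X n - (real_of_int l * h) *\<^sub>R u - ((real_of_int l * h)\<^sup>2 / 2) *\<^sub>R a) \<le> D * h ^ 3"
      and UX: "\<And>l. \<bar>l\<bar> \<le> int m \<Longrightarrow> \<bar>U (X (n + l)) - U (X n) - (real_of_int l * h) * (g \<bullet> u)\<bar> \<le> D * h\<^sup>2"
      and rec: "increment X n - increment X (n - 1) = \<tau> *\<^sub>R ((increment X n + increment X (n - 1)) \<times> b) - h\<^sup>2 *\<^sub>R g"
      and vel: "increment X n + increment X (n - 1) = (2 * h) *\<^sub>R (v + \<beta> *\<^sub>R ((v \<times> b) \<times> b))"
    for h \<tau> \<beta> X n u a g v
  proof -
    define P where "P l = (1 / h) *\<^sub>R increment X (n + l)" for l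
    have u1: "norm u \<le> D1" "norm a \<le> D1" "norm v \<le> D1" using u v assms(2) by (simp_all add: D1_def)
    have P: "norm (P l - u - ((real_of_int l + 1/2) * h) *\<^sub>R a) \<le> D1 * h\<^sup>2" if l: "- int m \<le> l" "l < int m" for l
    proof -
      let ?r = "\<lambda>l. X (n + l) - X n - (real_of_int l * h) *\<^sub>R u - ((real_of_int l * h)\<^sup>2 / 2) *\<^sub>R a"
      have "P l - u - ((real_of_int l + 1/2) * h) *\<^sub>R a = (1 / h) *\<^sub>R (?r (l + 1) - ?r l)"
        using h by (simp add: P_def increment_def vec_eq_iff power2_eq_square field_simps)
      also have "norm \<dots> \<le> (1 / h) * (D * h ^ 3 + D * h ^ 3)"
        unfolding norm_scaleR using h l by (intro mult_mono norm_triangle_le_diff add_mono X) auto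
      also have "\<dots> = D1 * h\<^sup>2"
        using h by (simp add: D1_def power2_eq_square power3_eq_cube)
      finally show ?thesis .
    qed
    have K: "\<bar>kinetic_ladder i (increment X) n / h\<^sup>2 - (u \<bullet> u + h * (u \<bullet> a))\<bar> \<le> ck * h\<^sup>2" if "i < m" for i
      using kinetic_ladder_expansion[of h u D1 a m P i] h u1 P that
      unfolding kinetic_ladder_rescale P_def[symmetric] by (simp add: ck_def mult.assoc)
    have Mg: "\<bar>\<tau> * (magnetic_ladder b i (increment X) n / h\<^sup>2)\<bar> \<le> cm * h\<^sup>2" if "i < m" for i
    proof -
      have "\<bar>magnetic_ladder b i P 0\<bar> \<le> cm * h"
        using magnetic_ladder_bound[of h u D1 a m P i b] h u1 P that by (simp add: cm_def mult.assoc)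
      then have "\<bar>\<tau>\<bar> * \<bar>magnetic_ladder b i P 0\<bar> \<le> h * (cm * h)"
        using \<tau> h by (intro mult_mono) auto
      then show ?thesis
        unfolding magnetic_ladder_rescale P_def[symmetric] by (simp add: abs_mult power2_eq_square mult_ac)
    qed
    let ?E = "\<lambda>i. kinetic_ladder i (increment X) n / h\<^sup>2 - \<tau> * (magnetic_ladder b i (increment X) n / h\<^sup>2)
        + U (X (n + int i + 1)) + U (X (n - int i))"
    \<comment> \<open>Twice the expected value of each weighted summand; the weights sum to one half.\<close>
    define G0 where "G0 = u \<bullet> u + h * (u \<bullet> a) + 2 * U (X n) + h * (g \<bullet> u)"
    have E: "\<bar>?E i - G0\<bar> \<le> c1 * h\<^sup>2" if i: "i < m" for i
    proof -
      have "\<bar>U (X (n + int i + 1)) - U (X n) - (real i + 1) * h * (g \<bullet> u)\<bar> \<le> D * h\<^sup>2"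
        using UX[of "int i + 1"] i by (simp add: ac_simps)
      moreover have "\<bar>U (X (n - int i)) - U (X n) + real i * h * (g \<bullet> u)\<bar> \<le> D * h\<^sup>2"
        using UX[of "- int i"] i by simp
      moreover have "(real i + 1) * h * (g \<bullet> u) - real i * h * (g \<bullet> u) = h * (g \<bullet> u)"
        by (simp add: algebra_simps)
      ultimately show ?thesis
        using K[OF i] Mg[OF i] unfolding c1_def G0_def distrib_right by linarith
    qed
    have "discrete_energy m e U b h \<tau> X n - G0 / 2 = (\<Sum>i<m. e i * (?E i - G0))"
      by (simp add: discrete_energy_def right_diff_distrib sum_subtractf e flip: sum_distrib_right)
    also have "\<bar>\<dots>\<bar> \<le> (\<Sum>i<m. \<bar>e i\<bar> * (c1 * h\<^sup>2))"
      using E by (intro order_trans[OF sum_abs sum_mono]) (auto simp: abs_mult intro!: mult_left_mono)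
    finally have 1: "\<bar>discrete_energy m e U b h \<tau> X n - G0 / 2\<bar> \<le> (\<Sum>i<m. \<bar>e i\<bar>) * c1 * h\<^sup>2"
      by (simp add: sum_distrib_right mult.assoc)
    \<comment> \<open>The mean of the two increments next to \<open>n\<close> equals both \<open>u\<close> and \<open>v\<close> up to \<open>h\<^sup>2\<close>, so
      the kinetic energies of \<open>u\<close> and \<open>v\<close> agree to that order.\<close>
    have P0: "norm (P 0 - u - (1/2 * h) *\<^sub>R a) \<le> D1 * h\<^sup>2" "norm (P (- 1) - u - (- 1/2 * h) *\<^sub>R a) \<le> D1 * h\<^sup>2"
      using P[of 0] P[of "- 1"] m by simp_all
    have sumP: "P 0 + P (- 1) = 2 *\<^sub>R (v + \<beta> *\<^sub>R ((v \<times> b) \<times> b))"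
      using h arg_cong[OF vel, of "\<lambda>w. (1 / h) *\<^sub>R w"] by (simp add: P_def scaleR_right_distrib)
    have "2 *\<^sub>R (u - v) = 2 *\<^sub>R (\<beta> *\<^sub>R ((v \<times> b) \<times> b))
        - ((P 0 - u - (1/2 * h) *\<^sub>R a) + (P (- 1) - u - (- 1/2 * h) *\<^sub>R a))"
    proof -
      have "(P 0 - u - (1/2 * h) *\<^sub>R a) + (P (- 1) - u - (- 1/2 * h) *\<^sub>R a) = P 0 + P (- 1) - 2 *\<^sub>R u"
        by (simp add: vec_eq_iff)
      then show ?thesis unfolding sumP by (simp add: vec_eq_iff algebra_simps)
    qed
    also have "norm \<dots> \<le> 2 * (h\<^sup>2 * (D * (norm b)\<^sup>2)) + (D1 * h\<^sup>2 + D1 * h\<^sup>2)"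
    proof (intro norm_triangle_le_diff add_mono)
      have "norm ((v \<times> b) \<times> b) \<le> norm v * norm b * norm b"
        by (meson norm_cross_le order_trans mult_right_mono norm_ge_zero)
      also have "\<dots> \<le> D * (norm b)\<^sup>2"
        unfolding power2_eq_square mult.assoc using v by (intro mult_right_mono) auto
      finally show "norm (2 *\<^sub>R (\<beta> *\<^sub>R ((v \<times> b) \<times> b))) \<le> 2 * (h\<^sup>2 * (D * (norm b)\<^sup>2))"
        using \<beta> unfolding norm_scaleR by (intro mult_mono) auto
      show "norm ((P 0 - u - (1/2 * h) *\<^sub>R a) + (P (- 1) - u - (- 1/2 * h) *\<^sub>R a)) \<le> D1 * h\<^sup>2 + D1 * h\<^sup>2"
        using P0 by (rule norm_triangle_mono)
    qed
    finally have "norm (u - v) \<le> cv * h\<^sup>2"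
      unfolding norm_scaleR by (simp add: cv_def algebra_simps)
    then have 2: "\<bar>u \<bullet> u - v \<bullet> v\<bar> \<le> 2 * D1 * (cv * h\<^sup>2)"
      by (rule norm_square_diff_le[OF u1(1,3)])
    \<comment> \<open>The term of order \<open>h\<close> in the expansion is the power \<open>u \<bullet> a + g \<bullet> u\<close>. By the recurrence
      \<open>a + g\<close> is, up to \<open>O(h)\<close>, a magnetic force, which does no work on \<open>u\<close>.\<close>
    have diffP: "P 0 - P (- 1) = \<tau> *\<^sub>R ((P 0 + P (- 1)) \<times> b) - h *\<^sub>R g"
      using h arg_cong[OF rec, of "\<lambda>w. (1 / h) *\<^sub>R w"]
      by (simp add: P_def scaleR_right_distrib scaleR_right_diff_distrib cross_mult_left cross_add_left power2_eq_square)
    have 3: "\<bar>h * (u \<bullet> a + g \<bullet> u)\<bar> \<le> c2 * h\<^sup>2" 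
    proof -
      let ?\<rho> = "(P 0 - u - (1/2 * h) *\<^sub>R a) - (P (- 1) - u - (- 1/2 * h) *\<^sub>R a)"
      let ?\<sigma> = "P 0 + P (- 1) - 2 *\<^sub>R u"
      have "?\<rho> = P 0 - P (- 1) - h *\<^sub>R a"
        by (simp add: vec_eq_iff)
      then have "h *\<^sub>R a + h *\<^sub>R g = \<tau> *\<^sub>R ((P 0 + P (- 1)) \<times> b) - ?\<rho>"
        unfolding diffP by (simp add: algebra_simps)
      also have "(P 0 + P (- 1)) \<times> b = ?\<sigma> \<times> b + 2 *\<^sub>R (u \<times> b)"
        by (simp add: cross_diff_left cross_mult_left)
      finally have "u \<bullet> (h *\<^sub>R a + h *\<^sub>R g) = \<tau> * (u \<bullet> (?\<sigma> \<times> b)) - u \<bullet> ?\<rho>"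
        using cross_cross_inner(1)[of u b] by (simp add: inner_diff_right inner_add_right)
      then have eq: "h * (u \<bullet> a + g \<bullet> u) = \<tau> * (u \<bullet> (?\<sigma> \<times> b)) - u \<bullet> ?\<rho>"
        by (simp add: inner_add_right inner_commute[of g] distrib_left)
      have "norm ?\<rho> \<le> D1 * h\<^sup>2 + D1 * h\<^sup>2"
        by (rule norm_triangle_le_diff[OF add_mono[OF P0]])
      then have "\<bar>u \<bullet> ?\<rho>\<bar> \<le> D1 * (D1 * h\<^sup>2 + D1 * h\<^sup>2)"
        using u1 nn by (intro order_trans[OF Cauchy_Schwarz_ineq2 mult_mono]) auto
      moreover have "?\<sigma> = (P 0 - u - (1/2 * h) *\<^sub>R a) + (P (- 1) - u - (- 1/2 * h) *\<^sub>R a)"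
        by (simp add: vec_eq_iff)
      then have "norm ?\<sigma> \<le> D1 * h\<^sup>2 + D1 * h\<^sup>2"
        using norm_triangle_mono[OF P0] by simp
      then have "norm (?\<sigma> \<times> b) \<le> (D1 * h\<^sup>2 + D1 * h\<^sup>2) * norm b"
        by (intro order_trans[OF norm_cross_le mult_right_mono]) auto
      then have "\<bar>u \<bullet> (?\<sigma> \<times> b)\<bar> \<le> D1 * ((D1 * h\<^sup>2 + D1 * h\<^sup>2) * norm b)"
        using u1 nn by (intro order_trans[OF Cauchy_Schwarz_ineq2 mult_mono]) auto
      then have "\<bar>\<tau> * (u \<bullet> (?\<sigma> \<times> b))\<bar> \<le> 1 * (D1 * ((D1 * h\<^sup>2 + D1 * h\<^sup>2) * norm b))"
        unfolding abs_mult using \<tau> h nn by (intro mult_mono) auto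
      ultimately have "\<bar>h * (u \<bullet> a + g \<bullet> u)\<bar> \<le> 1 * (D1 * ((D1 * h\<^sup>2 + D1 * h\<^sup>2) * norm b)) + D1 * (D1 * h\<^sup>2 + D1 * h\<^sup>2)"
        unfolding eq by linarith
      also have "\<dots> \<le> c2 * h\<^sup>2"
        using nn by (simp add: c2_def algebra_simps)
      finally show ?thesis .
    qed
    have "energy U (X n) v = v \<bullet> v / 2 + U (X n)" by (simp add: energy_def power2_norm_eq_inner)
    then have "G0 / 2 - energy U (X n) v = (u \<bullet> u - v \<bullet> v) / 2 + h * (u \<bullet> a + g \<bullet> u) / 2"
      by (simp add: G0_def field_simps)
    moreover have "\<bar>(u \<bullet> u - v \<bullet> v) / 2\<bar> \<le> D1 * cv * h\<^sup>2" using 2 by (simp add: mult.assoc)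
    moreover have "\<bar>h * (u \<bullet> a + g \<bullet> u) / 2\<bar> \<le> c2 * h\<^sup>2"
      using 3 mult_nonneg_nonneg[OF nn(6) zero_le_power2[of h]] by linarith
    ultimately have "\<bar>discrete_energy m e U b h \<tau> X n - energy U (X n) v\<bar>
        \<le> (\<Sum>i<m. \<bar>e i\<bar>) * c1 * h\<^sup>2 + (D1 * cv * h\<^sup>2 + c2 * h\<^sup>2)"
      using 1 by linarith
    then show ?thesis by (simp add: D'_def distrib_right add.assoc)
  qed
  moreover have "0 \<le> D'" using nn by (auto simp: D'_def intro!: add_nonneg_nonneg mult_nonneg_nonneg sum_nonneg)
  ultimately show ?thesis by (intro exI[of _ D']) blast
qed

section \<open>Long-time behaviour of the energy\<close>

lemma telescoped_bound:
  fixes f :: "nat \<Rightarrow> real"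
  assumes "\<And>n. p \<le> n \<Longrightarrow> n < q \<Longrightarrow> \<bar>f (Suc n) - f n\<bar> \<le> c" "p \<le> q"
  shows "\<bar>f q - f p\<bar> \<le> real (q - p) * c"
  using assms(2,1)
proof (induction rule: dec_induct)
  case (step n)
  then have "\<bar>f n - f p\<bar> \<le> real (n - p) * c" "\<bar>f (Suc n) - f n\<bar> \<le> c" by auto
  then show ?case using step(1) by (simp add: Suc_diff_le algebra_simps)
qed simp

text \<open>A crude bound that holds for every field and is used only for a fixed number of steps.\<close>

lemma EXS_O2_local_energy_error:
  assumes "smooth U" "0 \<le> C"
  shows "\<exists>D\<ge>0. \<forall>B x0 v0 h x v n. 0 < h \<and> h \<le> 1 \<and> EXS_O2 U B x0 v0 h x v \<and>
    norm (x n) \<le> C \<and> norm (v n) \<le> C \<and> norm (x (Suc n)) \<le> C \<longrightarrow>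
    \<bar>energy U (x (Suc n)) (v (Suc n)) - energy U (x n) (v n)\<bar> \<le> D * h\<^sup>2"
proof -
  obtain G where G: "0 \<le> G" "\<And>x. norm x \<le> C \<Longrightarrow> norm (grad U x) \<le> G"
    using smooth_grad_bounded[OF assms(1)] by blast
  obtain T where T: "0 \<le> T" "\<And>x x'. norm x \<le> C \<Longrightarrow> norm x' \<le> C \<Longrightarrow>
      \<bar>U x' - U x - grad U x \<bullet> (x' - x)\<bar> \<le> T * (norm (x' - x))\<^sup>2"
    using second_order_Taylor[OF assms] by blast
  let ?D = "T * (C + G)\<^sup>2 + G\<^sup>2"
  have "\<bar>energy U (x (Suc n)) (v (Suc n)) - energy U (x n) (v n)\<bar> \<le> ?D * h\<^sup>2"
    if h: "0 < h" "h \<le> 1" and exs: "EXS_O2 U B x0 v0 h x v"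
      and b: "norm (x n) \<le> C" "norm (v n) \<le> C" "norm (x (Suc n)) \<le> C" for B x0 v0 h x v n
  proof -
    define E E' where E: "E = grad U (x n)" "E' = grad U (x (Suc n))"
    define w where "w = gyration (h/2) (B (x n)) (v n)"
    have x: "x (Suc n) - x n = h *\<^sub>R w - (h\<^sup>2 / 2) *\<^sub>R E"
      using EXS_O2_step(1)[OF exs, of n] by (simp add: w_def E electric_field_def)
    have w: "norm w \<le> C" using b by (simp add: w_def)
    have GE: "norm E \<le> G" "norm E' \<le> G" using G b by (auto simp: E)
    have "norm (h *\<^sub>R w - (h\<^sup>2 / 2) *\<^sub>R E) \<le> h * C + h * G"
    proof (intro norm_triangle_le_diff add_mono)
      show "norm (h *\<^sub>R w) \<le> h * C" using w h by simp
      have "h\<^sup>2 / 2 \<le> h" using h by (simp add: power2_eq_square)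
      then show "norm ((h\<^sup>2 / 2) *\<^sub>R E) \<le> h * G"
        using GE h unfolding norm_scaleR by (intro mult_mono) auto
    qed
    then have "(norm (x (Suc n) - x n))\<^sup>2 \<le> (h * (C + G))\<^sup>2"
      unfolding x by (intro power_mono) (simp_all add: algebra_simps)
    then have dx: "T * (norm (x (Suc n) - x n))\<^sup>2 \<le> T * ((C + G)\<^sup>2 * h\<^sup>2)"
      using T(1) by (simp add: power_mult_distrib mult.commute mult_left_mono)
    \<comment> \<open>Averaging the expansions at both endpoints produces the same force \<open>(E + E') / 2\<close> that
      acts on the velocity.\<close>
    have "\<bar>U (x (Suc n)) - U (x n) - E \<bullet> (x (Suc n) - x n)\<bar> \<le> T * ((C + G)\<^sup>2 * h\<^sup>2)"
      using T(2)[OF b(1,3)] dx by (simp add: E)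
    moreover have "\<bar>U (x n) - U (x (Suc n)) + E' \<bullet> (x (Suc n) - x n)\<bar> \<le> T * ((C + G)\<^sup>2 * h\<^sup>2)"
      using T(2)[OF b(3,1)] dx by (simp add: E norm_minus_commute inner_diff_right algebra_simps)
    moreover have "\<bar>q - p - (r + s) / 2\<bar> \<le> c" if "\<bar>q - p - r\<bar> \<le> c" "\<bar>p - q + s\<bar> \<le> c"
      for p q r s c :: real
      using that unfolding add_divide_distrib by linarith
    ultimately have 1: "\<bar>U (x (Suc n)) - U (x n) - (E + E') \<bullet> (x (Suc n) - x n) / 2\<bar> \<le> T * ((C + G)\<^sup>2 * h\<^sup>2)"
      unfolding inner_add_left by blast
    have "norm (v (Suc n)) = norm (w + (- (h/2)) *\<^sub>R (E + E'))"
      using EXS_O2_step(2)[OF exs, of n]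
      by (simp add: w_def E electric_field_def algebra_simps)
    then have 2: "(norm (v (Suc n)))\<^sup>2 = w \<bullet> w - h * (w \<bullet> (E + E')) + h\<^sup>2 / 4 * ((E + E') \<bullet> (E + E'))"
      by (simp only: norm_add_scaleR_squared) (simp add: power2_eq_square)
    have 3: "(E + E') \<bullet> (x (Suc n) - x n) = h * (w \<bullet> (E + E')) - h\<^sup>2 / 2 * (E \<bullet> (E + E'))"
      unfolding x by (simp add: inner_diff_right inner_commute)
    have 4: "(norm (v n))\<^sup>2 = w \<bullet> w" by (simp add: w_def flip: power2_norm_eq_inner)
    have "(E + E') \<bullet> (E + E') / 8 - E \<bullet> (E + E') / 4 = (E' \<bullet> E' - E \<bullet> E) / 8"
      by (simp add: inner_add inner_commute[of E' E] field_simps)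
    moreover have "0 \<le> E \<bullet> E" "E \<bullet> E \<le> G\<^sup>2" "0 \<le> E' \<bullet> E'" "E' \<bullet> E' \<le> G\<^sup>2"
      using GE by (simp_all add: power_mono flip: power2_norm_eq_inner)
    ultimately have "\<bar>(E + E') \<bullet> (E + E') / 8 - E \<bullet> (E + E') / 4\<bar> \<le> G\<^sup>2"
      unfolding diff_divide_distrib by linarith
    then have 5: "\<bar>h\<^sup>2 * ((E + E') \<bullet> (E + E') / 8 - E \<bullet> (E + E') / 4)\<bar> \<le> h\<^sup>2 * G\<^sup>2"
      unfolding abs_mult by (simp add: mult_left_mono)
    have "energy U (x (Suc n)) (v (Suc n)) - energy U (x n) (v n)
       = (U (x (Suc n)) - U (x n) - (E + E') \<bullet> (x (Suc n) - x n) / 2)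
         + h\<^sup>2 * ((E + E') \<bullet> (E + E') / 8 - E \<bullet> (E + E') / 4)"
      unfolding energy_def 2 3 4 by (simp add: field_simps)
    then show ?thesis using 1 5 by (simp add: algebra_simps)
  qed
  moreover have "0 \<le> ?D" using T(1) by simp
  ultimately show ?thesis by blast
qed

text \<open>For a constant field the discrete energy is within \<open>O(h\<^sup>2)\<close> of the energy and almost invariant,
its change per step being of an order that grows with the stencil.\<close>

lemma EXS_O2_energy_near_discrete_energy:
  fixes b :: "real ^ 3"
  assumes "smooth U" "0 \<le> C" "stencil_order m e M"
  defines "\<tau> \<equiv> \<lambda>h. sin (h / 2 * norm b) / norm b / cos (h / 2 * norm b)"
  shows "\<exists>D\<ge>0. \<forall>B x0 v0 h x v L. EXS_O2 U B x0 v0 h x v \<and> (\<forall>y. B y = b) \<and>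
      0 < h \<and> h \<le> 1 \<and> h * norm b \<le> 1 \<and> (\<forall>n\<le>L. norm (x n) \<le> C \<and> norm (v n) \<le> C) \<longrightarrow>
    (\<forall>n. m \<le> n \<and> n + m \<le> L \<longrightarrow>
      \<bar>discrete_energy m e U b h (\<tau> h) (\<lambda>p. x (nat p)) (int n) - energy U (x n) (v n)\<bar> \<le> D * h\<^sup>2 \<and>
      \<bar>discrete_energy m e U b h (\<tau> h) (\<lambda>p. x (nat p)) (int n)
        - discrete_energy m e U b h (\<tau> h) (\<lambda>p. x (nat p)) (int n - 1)\<bar> \<le> D * h ^ (2 * M + 3))"
proof -
  obtain G where G: "0 \<le> G" "\<And>x. norm x \<le> C \<Longrightarrow> norm (grad U x) \<le> G"
    using smooth_grad_bounded[OF assms(1)] by blast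
  have m: "0 < m" using stencil_order_weight[OF assms(3)] by blast
  let ?Q = "2 * M + 3"
  obtain D1 where D1: "0 \<le> D1" "\<And>h \<tau> L x n. boris_orbit (electric_field U) b (C + G) h \<tau> L x \<Longrightarrow> m \<le> n \<Longrightarrow> n + m \<le> L \<Longrightarrow>
    (\<exists>y. (\<forall>i. bounded_derivs ?Q D1 (real m) (\<lambda>t. y t $ i))
       \<and> (\<forall>l. \<bar>l\<bar> \<le> int m \<longrightarrow> y (real_of_int l * h) = x (nat (int n + l))))"
    using boris_orbit_window[OF smooth_electric_field[OF assms(1)], where C = "C + G" and b = b and m = m and Q = ?Q]
      assms(2) G(1) by auto
  obtain D2 where D2: "0 \<le> D2" "\<And>y. (\<forall>i. bounded_derivs 3 D1 (real m) (\<lambda>t. y t $ i)) \<Longrightarrow>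
    (\<exists>u a. norm u \<le> D2 \<and> norm a \<le> D2 \<and> (\<forall>t. \<bar>t\<bar> \<le> real m \<longrightarrow>
      norm (y t - y 0 - t *\<^sub>R u - (t\<^sup>2 / 2) *\<^sub>R a) \<le> D2 * \<bar>t\<bar> ^ 3 \<and>
      \<bar>U (y t) - U (y 0) - t * (grad U (y 0) \<bullet> u)\<bar> \<le> D2 * t\<^sup>2))"
    using curve_Taylor[OF assms(1) D1(1), of "real m"] by auto
  obtain D3 where D3: "0 \<le> D3" "\<And>h y. 0 < h \<Longrightarrow> h \<le> 1 \<Longrightarrow> (\<forall>i. bounded_derivs ?Q D1 (real m) (\<lambda>t. y t $ i)) \<Longrightarrow>
    \<bar>stencil m e (\<lambda>j. U (y (real_of_int j * h))) - grad U (y 0) \<bullet> stencil m e (\<lambda>j. y (real_of_int j * h))\<bar>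
      \<le> D3 * h ^ ?Q"
    using stencil_chain_rule[OF assms(1) D1(1) assms(3)] by blast
  define D4 where "D4 = D2 * (1 + real m ^ 3) + C"
  have D4: "0 \<le> D4" "D2 \<le> D4" "C \<le> D4" "D2 * real m ^ 3 \<le> D4" "D2 * (real m)\<^sup>2 \<le> D4"
  proof -
    have "(real m)\<^sup>2 \<le> real m ^ 3" using m by (intro power_increasing) auto
    then have "D2 * (real m)\<^sup>2 \<le> D2 * real m ^ 3" using D2(1) by (rule mult_left_mono)
    moreover have "0 \<le> D2 * real m ^ 3" using D2(1) by simp
    ultimately show "0 \<le> D4" "D2 \<le> D4" "C \<le> D4" "D2 * real m ^ 3 \<le> D4" "D2 * (real m)\<^sup>2 \<le> D4"
      using D2(1) assms(2) by (simp_all add: D4_def algebra_simps)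
  qed
  obtain D5 where D5: "0 \<le> D5" "\<And>h \<tau> \<beta> X n u a g v.
    0 < h \<and> h \<le> 1 \<and> \<bar>\<tau>\<bar> \<le> h \<and> \<bar>\<beta>\<bar> \<le> h\<^sup>2 \<and> norm u \<le> D4 \<and> norm a \<le> D4 \<and> norm v \<le> D4 \<and>
    (\<forall>l. \<bar>l\<bar> \<le> int m \<longrightarrow>
      norm (X (n + l) - X n - (real_of_int l * h) *\<^sub>R u - ((real_of_int l * h)\<^sup>2 / 2) *\<^sub>R a) \<le> D4 * h ^ 3 \<and>
      \<bar>U (X (n + l)) - U (X n) - (real_of_int l * h) * (g \<bullet> u)\<bar> \<le> D4 * h\<^sup>2) \<and>
    increment X n - increment X (n - 1) = \<tau> *\<^sub>R ((increment X n + increment X (n - 1)) \<times> b) - h\<^sup>2 *\<^sub>R g \<and>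
    increment X n + increment X (n - 1) = (2 * h) *\<^sub>R (v + \<beta> *\<^sub>R ((v \<times> b) \<times> b))
    \<Longrightarrow> \<bar>discrete_energy m e U b h \<tau> X n - energy U (X n) v\<bar> \<le> D5 * h\<^sup>2"
    using discrete_energy_expansion[OF assms(3) D4(1), of U b] by blast
  have "\<bar>discrete_energy m e U b h (\<tau> h) (\<lambda>p. x (nat p)) (int n) - energy U (x n) (v n)\<bar> \<le> (D3 + D5) * h\<^sup>2 \<and>
      \<bar>discrete_energy m e U b h (\<tau> h) (\<lambda>p. x (nat p)) (int n)
        - discrete_energy m e U b h (\<tau> h) (\<lambda>p. x (nat p)) (int n - 1)\<bar> \<le> (D3 + D5) * h ^ ?Q"
    if exs: "EXS_O2 U B x0 v0 h x v" and B: "\<forall>y. B y = b" and h: "0 < h" "h \<le> 1" "h * norm b \<le> 1"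
      and bd: "\<forall>n\<le>L. norm (x n) \<le> C \<and> norm (v n) \<le> C" and n: "m \<le> n" "n + m \<le> L"
    for B x0 v0 h x v L n
  proof -
    have orb: "boris_orbit (electric_field U) b (C + G) h (\<tau> h) L x"
      unfolding \<tau>_def using B bd G(2) by (intro EXS_O2_boris_orbit[OF exs _ h]) auto
    obtain y where y: "\<forall>i. bounded_derivs ?Q D1 (real m) (\<lambda>t. y t $ i)"
      and yx: "\<And>l. \<bar>l\<bar> \<le> int m \<Longrightarrow> y (real_of_int l * h) = x (nat (int n + l))"
      using D1(2)[OF orb n] by blast
    have y0: "y 0 = x n" using yx[of 0] by simp
    obtain u a where u: "norm u \<le> D2" "norm a \<le> D2"
      and y_expand: "\<And>t. \<bar>t\<bar> \<le> real m \<Longrightarrow>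
        norm (y t - y 0 - t *\<^sub>R u - (t\<^sup>2 / 2) *\<^sub>R a) \<le> D2 * \<bar>t\<bar> ^ 3 \<and>
        \<bar>U (y t) - U (y 0) - t * (grad U (y 0) \<bullet> u)\<bar> \<le> D2 * t\<^sup>2"
      using D2(2)[of y] y bounded_derivs_le[of ?Q D1 "real m" _ 3] by auto
    define X where "X = (\<lambda>p. x (nat p))"
    have Xn: "X (int n) = x n" by (simp add: X_def)
    obtain k where k: "n = Suc k" using n m by (cases n) auto
    have inc: "increment X (int n) = fdiff x (Suc k)" "increment X (int n - 1) = fdiff x k"
      by (simp_all add: increment_def X_def k fdiff_def nat_add_distrib)
    note cf = EXS_O2_constant_field(1,2)[OF exs B[rule_format] h(1,3), of k]
      EXS_O2_constant_field(3,4)[OF exs B[rule_format] h(1,3)]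
    have rec: "increment X (int n) - increment X (int n - 1)
        = \<tau> h *\<^sub>R ((increment X (int n) + increment X (int n - 1)) \<times> b) + h\<^sup>2 *\<^sub>R electric_field U (x n)"
      unfolding inc unfolding \<tau>_def k by (rule cf(2))
    define \<beta> where "\<beta> = (1 - cos (h / 2 * norm b)) / (norm b)\<^sup>2"
    have vel: "increment X (int n) + increment X (int n - 1) = (2 * h) *\<^sub>R (v n + \<beta> *\<^sub>R ((v n \<times> b) \<times> b))"
      unfolding inc unfolding \<beta>_def k by (rule cf(1))
    have small: "\<bar>\<tau> h\<bar> \<le> h" "\<bar>\<beta>\<bar> \<le> h\<^sup>2"
      using cf(3,4) by (simp_all add: \<tau>_def \<beta>_def)
    have expand: "norm (X (int n + l) - X (int n) - (real_of_int l * h) *\<^sub>R u - ((real_of_int l * h)\<^sup>2 / 2) *\<^sub>R a) \<le> D4 * h ^ 3 \<and>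
      \<bar>U (X (int n + l)) - U (X (int n)) - (real_of_int l * h) * (grad U (x n) \<bullet> u)\<bar> \<le> D4 * h\<^sup>2"
      if l: "\<bar>l\<bar> \<le> int m" for l
    proof -
      have "\<bar>real_of_int l\<bar> \<le> real m" using l by linarith
      then have lh: "\<bar>real_of_int l * h\<bar> \<le> real m * h" "real m * h \<le> real m"
        using h by (auto simp: abs_mult mult_right_mono mult_left_le)
      have "D2 * \<bar>real_of_int l * h\<bar> ^ 3 \<le> D2 * (real m * h) ^ 3"
        using lh D2(1) by (intro mult_left_mono power_mono) auto
      also have "\<dots> = (D2 * real m ^ 3) * h ^ 3" by (simp add: power_mult_distrib)
      also have "\<dots> \<le> D4 * h ^ 3" using D4 h by (intro mult_right_mono) auto
      finally have 1: "D2 * \<bar>real_of_int l * h\<bar> ^ 3 \<le> D4 * h ^ 3" .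
      have "D2 * \<bar>real_of_int l * h\<bar>\<^sup>2 \<le> D2 * (real m * h)\<^sup>2"
        using lh D2(1) by (intro mult_left_mono power_mono) auto
      also have "\<dots> = (D2 * (real m)\<^sup>2) * h\<^sup>2" by (simp add: power_mult_distrib)
      also have "\<dots> \<le> D4 * h\<^sup>2" using D4 h by (intro mult_right_mono) auto
      finally have 2: "D2 * (real_of_int l * h)\<^sup>2 \<le> D4 * h\<^sup>2" by simp
      have "X (int n + l) = y (real_of_int l * h)" "X (int n) = y 0"
        using yx[OF l] y0 by (simp_all add: X_def)
      then show ?thesis
        using y_expand[of "real_of_int l * h"] lh 1 2 y0 by (auto intro: order_trans)
    qed
    have "norm (v n) \<le> C" using bd n by simp
    then have "\<bar>discrete_energy m e U b h (\<tau> h) X (int n) - energy U (X (int n)) (v n)\<bar> \<le> D5 * h\<^sup>2"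
      using h small u D4 expand vel rec
      by (intro D5(2)[where u = u and a = a and g = "grad U (x n)" and \<beta> = \<beta>])
         (auto simp: electric_field_def)
    also have "\<dots> \<le> (D3 + D5) * h\<^sup>2" using D3(1) by (intro mult_right_mono) auto
    finally have "\<bar>discrete_energy m e U b h (\<tau> h) X (int n) - energy U (x n) (v n)\<bar> \<le> (D3 + D5) * h\<^sup>2"
      unfolding Xn .
    moreover have "\<bar>discrete_energy m e U b h (\<tau> h) X (int n) - discrete_energy m e U b h (\<tau> h) X (int n - 1)\<bar>
        \<le> (D3 + D5) * h ^ ?Q"
    proof -
      have st: "stencil m e (\<lambda>j. X (int n + j)) = stencil m e (\<lambda>j. y (real_of_int j * h))"
        "stencil m e (\<lambda>j. U (X (int n + j))) = stencil m e (\<lambda>j. U (y (real_of_int j * h)))"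
        using yx by (auto simp: X_def intro!: stencil_cong)
      have "discrete_energy m e U b h (\<tau> h) X (int n) - discrete_energy m e U b h (\<tau> h) X (int n - 1)
        = stencil m e (\<lambda>j. U (y (real_of_int j * h))) - grad U (y 0) \<bullet> stencil m e (\<lambda>j. y (real_of_int j * h))"
        unfolding discrete_energy_diff[OF less_imp_neq[OF h(1), symmetric] rec] st y0
        by (simp add: electric_field_def inner_commute)
      also have "\<bar>\<dots>\<bar> \<le> D3 * h ^ ?Q" by (rule D3(2)[OF h(1,2) y])
      also have "\<dots> \<le> (D3 + D5) * h ^ ?Q" using D5(1) h by (intro mult_right_mono) auto
      finally show ?thesis .
    qed
    ultimately show ?thesis unfolding X_def by blast
  qed
  moreover have "0 \<le> D3 + D5" using D3(1) D5(1) by simp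
  ultimately show ?thesis by blast
qed

text \<open>The \<open>h\<^sup>2\<close> comes from replacing the energy by the discrete energy at both ends, and does not
accumulate; only the tiny change of the discrete energy does.\<close>

lemma EXS_O2_energy_drift:
  fixes b :: "real ^ 3"
  assumes "smooth U" "0 \<le> C"
  shows "\<exists>D\<ge>0. \<forall>B x0 v0 h x v L. EXS_O2 U B x0 v0 h x v \<and> (\<forall>y. B y = b) \<and>
      0 < h \<and> h \<le> 1 \<and> h * norm b \<le> 1 \<and> (\<forall>n\<le>L. norm (x n) \<le> C \<and> norm (v n) \<le> C) \<longrightarrow>
    \<bar>energy U (x L) (v L) - energy U (x 0) (v 0)\<bar> \<le> D * (h\<^sup>2 + real L * h ^ (2 * M + 3))"
proof -
  obtain m e where st: "stencil_order m e M"
    using central_stencil_exists[of M] unfolding stencil_order_def by blast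
  define \<tau> where "\<tau> h = sin (h / 2 * norm b) / norm b / cos (h / 2 * norm b)" for h
  let ?Q = "2 * M + 3"
  let ?G = "\<lambda>h x n. discrete_energy m e U b h (\<tau> h) (\<lambda>p. x (nat p)) (int n)"
  obtain D where D: "0 \<le> D" "\<And>B x0 v0 h x v L n. EXS_O2 U B x0 v0 h x v \<Longrightarrow> (\<forall>y. B y = b) \<Longrightarrow>
      0 < h \<Longrightarrow> h \<le> 1 \<Longrightarrow> h * norm b \<le> 1 \<Longrightarrow> (\<forall>n\<le>L. norm (x n) \<le> C \<and> norm (v n) \<le> C) \<Longrightarrow>
      m \<le> n \<Longrightarrow> n + m \<le> L \<Longrightarrow>
      \<bar>?G h x n - energy U (x n) (v n)\<bar> \<le> D * h\<^sup>2 \<and>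
      \<bar>?G h x n - discrete_energy m e U b h (\<tau> h) (\<lambda>p. x (nat p)) (int n - 1)\<bar> \<le> D * h ^ ?Q"
    using EXS_O2_energy_near_discrete_energy[OF assms st, of b] unfolding \<tau>_def by blast
  obtain S where S: "0 \<le> S" "\<And>B x0 v0 h x v n. 0 < h \<Longrightarrow> h \<le> 1 \<Longrightarrow> EXS_O2 U B x0 v0 h x v \<Longrightarrow>
    norm (x n) \<le> C \<Longrightarrow> norm (v n) \<le> C \<Longrightarrow> norm (x (Suc n)) \<le> C \<Longrightarrow>
    \<bar>energy U (x (Suc n)) (v (Suc n)) - energy U (x n) (v n)\<bar> \<le> S * h\<^sup>2"
    using EXS_O2_local_energy_error[OF assms] by blast
  let ?D = "2 * real m * S + 2 * D"
  have "\<bar>energy U (x L) (v L) - energy U (x 0) (v 0)\<bar> \<le> ?D * (h\<^sup>2 + real L * h ^ ?Q)"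
    if exs: "EXS_O2 U B x0 v0 h x v" and B: "\<forall>y. B y = b" and h: "0 < h" "h \<le> 1" "h * norm b \<le> 1"
      and bd: "\<forall>n\<le>L. norm (x n) \<le> C \<and> norm (v n) \<le> C" for B x0 v0 h x v L
  proof -
    let ?H = "\<lambda>n. energy U (x n) (v n)"
    have local: "\<bar>?H q - ?H p\<bar> \<le> real (q - p) * (S * h\<^sup>2)" if "p \<le> q" "q \<le> L" for p q
      using that bd by (intro telescoped_bound[where f = ?H] S(2)[OF h(1,2) exs]) auto
    have Lh: "0 \<le> real L * h ^ ?Q" using h by simp
    have "\<bar>?H L - ?H 0\<bar> \<le> 2 * real m * (S * h\<^sup>2) + 2 * D * h\<^sup>2 + D * (real L * h ^ ?Q)"
    \<comment> \<open>The discrete energy needs \<open>m\<close> points on either side. The first and the last \<open>m\<close> steps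
      are covered by the local error, and so is everything when \<open>L \<le> 2 * m\<close>.\<close>
    proof (cases "L \<le> 2 * m")
      case True
      have "real (L - 0) * (S * h\<^sup>2) \<le> real (2 * m) * (S * h\<^sup>2)"
        using True S(1) by (intro mult_right_mono) auto
      moreover have "0 \<le> D * h\<^sup>2" "0 \<le> D * (real L * h ^ ?Q)" using D(1) Lh by auto
      ultimately show ?thesis using local[of 0 L] by simp
    next
      case False
      note G = D(2)[OF exs B h bd]
      have "\<bar>?G h x (L - m) - ?G h x m\<bar> \<le> real (L - m - m) * (D * h ^ ?Q)"
      proof (rule telescoped_bound[where f = "?G h x"])
        fix n assume "m \<le> n" "n < L - m"
        then show "\<bar>?G h x (Suc n) - ?G h x n\<bar> \<le> D * h ^ ?Q"
          using G[of "Suc n"] by simp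
      qed (use False in auto)
      also have "\<dots> \<le> real L * (D * h ^ ?Q)"
        using D(1) h by (intro mult_right_mono) auto
      also have "\<dots> = D * (real L * h ^ ?Q)" by simp
      finally have "\<bar>?G h x (L - m) - ?G h x m\<bar> \<le> D * (real L * h ^ ?Q)" .
      moreover have "\<bar>?G h x (L - m) - ?H (L - m)\<bar> \<le> D * h\<^sup>2" "\<bar>?G h x m - ?H m\<bar> \<le> D * h\<^sup>2"
        using G[of "L - m"] G[of m] False by auto
      moreover have "\<bar>?H m - ?H 0\<bar> \<le> real m * (S * h\<^sup>2)" "\<bar>?H L - ?H (L - m)\<bar> \<le> real m * (S * h\<^sup>2)"
        using local[of 0 m] local[of "L - m" L] False by auto
      ultimately show ?thesis by linarith
    qed
    also have "\<dots> \<le> ?D * (h\<^sup>2 + real L * h ^ ?Q)"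
    proof -
      have "0 \<le> 2 * real m * S * (real L * h ^ ?Q)" "0 \<le> D * (real L * h ^ ?Q)"
        using S(1) D(1) Lh by auto
      then show ?thesis by (simp add: algebra_simps)
    qed
    finally show ?thesis .
  qed
  moreover have "0 \<le> ?D" using S(1) D(1) by simp
  ultimately show ?thesis by blast
qed

lemma energy_bounded_on_compact:
  assumes "smooth U" "compact K"
  shows "\<exists>M\<ge>0. \<forall>x v. (x, v) \<in> K \<longrightarrow> \<bar>energy U x v\<bar> \<le> M"
proof -
  have "continuous_on K (\<lambda>z. (norm (snd z))\<^sup>2 / 2 + U (fst z))"
    using continuous_on_compose2[OF smooth_continuous[OF assms(1)] continuous_on_fst[OF continuous_on_id], of K]
    by (intro continuous_intros) auto
  then have "compact ((\<lambda>z. (norm (snd z))\<^sup>2 / 2 + U (fst z)) ` K)"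
    using assms(2) by (rule compact_continuous_image)
  then obtain M where "\<forall>z\<in>K. \<bar>(norm (snd z))\<^sup>2 / 2 + U (fst z)\<bar> \<le> M"
    using compact_imp_bounded by (fastforce simp: bounded_iff)
  then show ?thesis
    by (intro exI[of _ "max 0 M"]) (force simp: energy_def)
qed

text \<open>With a stencil whose error is of order \<open>2 * N + 3\<close> the drift accumulated over times up to
\<open>h powi (2 - N)\<close> is still of order \<open>h\<^sup>2\<close>.\<close>

lemma EXS_O2_long_time_constant_field:
  fixes U :: "real ^ 3 \<Rightarrow> real" and K :: "((real ^ 3) \<times> (real ^ 3)) set"
  assumes U: "smooth U" and B: "constant_field B" and K: "compact K"
  shows "\<exists>C. \<forall>h>0. \<forall>x v. EXS_O2 U B x0 v0 h x v \<and>
            (\<forall>n. real n * h \<le> h powi (2 - int N) \<longrightarrow> (x n, v n) \<in> K) \<longrightarrow>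
          (\<forall>n. real n * h \<le> h powi (2 - int N) \<longrightarrow>
            \<bar>energy U (x n) (v n) - energy U (x 0) (v 0)\<bar> \<le> C * h\<^sup>2)"
proof -
  obtain b where b: "\<forall>y. B y = b" using B unfolding constant_field_def by blast
  obtain R where R: "\<And>z. z \<in> K \<Longrightarrow> norm z \<le> R"
    using compact_imp_bounded[OF K] by (auto simp: bounded_iff)
  have R': "norm x \<le> max 0 R \<and> norm v \<le> max 0 R" if "(x, v) \<in> K" for x v
    using R[OF that] norm_fst_le[of x v] norm_snd_le[of v x] by linarith
  obtain M where M: "0 \<le> M" "\<And>x v. (x, v) \<in> K \<Longrightarrow> \<bar>energy U x v\<bar> \<le> M"
    using energy_bounded_on_compact[OF U K] by blast
  obtain D where D: "0 \<le> D" "\<And>h x v L. EXS_O2 U B x0 v0 h x v \<Longrightarrow> 0 < h \<Longrightarrow> h \<le> 1 \<Longrightarrow> h * norm b \<le> 1 \<Longrightarrow>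
      (\<forall>n\<le>L. norm (x n) \<le> max 0 R \<and> norm (v n) \<le> max 0 R) \<Longrightarrow>
    \<bar>energy U (x L) (v L) - energy U (x 0) (v 0)\<bar> \<le> D * (h\<^sup>2 + real L * h ^ (2 * N + 3))"
    using EXS_O2_energy_drift[OF U, of "max 0 R" b N] b by auto
  \<comment> \<open>Below \<open>h0\<close> half a gyration step turns by at most half a radian, which keeps the cosine in
    the denominator of the recurrence away from zero.\<close>
  define h0 where "h0 = 1 / (1 + norm b)"
  have h0: "0 < h0" "h0 \<le> 1" "h0 * norm b \<le> 1"
    by (auto simp: h0_def divide_le_eq add_pos_nonneg)
  let ?C = "2 * D + 2 * M / h0\<^sup>2"
  have "\<bar>energy U (x n) (v n) - energy U (x 0) (v 0)\<bar> \<le> ?C * h\<^sup>2"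
    if h: "0 < h" and exs: "EXS_O2 U B x0 v0 h x v"
      and inK: "\<And>n. real n * h \<le> h powi (2 - int N) \<Longrightarrow> (x n, v n) \<in> K"
      and n: "real n * h \<le> h powi (2 - int N)" for h x v n
  proof -
    have inK': "(x k, v k) \<in> K" if "k \<le> n" for k
    proof (rule inK)
      have "real k * h \<le> real n * h" using that h by (intro mult_right_mono) auto
      then show "real k * h \<le> h powi (2 - int N)" using n by linarith
    qed
    show ?thesis
    proof (cases "h \<le> h0")
      case True
      have hb: "h * norm b \<le> 1"
        using mult_right_mono[OF True norm_ge_zero[of b]] h0(3) by linarith
      have h1: "h \<le> 1" using True h0 by linarith
      have "real n * h ^ (2 * N + 3) = (real n * h) * h ^ (2 * N + 2)" by (simp add: eval_nat_numeral)
      also have "\<dots> \<le> h powi (2 - int N) * h ^ (2 * N + 2)"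
        using n h by (intro mult_right_mono) auto
      also have "\<dots> = h powi (2 - int N + int (2 * N + 2))"
        using power_int_add[of h "2 - int N" "int (2 * N + 2)"] h by (simp only: power_int_of_nat) simp
      also have "2 - int N + int (2 * N + 2) = int (N + 4)" by simp
      also have "h powi int (N + 4) = h ^ (N + 4)" by (rule power_int_of_nat)
      also have "h ^ (N + 4) \<le> h\<^sup>2" using h h1 by (intro power_decreasing) auto
      finally have nh: "real n * h ^ (2 * N + 3) \<le> h\<^sup>2" .
      have "\<bar>energy U (x n) (v n) - energy U (x 0) (v 0)\<bar> \<le> D * (h\<^sup>2 + real n * h ^ (2 * N + 3))"
        using inK' R' by (intro D(2)[OF exs h h1 hb]) blast
      also have "\<dots> \<le> D * (h\<^sup>2 + h\<^sup>2)" using nh D(1) by (intro mult_left_mono) auto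
      also have "\<dots> \<le> ?C * h\<^sup>2"
        using M(1) by (simp add: algebra_simps)
      finally show ?thesis .
    next
      case False
      \<comment> \<open>For steps bounded below the energy is bounded on \<open>K\<close>, and \<open>h\<^sup>2\<close> is bounded below.\<close>
      have "\<bar>energy U (x n) (v n) - energy U (x 0) (v 0)\<bar> \<le> 2 * M"
        using M(2)[OF inK'[of n]] M(2)[OF inK'[of 0]] by simp
      also have "\<dots> = 2 * M / h0\<^sup>2 * h0\<^sup>2" using h0 by simp
      also have "\<dots> \<le> 2 * M / h0\<^sup>2 * h\<^sup>2"
        using False h0 M(1) by (intro mult_left_mono power_mono) auto
      also have "\<dots> \<le> ?C * h\<^sup>2" using D(1) by (intro mult_right_mono) auto
      finally show ?thesis .
    qed
  qed
  then show ?thesis by (intro exI[of _ ?C]) blast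
qed

text \<open>The modified energy differs from the energy by \<open>h\<^sup>2\<close> times a quantity that is bounded on \<open>K\<close>.\<close>

lemma EXS_O2_long_time_quadratic:
  fixes U :: "real ^ 3 \<Rightarrow> real" and K :: "((real ^ 3) \<times> (real ^ 3)) set"
  assumes U: "smooth U" "quadratic_potential U" and K: "compact K"
  shows "\<exists>C. \<forall>h>0. \<forall>B x v n. EXS_O2 U B x0 v0 h x v \<and> (x 0, v 0) \<in> K \<and> (x n, v n) \<in> K \<longrightarrow>
            \<bar>energy U (x n) (v n) - energy U (x 0) (v 0)\<bar> \<le> C * h\<^sup>2"
proof -
  obtain R where R: "\<And>z. z \<in> K \<Longrightarrow> norm z \<le> R"
    using compact_imp_bounded[OF K] by (auto simp: bounded_iff)
  obtain G where G: "0 \<le> G" "\<And>x. norm x \<le> R \<Longrightarrow> norm (grad U x) \<le> G"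
    using smooth_grad_bounded[OF U(1)] by blast
  have G': "(norm (grad U x))\<^sup>2 \<le> G\<^sup>2" if "(x, v) \<in> K" for x v
    using R[OF that] norm_fst_le[of x v] by (intro power_mono G(2)) auto
  have "\<bar>energy U (x n) (v n) - energy U (x 0) (v 0)\<bar> \<le> G\<^sup>2 * h\<^sup>2"
    if exs: "EXS_O2 U B x0 v0 h x v" and z: "(x 0, v 0) \<in> K" "(x n, v n) \<in> K" for B h x v n
  proof -
    have "modified_energy U h (x n) (v n) = modified_energy U h (x 0) (v 0)"
      by (induction n) (simp_all add: EXS_O2_modified_energy_step[OF U(2) exs])
    then have "energy U (x n) (v n) - energy U (x 0) (v 0)
        = h\<^sup>2 / 8 * ((norm (grad U (x n)))\<^sup>2 - (norm (grad U (x 0)))\<^sup>2)"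
      by (simp add: modified_energy_def energy_def right_diff_distrib)
    also have "\<bar>\<dots>\<bar> \<le> h\<^sup>2 * G\<^sup>2"
    proof -
      have "\<bar>(norm (grad U (x n)))\<^sup>2 - (norm (grad U (x 0)))\<^sup>2\<bar> \<le> G\<^sup>2"
        using G'[OF z(1)] G'[OF z(2)] by (smt (verit) zero_le_power2)
      then show ?thesis unfolding abs_mult by (intro mult_mono) auto
    qed
    finally show ?thesis by (simp add: mult.commute)
  qed
  then show ?thesis by blast
qed

theorem theorem3p1:
  fixes U :: "real ^ 3 \<Rightarrow> real" and A B :: "real ^ 3 \<Rightarrow> real ^ 3"
    and x0 v0 :: "real ^ 3" and T :: real and K :: "((real ^ 3) \<times> (real ^ 3)) set"
  assumes "smooth U" and "smooth B"
    and "\<And>x. A differentiable (at x)" and "\<And>x. B x = curl A x"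
    and "T > 0" and "compact K"
  shows "(\<forall>h>0. \<forall>x v. IMS_O2 U B x0 v0 h x v \<and> (\<forall>n. real n * h \<le> T \<longrightarrow> (x n, v n) \<in> K) \<longrightarrow>
            (\<forall>n. real n * h \<le> T \<longrightarrow> energy U (x n) (v n) = energy U (x 0) (v 0)))
       \<and> (constant_field B \<or> quadratic_potential U \<longrightarrow>
            (\<forall>N::nat. N > 0 \<longrightarrow>
              (\<exists>C. \<forall>h>0. \<forall>x v. EXS_O2 U B x0 v0 h x v \<and>
                  (\<forall>n. real n * h \<le> h powi (2 - int N) \<longrightarrow> (x n, v n) \<in> K) \<longrightarrow>
                (\<forall>n. real n * h \<le> h powi (2 - int N) \<longrightarrow>
                  \<bar>energy U (x n) (v n) - energy U (x 0) (v 0)\<bar> \<le> C * h\<^sup>2))))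
       \<and> (quadratic_potential U \<longrightarrow>
            (\<forall>h>0. \<forall>x v. EXS_O2 U B x0 v0 h x v \<and> (\<forall>n. real n * h \<le> T \<longrightarrow> (x n, v n) \<in> K) \<longrightarrow>
              (\<forall>n. real n * h \<le> T \<longrightarrow>
                modified_energy U h (x (Suc n)) (v (Suc n)) = modified_energy U h (x n) (v n))))"
proof (intro conjI impI allI; (elim conjE)?)
  fix h x v n assume "IMS_O2 U B x0 v0 h x v"
  then show "energy U (x n) (v n) = energy U (x 0) (v 0)"
    by (induction n) (simp_all add: IMS_O2_energy_step[OF assms(1)])
next
  fix N :: nat assume or: "constant_field B \<or> quadratic_potential U"
  show "\<exists>C. \<forall>h>0. \<forall>x v. EXS_O2 U B x0 v0 h x v \<and>
            (\<forall>n. real n * h \<le> h powi (2 - int N) \<longrightarrow> (x n, v n) \<in> K) \<longrightarrow>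
          (\<forall>n. real n * h \<le> h powi (2 - int N) \<longrightarrow>
            \<bar>energy U (x n) (v n) - energy U (x 0) (v 0)\<bar> \<le> C * h\<^sup>2)"
    using or
  proof
    assume "constant_field B"
    then show ?thesis by (rule EXS_O2_long_time_constant_field[OF assms(1) _ assms(6)])
  next
    assume "quadratic_potential U"
    then obtain C where C: "\<And>h x v n. 0 < h \<Longrightarrow> EXS_O2 U B x0 v0 h x v \<Longrightarrow> (x 0, v 0) \<in> K \<Longrightarrow> (x n, v n) \<in> K \<Longrightarrow>
        \<bar>energy U (x n) (v n) - energy U (x 0) (v 0)\<bar> \<le> C * h\<^sup>2"
      using EXS_O2_long_time_quadratic[OF assms(1) _ assms(6), of x0 v0] by blast
    have "real 0 * h \<le> h powi (2 - int N)" if "0 < h" for h :: real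
      using that by simp
    then show ?thesis using C by (intro exI[of _ C]) blast
  qed
next
  fix h x v n assume "quadratic_potential U" "EXS_O2 U B x0 v0 h x v"
  then show "modified_energy U h (x (Suc n)) (v (Suc n)) = modified_energy U h (x n) (v n)"
    by (rule EXS_O2_modified_energy_step)
qed

end
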